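(* Let $F_{50}:=(6,\{02,03,05,12,13,45\})$. Then $\lambda_{F_{50}}=5/54$. Furthermore, the $F_{50}$-problem is perfectly $B$-stable with $B:=(6,\{01,12,23,34,45,50\})$, and the unique (up to automorphisms of $B$) maximiser of $p(F_{50},B(\boldsymbol x))$ over $\boldsymbol x\in\mathbb S_6$ is $\boldsymbol x=(1/6,1/6,1/6,1/6,1/6,1/6)$.
   Context: All graphs are finite and simple. $(m,E)$ denotes the graph or pattern with vertex set $\{0,\dots,m-1\}$ and edge set $E$; $ij$ abbreviates $\{i,j\}$ ($ii$ is a loop). For graphs $F,G$ with $\kappa\le n$ vertices, $p(F,G)$ is the number of $\kappa$-subsets of $V(G)$ inducing a subgraph isomorphic to $F$, divided by $\binom n\kappa$; $p(F,n)$ is the maximum of $p(F,G)$ over $n$-vertex graphs $G$; $\lambda_F=\lim_{n\to\infty}p(F,n)$ (the limit exists). A pattern is a graph in which loops are allowed; its automorphisms are the bijections of the vertex set preserving edges, non-edges, loops and non-loops. For a pattern $B$ on $\{0,\dots,m-1\}$ and disjoint (possibly empty) sets $V_0,\dots,V_{m-1}$, the blowup $B(V_0,\dots,V_{m-1})$ is the simple graph on $\bigcup V_i$ in which distinct $x\in V_i$, $y\in V_j$ are adjacent iff $\{i,j\}\in E(B)$ (so $V_i$ is a clique if $i$ has a loop and independent otherwise); $B()$ is the family of all blowups. $\mathbb S_m=\{\boldsymbol x\in\mathbb R^m:x_i\ge0,\sum x_i=1\}$, and $p(F,B(\boldsymbol x))$ is the limit as $n\to\infty$ of $p(F,B(V_0,\dots,V_{m-1}))$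 with $|V_i|=(x_i+o(1))n$. $\delta_{\mathrm{edit}}(G,B())$ is the minimum number of vertex pairs whose adjacency must be changed to turn $G$ into a graph isomorphic to a blowup of $B$ (of the same order). The $F$-problem is perfectly $B$-stable if there is $C>0$ such that every graph $G$ with $n\ge C$ vertices satisfies $\delta_{\mathrm{edit}}(G,B())\le C\,(p(F,n)-p(F,G))\,n^2$. *)

theory Defs
  imports Complex_Main "HOL-Library.Disjoint_Sets"
begin

text \<open>
  A graph or pattern is a pair of a vertex set and an edge set. An edge is the set \<open>{i, j}\<close> of its
  endpoints, so a loop at \<open>i\<close> is the singleton \<open>{i, i} = {i}\<close>. Vertices are natural numbers; every
  finite graph is isomorphic to such a graph, and all the notions below are invariant under
  isomorphism.
\<close>

type_synonym graph = "nat set \<times> nat set set"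

abbreviation verts :: "graph \<Rightarrow> nat set" where "verts G \<equiv> fst G"
abbreviation edges :: "graph \<Rightarrow> nat set set" where "edges G \<equiv> snd G"

definition pattern :: "graph \<Rightarrow> bool" where
  "pattern B \<longleftrightarrow> finite (verts B) \<and> (\<forall>e\<in>edges B. e \<subseteq> verts B \<and> card e \<in> {1, 2})"

definition simple_graph :: "graph \<Rightarrow> bool" where
  "simple_graph G \<longleftrightarrow> finite (verts G) \<and> (\<forall>e\<in>edges G. e \<subseteq> verts G \<and> card e = 2)"

text \<open>The case \<open>x = y\<close> below says that loops and non-loops are preserved.\<close>

definition graph_iso :: "(nat \<Rightarrow> nat) \<Rightarrow> graph \<Rightarrow> graph \<Rightarrow> bool" where
  "graph_iso f G H \<longleftrightarrow> bij_betw f (verts G) (verts H) \<and>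
     (\<forall>x\<in>verts G. \<forall>y\<in>verts G. {x, y} \<in> edges G \<longleftrightarrow> {f x, f y} \<in> edges H)"

definition isomorphic :: "graph \<Rightarrow> graph \<Rightarrow> bool" where
  "isomorphic G H \<longleftrightarrow> (\<exists>f. graph_iso f G H)"

definition automorphism :: "graph \<Rightarrow> (nat \<Rightarrow> nat) \<Rightarrow> bool" where
  "automorphism B \<sigma> \<longleftrightarrow> graph_iso \<sigma> B B"

definition induced_subgraph :: "graph \<Rightarrow> nat set \<Rightarrow> graph" where
  "induced_subgraph G S = (S, {e \<in> edges G. e \<subseteq> S})"

text \<open>\<open>p(F, G)\<close>; it equals 0 by convention when \<open>G\<close> has fewer vertices than \<open>F\<close>.\<close>

definition induced_density :: "graph \<Rightarrow> graph \<Rightarrow> real" where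
  "induced_density F G =
     real (card {S. S \<subseteq> verts G \<and> card S = card (verts F) \<and> isomorphic (induced_subgraph G S) F})
     / real (card (verts G) choose card (verts F))"

text \<open>\<open>p(F, n)\<close>. The maximum is over a finite set of values although there are infinitely many
  graphs on \<open>n\<close> natural numbers.\<close>

definition max_density :: "graph \<Rightarrow> nat \<Rightarrow> real" where
  "max_density F n = Max {induced_density F G | G. simple_graph G \<and> card (verts G) = n}"

definition inducibility :: "graph \<Rightarrow> real" where
  "inducibility F = lim (max_density F)"

text \<open>Only the parts \<open>V i\<close> with \<open>i \<in> verts B\<close> matter.\<close>

definition blowup :: "graph \<Rightarrow> (nat \<Rightarrow> nat set) \<Rightarrow> graph" where
  "blowup B V =
     (\<Union>i\<in>verts B. V i,
      {{x, y} | x y. x \<noteq> y \<and>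
         (\<exists>i\<in>verts B. \<exists>j\<in>verts B. x \<in> V i \<and> y \<in> V j \<and> {i, j} \<in> edges B)})"

definition blowup_parts :: "graph \<Rightarrow> (nat \<Rightarrow> nat set) \<Rightarrow> bool" where
  "blowup_parts B V \<longleftrightarrow> (\<forall>i\<in>verts B. finite (V i)) \<and> disjoint_family_on V (verts B)"

definition blowups :: "graph \<Rightarrow> graph set" where
  "blowups B = {blowup B V | V. blowup_parts B V}"

definition prob_simplex :: "nat set \<Rightarrow> (nat \<Rightarrow> real) set" where
  "prob_simplex I = {x. (\<forall>i\<in>I. x i \<ge> 0) \<and> (\<Sum>i\<in>I. x i) = 1}"

text \<open>\<open>p(F, B(x))\<close>: the common limit of \<open>p(F, B(V\<^sub>0, \<dots>, V\<^bsub>m-1\<^esub>))\<close> over all sequences of parts with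
  \<open>|V\<^sub>i| = (x\<^sub>i + o(1)) n\<close>.\<close>

definition blowup_density :: "graph \<Rightarrow> graph \<Rightarrow> (nat \<Rightarrow> real) \<Rightarrow> real" where
  "blowup_density F B x = (THE l. \<forall>V :: nat \<Rightarrow> nat \<Rightarrow> nat set.
     (\<forall>n. blowup_parts B (V n)) \<and>
     (\<forall>i\<in>verts B. (\<lambda>n. real (card (V n i)) / real n) \<longlonglongrightarrow> x i) \<longrightarrow>
     (\<lambda>n. induced_density F (blowup B (V n))) \<longlonglongrightarrow> l)"

definition edit_distance :: "graph \<Rightarrow> graph \<Rightarrow> nat" where
  "edit_distance G B =
     Min {card ((edges G - edges H) \<union> (edges H - edges G)) | H.
            simple_graph H \<and> verts H = verts G \<and> (\<exists>K\<in>blowups B. isomorphic H K)}"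

definition perfectly_stable :: "graph \<Rightarrow> graph \<Rightarrow> bool" where
  "perfectly_stable F B \<longleftrightarrow> (\<exists>C::real. C > 0 \<and>
     (\<forall>G. simple_graph G \<and> real (card (verts G)) \<ge> C \<longrightarrow>
        real (edit_distance G B)
          \<le> C * (max_density F (card (verts G)) - induced_density F G) * (real (card (verts G)))\<^sup>2))"

definition maximiser :: "graph \<Rightarrow> graph \<Rightarrow> (nat \<Rightarrow> real) \<Rightarrow> bool" where
  "maximiser F B x \<longleftrightarrow> x \<in> prob_simplex (verts B) \<and>
     (\<forall>y\<in>prob_simplex (verts B). blowup_density F B y \<le> blowup_density F B x)"

text \<open>Weight vectors are compared only on \<open>verts B\<close>, since their values elsewhere are irrelevant.\<close>

definition unique_maximiser_up_to_aut :: "graph \<Rightarrow> graph \<Rightarrow> (nat \<Rightarrow> real) \<Rightarrow> bool" where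
  "unique_maximiser_up_to_aut F B x \<longleftrightarrow> maximiser F B x \<and>
     (\<forall>y. maximiser F B y \<longrightarrow> (\<exists>\<sigma>. automorphism B \<sigma> \<and> (\<forall>i\<in>verts B. y i = x (\<sigma> i))))"

definition F50 :: graph where
  "F50 = ({..<6}, {{0,2}, {0,3}, {0,5}, {1,2}, {1,3}, {4,5}})"

definition C6_pattern :: graph where
  "C6_pattern = ({..<6}, {{0,1}, {1,2}, {2,3}, {3,4}, {4,5}, {5,0}})"

lemma simple_graph_F50: "simple_graph F50"
  by (auto simp: simple_graph_def F50_def)

lemma pattern_C6_pattern: "pattern C6_pattern"
  by (auto simp: pattern_def C6_pattern_def)

end

theory Submission
  imports Defs "HOL-Combinatorics.Multiset_Permutations"
begin

text \<open>
  Call a 6-tuple \<open>(i, j, k, l, u, v)\<close> of vertices a match if \<open>i j k l\<close> is an induced path, \<open>u\<close> is adjacent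
  to \<open>i\<close> only among the four, \<open>v\<close> to \<open>j\<close> only, and \<open>u\<close> and \<open>v\<close> are adjacent. The vertices of a match
  induce a copy of \<open>F50\<close> when they are distinct, and every copy arises from exactly two of its 720
  orderings. Hence, up to a factor tending to 1, \<open>p(F50, G)\<close> is 360 times the probability that six
  independent random vertices form a match, and the value \<open>5 / 54\<close> says that this probability is at
  most \<open>1 / 3888\<close>, for every graph with weighted vertices. The balanced hexagon attains it.

  The bound is a sum of squares. To each 6-tuple a \<open>loss\<close> is assigned: 62208 if it is a match, plus
  a quadratic form in the ways in which \<open>u\<close> and \<open>v\<close> are attached to \<open>i, j, k, l\<close>, plus twice a \<open>defect\<close>.
  The forms are positive definite, so they are nonnegative on average (\<open>psd_sum_nonneg\<close>), and over
  the 720 orderings of any six vertices the loss is at most 16 on average (\<open>total_loss_le\<close>, a finite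
  check over the graphs on six vertices up to isomorphism). Taking means gives
  \<open>62208 P(match) + 2 E(defect) \<le> 16\<close> (\<open>core_inequality\<close>), where \<open>16 / 62208 = 1 / 3888\<close>.

  The defect carries the rest of the theorem. An induced path \<open>i j k l\<close>, placed on the vertices
  0, 1, 2, 3 of the hexagon, suggests a position in the hexagon for every vertex \<open>u\<close>, namely the one
  with the same neighbours in the path. The defect of the path is the proportion of pairs whose
  adjacency disagrees with these positions (or which contain a vertex without position), plus the sum
  of the squared differences between the weights of consecutive positions. Choosing the best path,
  a graph with nearly maximal match probability has a colouring by the hexagon with few wrong pairs
  (\<open>ex_colouring\<close>), and a weighted hexagon with nearly maximal match probability has nearly equal
  weights (\<open>imbalance_le\<close>). The latter with equality gives uniqueness of the maximiser.

  For perfect stability, the wrong pairs must be bounded by the deficit of \<open>G\<close> from the maximum over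
  graphs of the same order and not only from the limit. Let \<open>c\<close> be a colouring of \<open>G\<close> with the fewest
  wrong pairs, a proportion \<open>\<beta>\<close>, and let \<open>G'\<close> be the blowup with colouring \<open>c\<close>. The above shows that
  the colour classes are nearly balanced. Give each vertex weight inversely proportional to the size
  of its class: then \<open>G'\<close> has match probability exactly \<open>1 / 3888\<close>, whereas \<open>ex_colouring\<close> bounds that
  of \<open>G\<close> by \<open>1 / 3888\<close> minus a constant times \<open>\<beta>\<close>. So \<open>G'\<close> beats \<open>G\<close> by a constant times \<open>\<beta>\<close>. Returning
  to equal weights and to distinct vertices affects only tuples that are a match in exactly one of the
  two graphs, hence costs only a small multiple of \<open>\<beta>\<close> (\<open>copies_gain\<close>). As \<open>G'\<close> has the same order as
  \<open>G\<close>, its density is at most the maximum.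
\<close>

section \<open>Positive definite integer matrices\<close>

fun dot :: "int list \<Rightarrow> int list \<Rightarrow> int" where
  "dot (x # xs) (y # ys) = x * y + dot xs ys"
| "dot _ _ = 0"

text \<open>The symmetric bilinear form whose matrix has upper triangle \<open>M\<close>: row number \<open>i\<close> lists the entries
  from the diagonal onwards.\<close>

fun bil :: "int list list \<Rightarrow> int list \<Rightarrow> int list \<Rightarrow> int" where
  "bil ((d # r) # M) (x # xs) (y # ys) = d * x * y + x * dot r ys + y * dot r xs + bil M xs ys"
| "bil _ _ _ = 0"

text \<open>Evaluation equations that skip zero coordinates, since the coordinate vectors below are sparse.\<close>

lemma dot_code [code]:
  "dot (x # xs) (y # ys) = (if y = 0 then dot xs ys else x * y + dot xs ys)"
  "dot [] ys = 0" "dot xs [] = 0"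
  by simp_all

lemma bil_code [code]:
  "bil ((d # r) # M) (x # xs) (y # ys) =
     (if x = 0 then if y = 0 then bil M xs ys else y * dot r xs + bil M xs ys
      else if y = 0 then x * dot r ys + bil M xs ys
      else d * x * y + x * dot r ys + y * dot r xs + bil M xs ys)"
  "bil [] xs ys = 0" "bil M [] ys = 0"
  by auto

fun triangular :: "int list list \<Rightarrow> bool" where
  "triangular [] = True"
| "triangular (r # M) = (length r = Suc (length M) \<and> triangular M)"

text \<open>One step of fraction-free (Bareiss) elimination: \<open>d # r\<close> is the pivot row, \<open>p\<close> the previous pivot.
  All entries stay integers because they are minors of the original matrix.\<close>

fun schur :: "int \<Rightarrow> int \<Rightarrow> int list \<Rightarrow> int list list \<Rightarrow> int list list" where
  "schur p d (c # r) (row # M) = map2 (\<lambda>m x. (d * m - c * x) div p) row (c # r) # schur p d r M"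
| "schur _ _ _ _ = []"

fun schur_exact :: "int \<Rightarrow> int \<Rightarrow> int list \<Rightarrow> int list list \<Rightarrow> bool" where
  "schur_exact p d (c # r) (row # M) =
     (list_all2 (\<lambda>m x. p dvd d * m - c * x) row (c # r) \<and> schur_exact p d r M)"
| "schur_exact _ _ _ _ = True"

lemma length_schur_le: "length (schur p d r M) \<le> length M"
  by (induction p d r M rule: schur.induct) auto

text \<open>Elimination succeeds with positive pivots, so the form is positive definite.\<close>

function psd :: "int \<Rightarrow> int list list \<Rightarrow> bool" where
  "psd p [] = True"
| "psd p ([] # M) = False"
| "psd p ((d # r) # M) = (0 < d \<and> schur_exact p d r M \<and> psd d (schur p d r M))"
  by pat_completeness auto
termination
  by (relation "measure (\<lambda>(p, M). length M)") (auto simp: le_imp_less_Suc length_schur_le)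

lemma dot_schur_row:
  assumes "list_all2 (\<lambda>m x. p dvd d * m - c * x) row r"
  shows "p * dot (map2 (\<lambda>m x. (d * m - c * x) div p) row r) ys = d * dot row ys - c * dot r ys"
  using assms
proof (induction row r arbitrary: ys rule: list_all2_induct)
  case (Cons m row x r)
  then show ?case by (cases ys) (auto simp: algebra_simps)
qed simp

text \<open>Completing the square in the first coordinate.\<close>

lemma bil_schur:
  assumes "schur_exact p d r M" "triangular M" "length r = length M"
    and "length xs = length r" "length ys = length r"
  shows "p * bil (schur p d r M) xs ys = d * bil M xs ys - dot r xs * dot r ys"
  using assms
proof (induction p d r M arbitrary: xs ys rule: schur.induct)
  case (1 p d c r row M)
  obtain m ms where row: "row = m # ms" using "1.prems" by (cases row) auto
  obtain x xs' where xs: "xs = x # xs'" using "1.prems" by (cases xs) auto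
  obtain y ys' where ys: "ys = y # ys'" using "1.prems" by (cases ys) auto
  have pd: "p dvd d * m - c * c" and ex: "list_all2 (\<lambda>m x. p dvd d * m - c * x) ms r"
    using "1.prems" by (auto simp: row)
  note rowx = dot_schur_row[OF ex]
  have IH: "p * bil (schur p d r M) xs' ys' = d * bil M xs' ys' - dot r xs' * dot r ys'"
    using "1.prems" by (intro "1.IH") (auto simp: xs ys)
  have "p * bil (schur p d (c # r) (row # M)) xs ys =
      (p * ((d * m - c * c) div p)) * x * y
      + x * (p * dot (map2 (\<lambda>m x. (d * m - c * x) div p) ms r) ys')
      + y * (p * dot (map2 (\<lambda>m x. (d * m - c * x) div p) ms r) xs')
      + p * bil (schur p d r M) xs' ys'"
    by (simp add: row xs ys algebra_simps)
  also have "\<dots> = d * bil (row # M) xs ys - dot (c # r) xs * dot (c # r) ys"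
    unfolding rowx IH using pd by (simp add: row xs ys algebra_simps)
  finally show ?case .
qed auto

lemma triangular_schur:
  assumes "triangular M" "length r = length M"
  shows "triangular (schur p d r M) \<and> length (schur p d r M) = length M"
  using assms by (induction p d r M rule: schur.induct) auto

text \<open>Each elimination step splits off a square, and the double sum of a product \<open>f u * f v\<close> is the
  square of a single sum. The weights \<open>W\<close> need not be positive.\<close>

theorem psd_sum_nonneg:
  fixes W :: "'a \<Rightarrow> real"
  assumes "psd p M" "0 < p" "triangular M" "\<And>u. u \<in> X \<Longrightarrow> length (b u) = length M"
  shows "0 \<le> (\<Sum>u\<in>X. \<Sum>v\<in>X. W u * W v * of_int (bil M (b u) (b v)))"
  using assms
proof (induction p M arbitrary: b rule: psd.induct)
  case (3 p d r M)
  let ?S = "schur p d r M" and ?t = "\<lambda>u. tl (b u)"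
  let ?l = "\<lambda>u. real_of_int (dot (d # r) (b u))"
  have d: "0 < d" and tri: "triangular M" "length r = length M"
    using "3.prems" by auto
  have len: "length (?t u) = length M" if "u \<in> X" for u using "3.prems"(4)[OF that] by simp
  have eq: "d * bil ((d # r) # M) (b u) (b v) =
      dot (d # r) (b u) * dot (d # r) (b v) + p * bil ?S (?t u) (?t v)"
    if uv: "u \<in> X" "v \<in> X" for u v
  proof -
    obtain x xs where u: "b u = x # xs" using "3.prems"(4)[OF uv(1)] by (cases "b u") auto
    obtain y ys where v: "b v = y # ys" using "3.prems"(4)[OF uv(2)] by (cases "b v") auto
    have "p * bil ?S xs ys = d * bil M xs ys - dot r xs * dot r ys"
      using "3.prems" len[OF uv(1)] len[OF uv(2)] by (intro bil_schur) (auto simp: u v)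
    then show ?thesis by (simp add: u v algebra_simps)
  qed
  have sq: "(\<Sum>u\<in>X. W u * ?l u)\<^sup>2 = (\<Sum>u\<in>X. \<Sum>v\<in>X. W u * ?l u * (W v * ?l v))"
    by (simp only: power2_eq_square sum_product)
  have "0 \<le> (\<Sum>u\<in>X. \<Sum>v\<in>X. W u * W v * of_int (bil ?S (?t u) (?t v)))"
    using "3.prems" d tri triangular_schur[OF tri, of p d] len by (intro "3.IH") auto
  then have "0 \<le> (\<Sum>u\<in>X. W u * ?l u)\<^sup>2
      + p * (\<Sum>u\<in>X. \<Sum>v\<in>X. W u * W v * of_int (bil ?S (?t u) (?t v)))"
    using "3.prems"(2) by simp
  also have "\<dots> = (\<Sum>u\<in>X. \<Sum>v\<in>X. W u * ?l u * (W v * ?l v)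
      + p * (W u * W v * of_int (bil ?S (?t u) (?t v))))"
    unfolding sq by (simp add: sum_distrib_left sum.distrib)
  also have "\<dots> = (\<Sum>u\<in>X. \<Sum>v\<in>X. W u * W v * of_int (d * bil ((d # r) # M) (b u) (b v)))"
    by (intro sum.cong refl) (simp only: eq, simp add: algebra_simps)
  also have "\<dots> = d * (\<Sum>u\<in>X. \<Sum>v\<in>X. W u * W v * of_int (bil ((d # r) # M) (b u) (b v)))"
    by (simp add: sum_distrib_left algebra_simps)
  finally show ?case using d by (simp add: zero_le_mult_iff)
qed auto

section \<open>The certificate\<close>

text \<open>The four arguments say to which of the four roots \<open>i, j, k, l\<close> a further vertex is adjacent. The
  coordinates of a vertex depend on nothing else. The matrices are an exact solution of the
  semidefinite program whose constraints are the bounds on the total loss of the graphs on six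
  vertices.

  As the bound is attained by the balanced hexagon and the matrices are positive definite, each
  coordinate must sum to zero over the six vertices of the hexagon whenever the roots are placed in
  it. This linear condition explains the coordinates: most kinds of attachment have a coordinate of
  their own, and the remaining kinds are eliminated.\<close>

type_synonym coords = "bool \<Rightarrow> bool \<Rightarrow> bool \<Rightarrow> bool \<Rightarrow> int list"

definition edgeless_matrix :: "int list list" where
  "edgeless_matrix =
    [[1]]"

definition edge_matrix :: "int list list" where
  "edge_matrix =
    [[192, 67, 110, 108, 274, - 320, 564, - 68],
     [64, 120, 4, 98, - 72, 74, - 218],
     [238, - 4, 164, - 106, 70, - 462],
     [118, 150, - 224, 438, 58],
     [414, - 460, 810, - 90],
     [588, - 1088, - 72],
     [2100, 428],
     [1292]]"

definition cherry_matrix :: "int list list" where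
  "cherry_matrix =
    [[188, 148, - 38, 246, 71, 172, 77, 118, 98],
     [1200, 442, 1058, 107, 560, - 312, 18, 112],
     [254, 352, - 6, 114, - 156, - 106, 16],
     [1160, - 24, 418, 88, - 236, 208],
     [232, 234, - 345, 430, 10],
     [492, - 338, 414, 34],
     [812, - 620, 80],
     [884, - 38],
     [142]]"

definition claw_matrix :: "int list list" where
  "claw_matrix =
    [[496, - 248, 144, - 174, - 454, - 196],
     [160, - 272, 152, 258, 86],
     [1296, - 456, - 322, 12],
     [198, 222, 22],
     [456, 170],
     [316]]"

definition path_sym_matrix :: "int list list" where
  "path_sym_matrix =
    [[122, 404, 288, - 448, 144, 44, - 840, - 156, 330],
     [3399, 2726, - 3085, 572, - 156, - 5612, - 1434, 498],
     [2608, - 2700, 670, 46, - 4982, - 1110, 56],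
     [3170, - 864, - 138, 5878, 1240, - 856],
     [428, 240, - 1686, - 182, 468],
     [224, - 342, 114, 288],
     [10948, 2236, - 1692],
     [640, - 144],
     [1810]]"

definition path_skew_matrix :: "int list list" where
  "path_skew_matrix =
    [[2199, 2503, 954, - 694, 824, 412],
     [4960, 3328, - 8, 1834, - 524],
     [2819, 528, 1330, - 872],
     [520, 64, - 510],
     [722, - 250],
     [586]]"

text \<open>Reversing the path \<open>i j k l\<close> fixes the coordinates of this function and negates those of the next;
  the quadratic form splits into these two parts.\<close>

fun path_sym_coords :: coords where
  "path_sym_coords False False False False = [1, 0, 0, 0, 0, 0, 0, 0, 0]"
| "path_sym_coords False False False True = [0, 0, 0, 1, 0, 0, 0, 0, 0]"
| "path_sym_coords False False True False = [0, 1, 0, 0, 0, 0, 0, 0, 0]"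
| "path_sym_coords False False True True = [0, 0, 0, 0, 1, 0, 0, 0, 0]"
| "path_sym_coords False True False False = [0, 1, 0, 0, 0, 0, 0, 0, 0]"
| "path_sym_coords False True False True = [0, - 1, 0, - 1, 0, 0, 0, 0, 0]"
| "path_sym_coords False True True False = [0, 0, 1, 0, 0, 0, 0, 0, 0]"
| "path_sym_coords False True True True = [0, 0, 0, 0, 0, 1, 0, 0, 0]"
| "path_sym_coords True False False False = [0, 0, 0, 1, 0, 0, 0, 0, 0]"
| "path_sym_coords True False False True = [0, 0, 0, 0, 0, 0, 1, 0, 0]"
| "path_sym_coords True False True False = [0, - 1, 0, - 1, 0, 0, 0, 0, 0]"
| "path_sym_coords True False True True = [0, 0, 0, 0, 0, 0, 0, 1, 0]"
| "path_sym_coords True True False False = [0, 0, 0, 0, 1, 0, 0, 0, 0]"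
| "path_sym_coords True True False True = [0, 0, 0, 0, 0, 0, 0, 1, 0]"
| "path_sym_coords True True True False = [0, 0, 0, 0, 0, 1, 0, 0, 0]"
| "path_sym_coords True True True True = [0, 0, 0, 0, 0, 0, 0, 0, 1]"

fun path_skew_coords :: coords where
  "path_skew_coords False False False False = [0, 0, 0, 0, 0, 0]"
| "path_skew_coords False False False True = [0, 1, 0, 0, 0, 0]"
| "path_skew_coords False False True False = [- 1, 0, 0, 0, 0, 0]"
| "path_skew_coords False False True True = [0, 0, 0, 1, 0, 0]"
| "path_skew_coords False True False False = [1, 0, 0, 0, 0, 0]"
| "path_skew_coords False True False True = [0, 0, 1, 0, 0, 0]"
| "path_skew_coords False True True False = [0, 0, 0, 0, 0, 0]"
| "path_skew_coords False True True True = [0, 0, 0, 0, 1, 0]"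
| "path_skew_coords True False False False = [0, - 1, 0, 0, 0, 0]"
| "path_skew_coords True False False True = [0, 0, 0, 0, 0, 0]"
| "path_skew_coords True False True False = [0, 0, - 1, 0, 0, 0]"
| "path_skew_coords True False True True = [0, 0, 0, 0, 0, - 1]"
| "path_skew_coords True True False False = [0, 0, 0, - 1, 0, 0]"
| "path_skew_coords True True False True = [0, 0, 0, 0, 0, 1]"
| "path_skew_coords True True True False = [0, 0, 0, 0, - 1, 0]"
| "path_skew_coords True True True True = [0, 0, 0, 0, 0, 0]"

text \<open>For the other shapes only the part invariant under the symmetries of the root graph is used.\<close>

definition edgeless_coords :: coords where
  "edgeless_coords i j k l = [4 - 3 * (of_bool i + of_bool j + of_bool k + of_bool l)]"

definition edge_coords :: coords where
  "edge_coords i j k l =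
    (if i \<and> j then
       if k \<and> l then [0, 0, 0, 0, 0, 0, 0, 1]
       else if k \<or> l then [- 1, - 3, 0, 0, 0, 0, - 1, 0] else [0, 0, 0, 0, 0, 0, 1, 0]
     else if i \<or> j then
       if k \<and> l then [0, 0, 0, 0, 0, 1, 0, 0]
       else if k \<or> l then [0, 0, 0, 0, 1, 0, 0, 0] else [0, 0, 0, 1, 0, 0, 0, 0]
     else
       if k \<and> l then [0, 0, 1, 0, 0, 0, 0, 0]
       else if k \<or> l then [0, 1, 0, 0, 0, 0, 0, 0] else [1, 0, 0, 0, 0, 0, 0, 0])"

definition cherry_coords :: coords where
  "cherry_coords i j k l =
    (if i then
       if j \<and> k then if l then [0, 0, 0, 0, 0, 0, 0, 0, 1] else [- 2, - 2, 0, 0, - 2, 0, - 1, 0, 0]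
       else if j \<or> k then
         if l then [0, 0, 0, 0, 0, 0, 0, 1, 0] else [- 1, - 1, 0, 0, - 1, 0, 0, 0, 0]
       else if l then [- 2, - 1, 0, 0, - 4, 0, - 1, 0, 0] else [0, 0, 0, 0, 0, 0, 1, 0, 0]
     else
       if j \<and> k then if l then [0, 0, 0, 0, 0, 1, 0, 0, 0] else [0, 0, 0, 0, 2, 0, 0, 0, 0]
       else if j \<or> k then if l then [0, 0, 0, 1, 0, 0, 0, 0, 0] else [0, 0, 1, 0, 0, 0, 0, 0, 0]
       else if l then [0, 1, 0, 0, 0, 0, 0, 0, 0] else [2, 0, 0, 0, 0, 0, 0, 0, 0])"

definition claw_coords :: coords where
  "claw_coords i j k l =
    (if i \<and> j \<and> k then if l then [0, 0, 0, 0, 0, 1] else [- 1, - 1, 0, 0, 0, 0]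
     else if i \<and> j \<or> i \<and> k \<or> j \<and> k then if l then [0, 0, 0, 0, 1, 0] else [0, - 1, - 1, 0, 0, 0]
     else if i \<or> j \<or> k then if l then [0, 0, 0, 1, 0, 0] else [0, 0, 1, 0, 0, 0]
     else if l then [0, 1, 0, 0, 0, 0] else [1, 0, 0, 0, 0, 0])"

datatype shape = Edgeless | Edge | Cherry | Claw | Path | Other

text \<open>Only one labelling of each root graph, up to its symmetries, carries a quadratic form. This makes most orderings of six
  vertices contribute nothing.\<close>

definition shape_of :: "bool \<Rightarrow> bool \<Rightarrow> bool \<Rightarrow> bool \<Rightarrow> bool \<Rightarrow> bool \<Rightarrow> shape" where
  "shape_of ij ik jk il jl kl =
    (if ij then if jk \<and> \<not> ik \<and> kl \<and> \<not> il \<and> \<not> jl then Path else Other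
     else if ik \<or> jk then Other
     else if il then if jl \<and> kl then Claw else Other
     else if jl then if kl then Cherry else Other
     else if kl then Edge else Edgeless)"

fun squares :: "shape \<Rightarrow> (int list list \<times> coords) list" where
  "squares Edgeless = [(edgeless_matrix, edgeless_coords)]"
| "squares Edge = [(edge_matrix, edge_coords)]"
| "squares Cherry = [(cherry_matrix, cherry_coords)]"
| "squares Claw = [(claw_matrix, claw_coords)]"
| "squares Path = [(path_sym_matrix, path_sym_coords), (path_skew_matrix, path_skew_coords)]"
| "squares Other = []"

lemma psd_matrices:
  "psd 1 edgeless_matrix" "psd 1 edge_matrix" "psd 1 cherry_matrix" "psd 1 claw_matrix"
  "psd 1 path_sym_matrix" "psd 1 path_skew_matrix"
  by code_simp+

lemma triangular_matrices:
  "triangular edgeless_matrix" "triangular edge_matrix" "triangular cherry_matrix"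
  "triangular claw_matrix" "triangular path_sym_matrix" "triangular path_skew_matrix"
  by code_simp+

lemma length_coords:
  "length (edgeless_coords i j k l) = length edgeless_matrix"
  "length (edge_coords i j k l) = length edge_matrix"
  "length (cherry_coords i j k l) = length cherry_matrix"
  "length (claw_coords i j k l) = length claw_matrix"
  "length (path_sym_coords i j k l) = length path_sym_matrix"
  "length (path_skew_coords i j k l) = length path_skew_matrix"
  by (simp_all add: edgeless_coords_def edge_coords_def cherry_coords_def claw_coords_def
      edgeless_matrix_def edge_matrix_def cherry_matrix_def claw_matrix_def
      path_sym_matrix_def path_skew_matrix_def)
    (cases i; cases j; cases k; cases l; simp)+

lemma psd_squares:
  assumes "(M, c) \<in> set (squares t)"
  shows "psd 1 M" "triangular M" "length (c i j k l) = length M"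
  using assms psd_matrices triangular_matrices length_coords by (cases t; auto)+

text \<open>The position in the hexagon of a vertex with the given adjacency to the path \<open>0, 1, 2, 3\<close>.\<close>

fun path_class :: "bool \<Rightarrow> bool \<Rightarrow> bool \<Rightarrow> bool \<Rightarrow> nat option" where
  "path_class False True False False = Some 0"
| "path_class True False True False = Some 1"
| "path_class False True False True = Some 2"
| "path_class False False True False = Some 3"
| "path_class False False False True = Some 4"
| "path_class True False False False = Some 5"
| "path_class _ _ _ _ = None"

definition hex :: "nat \<Rightarrow> nat \<Rightarrow> bool" where
  "hex c d \<longleftrightarrow> c < 6 \<and> d < 6 \<and> (d = Suc c \<or> c = Suc d \<or> {c, d} = {0, 5})"

definition hex_rows :: "bool list list" where
  "hex_rows = [[False, True, False, False, False, True], [True, False, True, False, False, False],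
    [False, True, False, True, False, False], [False, False, True, False, True, False],
    [False, False, False, True, False, True], [True, False, False, False, True, False]]"

lemma hex_eq_rows: "c < 6 \<Longrightarrow> d < 6 \<Longrightarrow> hex c d = hex_rows ! c ! d"
  by (auto simp: hex_def hex_rows_def doubleton_eq_iff less_Suc_eq numeral_eq_Suc)

text \<open>Lookup in a table is much faster to evaluate than the arithmetic definition.\<close>

lemma hex_code [code]: "hex c d \<longleftrightarrow> c < 6 \<and> d < 6 \<and> hex_rows ! c ! d"
proof -
  have "hex c d \<longleftrightarrow> c < 6 \<and> d < 6 \<and> hex c d" by (auto simp: hex_def)
  then show ?thesis by (simp add: hex_eq_rows cong: conj_cong)
qed

text \<open>The second summand of the first case is the Laplacian of the
  hexagon: for random \<open>u\<close> and \<open>v\<close> its mean is the sum of the squared differences between the weights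
  of consecutive positions.\<close>

definition class_defect :: "nat option \<Rightarrow> nat option \<Rightarrow> bool \<Rightarrow> int" where
  "class_defect a b e =
    (case (a, b) of
       (Some c, Some d) \<Rightarrow> of_bool (e \<noteq> hex c d) + (if c = d then 2 else if hex c d then - 1 else 0)
     | _ \<Rightarrow> 1)"

text \<open>The factor is \<open>62208 = 16 * 3888\<close>, which makes the average loss 16 in the balanced hexagon.\<close>

definition path_loss :: "nat option \<Rightarrow> nat option \<Rightarrow> bool \<Rightarrow> int" where
  "path_loss a b e = 62208 * of_bool (a = Some 5 \<and> b = Some 0 \<and> e) + 2 * class_defect a b e"

definition square_value ::
  "shape \<Rightarrow> bool \<Rightarrow> bool \<Rightarrow> bool \<Rightarrow> bool \<Rightarrow> bool \<Rightarrow> bool \<Rightarrow> bool \<Rightarrow> bool \<Rightarrow> int" where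
  "square_value t i j k l i' j' k' l' = (\<Sum>(M, c)\<leftarrow>squares t. bil M (c i j k l) (c i' j' k' l'))"

definition pair_loss ::
  "shape \<Rightarrow> bool \<Rightarrow> bool \<Rightarrow> bool \<Rightarrow> bool \<Rightarrow> bool \<Rightarrow> bool \<Rightarrow> bool \<Rightarrow> bool \<Rightarrow> bool \<Rightarrow> int" where
  "pair_loss t i j k l i' j' k' l' e =
     square_value t i j k l i' j' k' l'
     + (if t = Path then path_loss (path_class i j k l) (path_class i' j' k' l') e else 0)"

section \<open>Summing the loss over all orderings of six vertices\<close>

text \<open>Nested use enumerates the orderings of a list and allows cutting off branches early.\<close>

primrec selects :: "'a list \<Rightarrow> ('a \<times> 'a list) list" where
  "selects [] = []"
| "selects (x # xs) = (x, xs) # map (\<lambda>(y, ys). (y, x # ys)) (selects xs)"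

text \<open>The loss of the two orderings \<open>u, v\<close> and \<open>v, u\<close> together, so that the symmetric quadratic form is
  evaluated once.\<close>

definition split_loss where
  "split_loss t i j k l i' j' k' l' e =
    (case t of Other \<Rightarrow> 0 | Path \<Rightarrow> 2 * square_value t i j k l i' j' k' l' +
      path_loss (path_class i j k l) (path_class i' j' k' l') e
      + path_loss (path_class i' j' k' l') (path_class i j k l) e
     | _ \<Rightarrow> 2 * square_value t i j k l i' j' k' l')"

definition last_loss :: "('a \<Rightarrow> 'a \<Rightarrow> bool) \<Rightarrow> 'a \<Rightarrow> 'a \<Rightarrow> 'a \<Rightarrow> 'a \<Rightarrow> 'a list \<Rightarrow> int" where
  "last_loss E i j k l uv =
    (case uv of [u, v] \<Rightarrow>
       split_loss (shape_of (E i j) (E i k) (E j k) (E i l) (E j l) (E k l))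
         (E i u) (E j u) (E k u) (E l u) (E i v) (E j v) (E k v) (E l v) (E u v)
     | _ \<Rightarrow> 0)"

text \<open>In a root graph with a nontrivial contribution \<open>i\<close> and \<open>k\<close> are never adjacent and \<open>j\<close> is adjacent to
  both or to neither of them.\<close>

definition total_loss :: "('a \<Rightarrow> 'a \<Rightarrow> bool) \<Rightarrow> 'a list \<Rightarrow> int" where
  "total_loss E xs =
    (\<Sum>(i, r)\<leftarrow>selects xs. \<Sum>(j, s)\<leftarrow>selects r. \<Sum>(k, t)\<leftarrow>selects s.
       if E i k \<or> E i j \<noteq> E j k then 0 else \<Sum>(l, uv)\<leftarrow>selects t. last_loss E i j k l uv)"

lemma bil_commute: "bil M xs ys = bil M ys xs"
proof (induction M arbitrary: xs ys)
  case (Cons r M)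
  then show ?case by (cases r; cases xs; cases ys) (simp_all add: algebra_simps)
qed simp

lemma square_value_commute:
  "square_value t i j k l i' j' k' l' = square_value t i' j' k' l' i j k l"
  unfolding square_value_def by (simp add: bil_commute)

fun loss :: "('a \<Rightarrow> 'a \<Rightarrow> bool) \<Rightarrow> 'a list \<Rightarrow> int" where
  "loss E [i, j, k, l, u, v] =
     pair_loss (shape_of (E i j) (E i k) (E j k) (E i l) (E j l) (E k l))
       (E i u) (E j u) (E k u) (E l u) (E i v) (E j v) (E k v) (E l v) (E u v)"
| "loss E _ = 0"

lemma selects_map: "selects (map f xs) = map (\<lambda>(x, r). (f x, map f r)) (selects xs)"
  by (induction xs) (auto simp: split_def)

lemma map_fst_selects: "map fst (selects xs) = xs"
  by (induction xs) (auto simp: comp_def split_def)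

lemma selectsD:
  "(x, r) \<in> set (selects xs) \<Longrightarrow> distinct xs \<Longrightarrow>
     x \<in> set xs \<and> set r = set xs - {x} \<and> distinct r \<and> length xs = Suc (length r)"
proof (induction xs arbitrary: x r)
  case (Cons a xs)
  from Cons.prems(1) consider "x = a" "r = xs"
    | ys where "r = a # ys" "(x, ys) \<in> set (selects xs)"
    by auto
  then show ?case
  proof cases
    case 2
    then show ?thesis using Cons.IH[of x ys] Cons.prems(2) by auto
  qed (use Cons.prems in auto)
qed simp

lemma sum_list_selects_map:
  "(\<Sum>(x, r)\<leftarrow>selects (map f xs). g x r) = (\<Sum>(x, r)\<leftarrow>selects xs. g (f x) (map f r))"
  by (simp add: selects_map comp_def split_def)

lemma sum_permutations_of_set:
  assumes "finite A" "A \<noteq> {}"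
  shows "(\<Sum>p\<in>permutations_of_set A. f p) =
    (\<Sum>x\<in>A. \<Sum>q\<in>permutations_of_set (A - {x}). f (x # q))"
proof -
  have reind: "(\<Sum>p\<in>(#) x ` P. f p) = (\<Sum>q\<in>P. f (x # q))" for x P
    by (subst sum.reindex) auto
  have "(\<Sum>p\<in>permutations_of_set A. f p) =
      (\<Sum>x\<in>A. \<Sum>p\<in>(#) x ` permutations_of_set (A - {x}). f p)"
    unfolding permutations_of_set_nonempty[OF assms(2)]
    using assms(1) by (intro sum.UNION_disjoint) auto
  also have "\<dots> = (\<Sum>x\<in>A. \<Sum>q\<in>permutations_of_set (A - {x}). f (x # q))"
    by (simp only: reind)
  finally show ?thesis .
qed

lemma sum_permutations_selects:
  assumes "distinct xs" "xs \<noteq> []"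
  shows "(\<Sum>p\<in>permutations_of_set (set xs). f p) =
    (\<Sum>(x, r)\<leftarrow>selects xs. \<Sum>q\<in>permutations_of_set (set r). f (x # q))"
proof -
  have "(\<Sum>(x, r)\<leftarrow>selects xs. \<Sum>q\<in>permutations_of_set (set r). f (x # q)) =
      (\<Sum>x\<leftarrow>map fst (selects xs). \<Sum>q\<in>permutations_of_set (set xs - {x}). f (x # q))"
    unfolding map_map
  proof (intro arg_cong[of _ _ sum_list] map_cong refl)
    fix z assume "z \<in> set (selects xs)"
    then have "set (snd z) = set xs - {fst z}"
      using selectsD[of "fst z" "snd z" xs] assms(1) by simp
    then show "(case z of (x, r) \<Rightarrow> \<Sum>q\<in>permutations_of_set (set r). f (x # q)) =
        ((\<lambda>x. \<Sum>q\<in>permutations_of_set (set xs - {x}). f (x # q)) \<circ> fst) z"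
      by (simp add: split_def)
  qed
  also have "\<dots> = (\<Sum>x\<in>set xs. \<Sum>q\<in>permutations_of_set (set xs - {x}). f (x # q))"
    unfolding map_fst_selects by (rule sum_list_distinct_conv_sum_set[OF assms(1)])
  finally show ?thesis using sum_permutations_of_set[of "set xs" f] assms by simp
qed

text \<open>Peels off the first element of an ordering; the hypothesis evaluates the sum over the rest.\<close>

lemma sum_permutations_step:
  assumes "distinct xs" "length xs = Suc n"
    and "\<And>x r. \<lbrakk>distinct r; length r = n\<rbrakk> \<Longrightarrow>
      (\<Sum>q\<in>permutations_of_set (set r). f (x # q)) = g x r"
  shows "(\<Sum>p\<in>permutations_of_set (set xs). f p) = (\<Sum>(x, r)\<leftarrow>selects xs. g x r)"
proof -
  have "(\<Sum>p\<in>permutations_of_set (set xs). f p) =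
      (\<Sum>(x, r)\<leftarrow>selects xs. \<Sum>q\<in>permutations_of_set (set r). f (x # q))"
    using assms(1,2) by (intro sum_permutations_selects) auto
  also have "\<dots> = (\<Sum>(x, r)\<leftarrow>selects xs. g x r)"
  proof (intro arg_cong[of _ _ sum_list] map_cong refl)
    fix z assume "z \<in> set (selects xs)"
    then have "distinct (snd z)" "length (snd z) = n"
      using selectsD[of "fst z" "snd z" xs] assms(1,2) by simp_all
    then show "(case z of (x, r) \<Rightarrow> \<Sum>q\<in>permutations_of_set (set r). f (x # q)) =
        (case z of (x, r) \<Rightarrow> g x r)"
      using assms(3)[of "snd z" "fst z"] by (simp add: split_def)
  qed
  finally show ?thesis .
qed

lemma split_loss_eq:
  assumes "\<And>x y. E x y = E y x"
  shows "split_loss (shape_of (E i j) (E i k) (E j k) (E i l) (E j l) (E k l))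
      (E i u) (E j u) (E k u) (E l u) (E i v) (E j v) (E k v) (E l v) (E u v)
    = loss E [i, j, k, l, u, v] + loss E [i, j, k, l, v, u]"
  using square_value_commute assms[of u v]
  by (auto simp: split_loss_def pair_loss_def square_value_def[of Other] split: shape.split)

text \<open>The pruning in \<open>total_loss\<close> is justified by the definition of \<open>shape_of\<close>.\<close>

lemma loss_eq_0:
  assumes "E i k \<or> E i j \<noteq> E j k"
  shows "loss E (i # j # k # q) = 0"
  using assms
  by (cases "(E, i # j # k # q)" rule: loss.cases)
    (auto simp: shape_of_def pair_loss_def square_value_def)

lemma sum_loss_eq_total_loss:
  assumes sym: "\<And>x y. E x y = E y x" and xs: "distinct xs" "length xs = 6"
  shows "(\<Sum>p\<in>permutations_of_set (set xs). loss E p) = total_loss E xs"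
proof -
  have two: "(\<Sum>q\<in>permutations_of_set (set uv). loss E (i # j # k # l # q)) = last_loss E i j k l uv"
    if uv: "distinct uv" "length uv = 2" for i j k l uv
  proof -
    obtain u v where uv': "uv = [u, v]" using uv by (auto simp: length_Suc_conv numeral_2_eq_2)
    have "(\<Sum>q\<in>permutations_of_set (set uv). loss E (i # j # k # l # q)) =
        loss E [i, j, k, l, u, v] + loss E [i, j, k, l, v, u]"
      using uv by (subst sum_permutations_selects) (simp_all add: uv')
    then show ?thesis
      by (simp only: uv' last_loss_def list.case split_loss_eq[of E, OF sym])
  qed
  have three: "(\<Sum>q\<in>permutations_of_set (set t). loss E (i # j # k # q)) =
      (if E i k \<or> E i j \<noteq> E j k then 0 else \<Sum>(l, uv)\<leftarrow>selects t. last_loss E i j k l uv)"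
    if t: "distinct t" "length t = 3" for i j k t
  proof (cases "E i k \<or> E i j \<noteq> E j k")
    case True
    then show ?thesis by (simp only: loss_eq_0 if_True sum.neutral_const)
  next
    case False
    then show ?thesis
      using sum_permutations_step[where f = "\<lambda>q. loss E (i # j # k # q)" and n = 2, OF t(1) _ two] t(2)
      by (simp only: if_False numeral_3_eq_3 numeral_2_eq_2)
  qed
  show ?thesis
    unfolding total_loss_def
    by (rule sum_permutations_step[where n = 5], use xs in simp, use xs in simp,
        rule sum_permutations_step[where n = 4], simp, simp,
        rule sum_permutations_step[where n = 3], simp, simp,
        rule three, simp, simp)
qed

lemma last_loss_map:
  "last_loss E (f i) (f j) (f k) (f l) (map f uv) = last_loss (\<lambda>a b. E (f a) (f b)) i j k l uv"
  by (auto simp: last_loss_def split: list.split)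

lemma total_loss_map: "total_loss E (map f xs) = total_loss (\<lambda>a b. E (f a) (f b)) xs"
  unfolding total_loss_def sum_list_selects_map last_loss_map ..

lemma sum_list_selects_cong:
  assumes "\<And>x r. \<lbrakk>x \<in> set xs; set r \<subseteq> set xs\<rbrakk> \<Longrightarrow> f x r = g x r"
  shows "(\<Sum>(x, r)\<leftarrow>selects xs. f x r) = (\<Sum>(x, r)\<leftarrow>selects xs. g x r)"
proof -
  have "x \<in> set xs \<and> set r \<subseteq> set xs" if "(x, r) \<in> set (selects xs)" for x r
    using that by (induction xs arbitrary: x r) (simp, fastforce)
  then show ?thesis using assms by (intro arg_cong[of _ _ sum_list] map_cong) auto
qed

lemma total_loss_cong:
  assumes E: "\<And>x y. x \<in> set xs \<Longrightarrow> y \<in> set xs \<Longrightarrow> E x y = E' x y"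
  shows "total_loss E xs = total_loss E' xs"
  unfolding total_loss_def
proof (intro sum_list_selects_cong, goal_cases)
  case (1 i r j s k t)
  then have sub: "j \<in> set xs" "k \<in> set xs" "set t \<subseteq> set xs" by auto
  have "(\<Sum>(l, uv)\<leftarrow>selects t. last_loss E i j k l uv) = (\<Sum>(l, uv)\<leftarrow>selects t. last_loss E' i j k l uv)"
  proof (rule sum_list_selects_cong)
    fix l uv assume "l \<in> set t" "set uv \<subseteq> set t"
    then show "last_loss E i j k l uv = last_loss E' i j k l uv"
      using E 1 sub by (auto simp: last_loss_def subset_iff split: list.split)
  qed
  moreover have "E i k = E' i k" "E i j = E' i j" "E j k = E' j k" using E 1 sub by simp_all
  ultimately show ?case by (simp only:)
qed

lemma total_loss_relabel:
  assumes "\<And>x y. A x y = A y x" "\<sigma> permutes {..<6::nat}"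
  shows "total_loss (\<lambda>a b. A (\<sigma> a) (\<sigma> b)) [0..<6] = total_loss A [0..<6]"
proof -
  have set: "\<sigma> ` {0..<6} = {0..<6}" using permutes_image[OF assms(2)] by (simp add: atLeast0LessThan)
  have "total_loss (\<lambda>a b. A (\<sigma> a) (\<sigma> b)) [0..<6] = total_loss A (map \<sigma> [0..<6])"
    by (simp add: total_loss_map)
  also have "\<dots> = (\<Sum>p\<in>permutations_of_set (set (map \<sigma> [0..<6])). loss A p)"
    using permutes_inj_on[OF assms(2)]
    by (intro sum_loss_eq_total_loss[symmetric] assms(1)) (auto simp: distinct_map)
  also have "\<dots> = (\<Sum>p\<in>permutations_of_set (set [0..<6]). loss A p)"
    by (simp only: set_map set_upt set)
  also have "\<dots> = total_loss A [0..<6]"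
    by (intro sum_loss_eq_total_loss assms(1)) auto
  finally show ?thesis .
qed

section \<open>Orderly generation of the graphs on six vertices\<close>

text \<open>A graph on \<open>{..<n}\<close> is represented by its strictly lower triangle: row \<open>j\<close> lists the adjacency of \<open>j\<close>
  to the earlier vertices.\<close>

definition row_edge :: "bool list list \<Rightarrow> nat \<Rightarrow> nat \<Rightarrow> bool" where
  "row_edge R i j = (if i < j then R ! j ! i else if j < i then R ! i ! j else False)"

text \<open>Each vertex carries its full row of adjacencies, so that testing an edge is a single lookup.\<close>

definition vertex_list :: "bool list list \<Rightarrow> (nat \<times> bool list) list" where
  "vertex_list R = map (\<lambda>i. (i, map (row_edge R i) [0..<6])) [0..<6]"

fun vertex_edge :: "nat \<times> bool list \<Rightarrow> nat \<times> bool list \<Rightarrow> bool" where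
  "vertex_edge (i, r) (j, s) = r ! j"

text \<open>Exchanging vertices \<open>i\<close> and \<open>i + 1\<close> exchanges entries \<open>i\<close> and \<open>i + 1\<close> of the later rows. The first row in
  which they differ decides whether the result is lexicographically smaller.\<close>

fun swap_ties :: "nat \<Rightarrow> bool list list \<Rightarrow> bool" where
  "swap_ties i [] = True"
| "swap_ties i (r # R) = (if r ! i = r ! Suc i then swap_ties i R else r ! i)"

fun lex_le :: "bool list \<Rightarrow> bool list \<Rightarrow> bool" where
  "lex_le (x # xs) (y # ys) = (if x = y then lex_le xs ys else y)"
| "lex_le _ _ = True"

text \<open>No exchange of two consecutive vertices from \<open>i\<close> onwards makes the triangle lexicographically larger.
  This is necessary for being the largest triangle in the isomorphism class, and it holds for initial
  segments of the triangle, so graphs can be generated vertex by vertex.\<close>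

fun orderly_from :: "nat \<Rightarrow> bool list list \<Rightarrow> bool" where
  "orderly_from i (r # r' # R) =
     ((if take i r' = r then swap_ties i R else lex_le (take i r') r) \<and> orderly_from (Suc i) (r' # R))"
| "orderly_from i _ = True"

primrec orderly_graphs :: "nat \<Rightarrow> bool list list list" where
  "orderly_graphs 0 = [[]]"
| "orderly_graphs (Suc n) =
     filter (orderly_from 0) [R @ [r]. R \<leftarrow> orderly_graphs n, r \<leftarrow> List.n_lists n [False, True]]"

text \<open>
  The graphs on six vertices are the orderly extensions of those on five vertices, which spares
  listing them.
\<close>

definition extensions_bounded :: "bool list list \<Rightarrow> bool" where
  "extensions_bounded R \<longleftrightarrow> list_all (\<lambda>r. if orderly_from 0 (R @ [r])
     then total_loss vertex_edge (vertex_list (R @ [r])) \<le> 11520 else True)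
     (List.n_lists 5 [False, True])"

text \<open>Two halves of one finite check, evaluated separately.\<close>

lemma extensions_bounded_take: "list_all extensions_bounded (take 23 (orderly_graphs 5))"
  by code_simp

lemma extensions_bounded_drop: "list_all extensions_bounded (drop 23 (orderly_graphs 5))"
  by code_simp

text \<open>Reading the triangle as a binary number turns the lexicographic order into an order on numbers, so
  that a maximal labelling exists.\<close>

primrec code_value :: "bool list \<Rightarrow> nat" where
  "code_value [] = 0"
| "code_value (x # xs) = of_bool x * 2 ^ length xs + code_value xs"

lemma code_value_less: "code_value xs < 2 ^ length xs"
  by (induction xs) auto

lemma lex_le_iff_code_value:
  "length xs = length ys \<Longrightarrow> lex_le xs ys \<longleftrightarrow> code_value xs \<le> code_value ys"
proof (induction xs ys rule: list_induct2)
  case (Cons x xs y ys)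
  then show ?case
    using code_value_less[of xs] code_value_less[of ys] by (cases x; cases y) auto
qed simp

lemma lex_le_append:
  "length a = length b \<Longrightarrow> lex_le (a @ x) (b @ y) = (if a = b then lex_le x y else lex_le a b)"
  by (induction a b rule: list_induct2) auto

definition rows :: "nat \<Rightarrow> (nat \<Rightarrow> nat \<Rightarrow> bool) \<Rightarrow> bool list list" where
  "rows n A = map (\<lambda>k. map (\<lambda>i. A i k) [0..<k]) [0..<n]"

definition later_rows :: "nat \<Rightarrow> nat \<Rightarrow> (nat \<Rightarrow> nat \<Rightarrow> bool) \<Rightarrow> bool list list" where
  "later_rows m n A = map (\<lambda>k. map (\<lambda>i. A i k) [0..<k]) [m..<n]"

lemma rows_Suc: "rows (Suc n) A = rows n A @ [map (\<lambda>i. A i n) [0..<n]]"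
  by (simp add: rows_def)

lemma rows_split:
  assumes "Suc j < n"
  shows "rows n A = rows j A @ map (\<lambda>i. A i j) [0..<j] # map (\<lambda>i. A i (Suc j)) [0..<Suc j]
    # later_rows (Suc (Suc j)) n A"
proof -
  have "[0..<n] = [0..<j] @ j # Suc j # [Suc (Suc j)..<n]"
    using assms upt_add_eq_append[of 0 j "n - j"] by (simp add: upt_conv_Cons)
  then show ?thesis by (simp add: rows_def later_rows_def)
qed

abbreviation swap_adjacent :: "nat \<Rightarrow> nat \<Rightarrow> nat" where
  "swap_adjacent j \<equiv> transpose j (Suc j)"

definition swap_entries :: "nat \<Rightarrow> bool list \<Rightarrow> bool list" where
  "swap_entries j r = r[j := r ! Suc j, Suc j := r ! j]"

lemma swap_entries_append:
  "swap_entries (length p) (p @ x # y # d) = p @ y # x # d"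
  by (simp add: swap_entries_def nth_append list_update_append)

lemma swap_ties_if_lex_le:
  assumes "\<forall>r\<in>set R. Suc j < length r"
    and "lex_le (concat (map (swap_entries j) R)) (concat R)"
  shows "swap_ties j R"
  using assms
proof (induction R)
  case (Cons r R)
  have "r = take j r @ r ! j # r ! Suc j # drop (Suc (Suc j)) r" "length (take j r) = j"
    using Cons.prems(1) by (simp_all add: Cons_nth_drop_Suc)
  then obtain p x y d where r: "r = p @ x # y # d" and j: "length p = j" by blast
  have swap: "swap_entries j r = p @ y # x # d" using swap_entries_append j r by blast
  have nths: "r ! j = x" "r ! Suc j = y" by (simp_all add: r j[symmetric] nth_append)
  have "lex_le ((p @ y # x # d) @ concat (map (swap_entries j) R)) (r @ concat R)"
    using Cons.prems(2) by (simp only: list.map concat.simps swap)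
  then have "if x = y then lex_le (concat (map (swap_entries j) R)) (concat R) else x"
    by (simp add: r lex_le_append split: if_splits)
  then show ?case
    using Cons.IH Cons.prems(1) unfolding swap_ties.simps nths by (simp split: if_splits)
qed simp

lemma swap_ties_append: "swap_ties j (R @ R') \<Longrightarrow> swap_ties j R"
  by (induction R) (auto split: if_splits)

text \<open>The exchange leaves rows before \<open>j\<close> unchanged, essentially exchanges rows \<open>j\<close> and \<open>j + 1\<close>, and acts on
  the entries of later rows. Comparing the two triangles row by row gives the local criterion.\<close>

lemma orderly_if_maximal:
  assumes sym: "\<And>a b. A a b = A b a" and j: "Suc j < n"
    and max: "lex_le (concat (rows n (\<lambda>a b. A (swap_adjacent j a) (swap_adjacent j b)))) (concat (rows n A))"
  defines "r \<equiv> map (\<lambda>i. A i j) [0..<j]" and "r' \<equiv> map (\<lambda>i. A i (Suc j)) [0..<Suc j]"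
  shows "if take j r' = r then swap_ties j (later_rows (Suc (Suc j)) n A) else lex_le (take j r') r"
proof -
  let ?B = "\<lambda>a b. A (swap_adjacent j a) (swap_adjacent j b)"
  have 1: "rows j ?B = rows j A" by (auto simp: rows_def transpose_def)
  have 2: "map (\<lambda>i. ?B i j) [0..<j] = take j r'" by (auto simp: r'_def transpose_def)
  have 3: "map (\<lambda>i. ?B i (Suc j)) [0..<Suc j] = r @ [A j (Suc j)]"
    using sym by (auto simp: r_def transpose_def)
  have 4: "later_rows (Suc (Suc j)) n ?B = map (swap_entries j) (later_rows (Suc (Suc j)) n A)"
    unfolding later_rows_def map_map
  proof (intro map_cong refl)
    fix k assume "k \<in> set [Suc (Suc j)..<n]"
    then show "map (\<lambda>i. ?B i k) [0..<k] = (swap_entries j \<circ> (\<lambda>k. map (\<lambda>i. A i k) [0..<k])) k"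
      by (intro nth_equalityI) (auto simp: swap_entries_def nth_list_update transpose_def)
  qed
  have "lex_le (concat (take j r' # (r @ [A j (Suc j)]) # map (swap_entries j) (later_rows (Suc (Suc j)) n A)))
      (concat (r # r' # later_rows (Suc (Suc j)) n A))"
    using max unfolding rows_split[OF j] 1 2 3 4
    by (simp add: lex_le_append r_def r'_def split: if_splits)
  then have *: "if take j r' = r then lex_le ((r @ [A j (Suc j)]) @ concat (map (swap_entries j) (later_rows (Suc (Suc j)) n A)))
      (r' @ concat (later_rows (Suc (Suc j)) n A)) else lex_le (take j r') r"
    by (simp add: lex_le_append r_def r'_def del: upt_Suc)
  have "r' = take j r' @ [A j (Suc j)]" by (simp add: r'_def)
  then show ?thesis
    using * by (auto simp: lex_le_append later_rows_def intro!: swap_ties_if_lex_le split: if_splits)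
qed

lemma orderly_from_iff:
  "orderly_from i R \<longleftrightarrow> (\<forall>m. Suc m < length R \<longrightarrow>
     (if take (i + m) (R ! Suc m) = R ! m then swap_ties (i + m) (drop (Suc (Suc m)) R)
      else lex_le (take (i + m) (R ! Suc m)) (R ! m)))"
proof (induction i R rule: orderly_from.induct)
  case (1 i r r' R)
  have split: "(\<forall>m. P m) \<longleftrightarrow> P 0 \<and> (\<forall>m. P (Suc m))" for P :: "nat \<Rightarrow> bool"
    by (metis not0_implies_Suc)
  show ?case
    unfolding orderly_from.simps 1 by (subst (2) split) simp
qed auto

lemma row_edge_rows:
  assumes "\<And>a b. A a b = A b a" "\<And>a. \<not> A a a" "a < n" "b < n"
  shows "row_edge (rows n A) a b = A a b"
  using assms by (auto simp: row_edge_def rows_def linorder_neq_iff)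

lemma length_concat_rows: "length (concat (rows n A)) = length (concat (rows n B))"
  by (simp add: rows_def length_concat comp_def)

text \<open>Relabel the graph so that its triangle is lexicographically maximal. Then it is among the
  orderly graphs, for which the bound is checked by evaluation. The bound is \<open>11520 = 16 * 720\<close>.\<close>

theorem total_loss_le:
  fixes A :: "nat \<Rightarrow> nat \<Rightarrow> bool"
  assumes sym: "\<And>a b. A a b = A b a" and irrefl: "\<And>a. \<not> A a a"
  shows "total_loss A [0..<6] \<le> 11520"
proof -
  let ?P = "{\<sigma>. \<sigma> permutes {..<6::nat}}"
  define f where "f \<sigma> = code_value (concat (rows 6 (\<lambda>a b. A (\<sigma> a) (\<sigma> b))))" for \<sigma>
  have fin: "finite (f ` ?P)" by (intro finite_imageI finite_permutations) simp
  have "f ` ?P \<noteq> {}" using permutes_id by blast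
  then obtain \<sigma> where \<sigma>: "\<sigma> \<in> ?P" and max: "\<And>\<tau>. \<tau> \<in> ?P \<Longrightarrow> f \<tau> \<le> f \<sigma>"
    using Max_in[OF fin] Max_ge[OF fin] by (metis (no_types, lifting) imageE imageI)
  define B where "B a b = A (\<sigma> a) (\<sigma> b)" for a b
  have symB: "\<And>a b. B a b = B b a" and irB: "\<And>a. \<not> B a a"
    using sym irrefl by (simp_all add: B_def)
  have lexmax: "lex_le (concat (rows 6 (\<lambda>a b. B (swap_adjacent j a) (swap_adjacent j b)))) (concat (rows 6 B))"
    if "Suc j < 6" for j
  proof -
    have "\<sigma> \<circ> swap_adjacent j \<in> ?P"
      using \<sigma> that by (auto intro!: permutes_compose permutes_swap_id)
    from max[OF this] show ?thesis
      by (subst lex_le_iff_code_value[OF length_concat_rows]) (simp add: f_def B_def[abs_def] comp_def)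
  qed
  have ord: "orderly_from 0 (rows n B)" if "n \<le> 6" for n
    unfolding orderly_from_iff
  proof (intro allI impI)
    fix m assume "Suc m < length (rows n B)"
    then have m: "Suc m < n" by (simp add: rows_def)
    then have m6: "Suc m < 6" using that by simp
    have nths: "rows n B ! m = map (\<lambda>i. B i m) [0..<m]"
      "rows n B ! Suc m = map (\<lambda>i. B i (Suc m)) [0..<Suc m]"
      using m by (simp_all add: rows_def del: upt_Suc)
    have "[Suc (Suc m)..<6] = [Suc (Suc m)..<n] @ [n..<6]"
      using upt_add_eq_append[of "Suc (Suc m)" n "6 - n"] m that by simp
    then have app: "later_rows (Suc (Suc m)) 6 B = later_rows (Suc (Suc m)) n B @ later_rows n 6 B"
      by (simp add: later_rows_def)
    have "drop (Suc (Suc m)) (rows n B) = later_rows (Suc (Suc m)) n B"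
      by (simp add: rows_def later_rows_def drop_map)
    then show "if take (0 + m) (rows n B ! Suc m) = rows n B ! m
        then swap_ties (0 + m) (drop (Suc (Suc m)) (rows n B))
        else lex_le (take (0 + m) (rows n B ! Suc m)) (rows n B ! m)"
      using orderly_if_maximal[OF symB m6 lexmax[OF m6]] unfolding nths app
      by (auto split: if_splits dest: swap_ties_append simp del: upt_Suc)
  qed
  have new_row: "map (\<lambda>i. B i n) [0..<n] \<in> set (List.n_lists n [False, True])" for n
    by (auto simp: set_n_lists)
  have graphs: "n \<le> 6 \<Longrightarrow> rows n B \<in> set (orderly_graphs n)" for n
  proof (induction n)
    case 0
    then show ?case by (simp add: rows_def)
  next
    case (Suc n)
    then show ?case using ord[of "Suc n"] new_row[of n] by (auto simp: rows_Suc)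
  qed
  have "list_all extensions_bounded (orderly_graphs 5)"
    using extensions_bounded_take extensions_bounded_drop
    by (metis append_take_drop_id list_all_append)
  then have "extensions_bounded (rows 5 B)" using graphs[of 5] by (simp add: list_all_iff)
  moreover have r6: "rows 6 B = rows 5 B @ [map (\<lambda>i. B i 5) [0..<5]]"
    using rows_Suc[of 5 B] by simp
  ultimately have "total_loss vertex_edge (vertex_list (rows 6 B)) \<le> 11520"
    using ord[of 6] new_row[of 5] by (simp add: extensions_bounded_def list_all_iff)
  also have "total_loss vertex_edge (vertex_list (rows 6 B)) = total_loss B [0..<6]"
    unfolding vertex_list_def total_loss_map
    by (rule total_loss_cong) (simp add: row_edge_rows[OF symB irB])
  also have "\<dots> = total_loss A [0..<6]"
    unfolding B_def[abs_def] using \<sigma> by (intro total_loss_relabel sym) simp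
  finally show ?thesis .
qed

section \<open>Means over random tuples\<close>

definition tuples :: "'a set \<Rightarrow> nat \<Rightarrow> 'a list set" where
  "tuples V n = {xs. set xs \<subseteq> V \<and> length xs = n}"

text \<open>The expectation of \<open>f\<close> at \<open>n\<close> independent vertices with distribution \<open>w\<close> (if \<open>w\<close> sums to 1).\<close>

definition mean :: "'a set \<Rightarrow> ('a \<Rightarrow> real) \<Rightarrow> nat \<Rightarrow> ('a list \<Rightarrow> real) \<Rightarrow> real" where
  "mean V w n f = (\<Sum>xs\<in>tuples V n. prod_list (map w xs) * f xs)"

lemma finite_tuples: "finite V \<Longrightarrow> finite (tuples V n)"
  unfolding tuples_def by (rule finite_lists_length_eq)

lemma mean_0 [simp]: "mean V w 0 f = f []"
proof -
  have "tuples V 0 = {[]}" by (auto simp: tuples_def)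
  then show ?thesis by (simp add: mean_def)
qed

lemma mean_Suc:
  assumes "finite V"
  shows "mean V w (Suc n) f = (\<Sum>x\<in>V. w x * mean V w n (\<lambda>xs. f (x # xs)))"
proof -
  have "tuples V (Suc n) = (\<lambda>(x, xs). x # xs) ` (V \<times> tuples V n)"
    by (auto simp: tuples_def length_Suc_conv image_iff)
  then have "mean V w (Suc n) f =
      (\<Sum>z\<in>(\<lambda>(x, xs). x # xs) ` (V \<times> tuples V n). prod_list (map w z) * f z)"
    by (simp only: mean_def)
  also have "\<dots> = (\<Sum>z\<in>V \<times> tuples V n. prod_list (map w (fst z # snd z)) * f (fst z # snd z))"
    by (subst sum.reindex) (simp_all add: inj_on_def split_def)
  also have "\<dots> = (\<Sum>x\<in>V. \<Sum>xs\<in>tuples V n. prod_list (map w (x # xs)) * f (x # xs))"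
    by (simp only: sum.cartesian_product split_def)
  also have "\<dots> = (\<Sum>x\<in>V. w x * mean V w n (\<lambda>xs. f (x # xs)))"
    by (simp add: mean_def sum_distrib_left mult.assoc)
  finally show ?thesis .
qed

lemma mean_add: "mean V w n (\<lambda>xs. f xs + g xs) = mean V w n f + mean V w n g"
  by (simp add: mean_def sum.distrib algebra_simps)

lemma mean_diff: "mean V w n (\<lambda>xs. f xs - g xs) = mean V w n f - mean V w n g"
  by (simp add: mean_def sum_subtractf algebra_simps)

lemma mean_cmult: "mean V w n (\<lambda>xs. c * f xs) = c * mean V w n f"
  by (simp add: mean_def sum_distrib_left algebra_simps)

lemma mean_sum: "mean V w n (\<lambda>xs. \<Sum>p\<in>P. f p xs) = (\<Sum>p\<in>P. mean V w n (f p))"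
  unfolding mean_def sum_distrib_left by (rule sum.swap)

lemma mean_const:
  assumes "finite V" "(\<Sum>x\<in>V. w x) = 1"
  shows "mean V w n (\<lambda>_. c) = c"
  by (induction n) (simp_all add: mean_Suc assms sum_distrib_right[symmetric])

lemma prod_list_nonneg: "(\<And>x. x \<in> set xs \<Longrightarrow> 0 \<le> w x) \<Longrightarrow> 0 \<le> prod_list (map w xs)"
  for w :: "'a \<Rightarrow> real"
  by (induction xs) auto

lemma mean_mono:
  assumes "\<And>x. x \<in> V \<Longrightarrow> 0 \<le> w x" "\<And>xs. xs \<in> tuples V n \<Longrightarrow> f xs \<le> g xs"
  shows "mean V w n f \<le> mean V w n g"
  unfolding mean_def
  by (intro sum_mono mult_left_mono assms prod_list_nonneg) (auto simp: tuples_def assms)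

lemma mean_nonneg:
  assumes "\<And>x. x \<in> V \<Longrightarrow> 0 \<le> w x" "\<And>xs. xs \<in> tuples V n \<Longrightarrow> 0 \<le> f xs"
  shows "0 \<le> mean V w n f"
  unfolding mean_def
  by (intro sum_nonneg mult_nonneg_nonneg assms prod_list_nonneg) (auto simp: tuples_def assms)

lemma mean_cong: "(\<And>xs. xs \<in> tuples V n \<Longrightarrow> f xs = g xs) \<Longrightarrow> mean V w n f = mean V w n g"
  unfolding mean_def by (intro sum.cong) auto

text \<open>The image under \<open>c\<close> of a random vertex has as distribution the total weights of the fibres.\<close>

lemma mean_push:
  assumes "finite V" "finite C" "c ` V \<subseteq> C"
  shows "mean V w n (\<lambda>xs. f (map c xs)) = mean C (\<lambda>d. \<Sum>y\<in>{y \<in> V. c y = d}. w y) n f"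
proof (induction n arbitrary: f)
  case (Suc n)
  let ?w = "\<lambda>d. \<Sum>y\<in>{y \<in> V. c y = d}. w y"
  have IH: "mean V w n (\<lambda>xs. f (c y # map c xs)) = mean C ?w n (\<lambda>xs. f (c y # xs))" for y
    using Suc[of "\<lambda>xs. f (c y # xs)"] .
  have "mean V w (Suc n) (\<lambda>xs. f (map c xs)) = (\<Sum>y\<in>V. w y * mean C ?w n (\<lambda>xs. f (c y # xs)))"
    by (simp only: mean_Suc[OF assms(1)] list.map IH)
  also have "\<dots> = (\<Sum>d\<in>C. \<Sum>y\<in>{y \<in> V. c y = d}. w y * mean C ?w n (\<lambda>xs. f (c y # xs)))"
    using assms by (intro sum.group[symmetric]) auto
  also have "\<dots> = (\<Sum>d\<in>C. ?w d * mean C ?w n (\<lambda>xs. f (d # xs)))"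
    by (intro sum.cong refl) (simp add: sum_distrib_right)
  finally show ?case by (simp only: mean_Suc[OF assms(2)])
qed simp

abbreviation index_perms :: "nat \<Rightarrow> nat list set" where
  "index_perms n \<equiv> permutations_of_set {..<n}"

lemma length_index_perms: "p \<in> index_perms n \<Longrightarrow> length p = n"
  using length_finite_permutations_of_set[of p "{..<n}"] by simp

lemma mset_nths_index_perm:
  assumes "p \<in> index_perms n" "length xs = n"
  shows "mset (map ((!) xs) p) = mset xs"
proof -
  have "mset p = mset [0..<n]"
    using permutations_of_setD[OF assms(1)] set_eq_iff_mset_eq_distinct[of p "[0..<n]"]
    by (simp add: atLeast0LessThan)
  then have "mset (map ((!) xs) p) = mset (map ((!) xs) [0..<n])" by (simp only: mset_map)
  also have "map ((!) xs) [0..<n] = xs" using map_nth[of xs] assms(2) by simp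
  finally show ?thesis .
qed

text \<open>Independent identically distributed vertices are exchangeable.\<close>

lemma mean_permute:
  assumes "finite V" "p \<in> index_perms n"
  shows "mean V w n (\<lambda>xs. f (map ((!) xs) p)) = mean V w n f"
proof -
  let ?g = "\<lambda>xs. map ((!) xs) p"
  have len: "length p = n" using length_index_perms[OF assms(2)] .
  have sp: "set p = {..<n}" using permutations_of_setD(1)[OF assms(2)] .
  have ms: "mset (?g xs) = mset xs" if "xs \<in> tuples V n" for xs
    using mset_nths_index_perm[OF assms(2), of xs] that unfolding tuples_def by blast
  have "inj_on ?g (tuples V n)"
  proof (rule inj_onI)
    fix xs ys assume *: "xs \<in> tuples V n" "ys \<in> tuples V n" "?g xs = ?g ys"
    have "xs ! i = ys ! i" if "i < n" for i
      using *(3) sp that unfolding map_eq_conv by blast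
    moreover have "length xs = n" "length ys = n" using * by (simp_all add: tuples_def)
    ultimately show "xs = ys" by (intro nth_equalityI) simp_all
  qed
  moreover have sub: "?g ` tuples V n \<subseteq> tuples V n"
  proof
    fix ys assume "ys \<in> ?g ` tuples V n"
    then obtain xs where "xs \<in> tuples V n" "ys = ?g xs" by auto
    then show "ys \<in> tuples V n" using mset_eq_setD[OF ms[of xs]] len
      by (simp add: tuples_def del: set_map)
  qed
  ultimately have im: "?g ` tuples V n = tuples V n" "inj_on ?g (tuples V n)"
    using endo_inj_surj[OF finite_tuples[OF assms(1)]] by auto
  have pl: "prod_list (map w (?g xs)) = prod_list (map w xs)" if "xs \<in> tuples V n" for xs
    using arg_cong[OF ms[OF that], of "\<lambda>M. prod_mset (image_mset w M)"]
    by (simp only: mset_map[symmetric] prod_mset_prod_list)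
  have "mean V w n f = (\<Sum>xs\<in>?g ` tuples V n. prod_list (map w xs) * f xs)"
    using im by (simp add: mean_def)
  also have "\<dots> = (\<Sum>xs\<in>tuples V n. prod_list (map w (?g xs)) * f (?g xs))"
    by (simp only: sum.reindex[OF im(2)] o_def)
  also have "\<dots> = mean V w n (\<lambda>xs. f (?g xs))"
    unfolding mean_def by (intro sum.cong refl) (simp only: pl)
  finally show ?thesis ..
qed

section \<open>The core inequality\<close>

definition square_part :: "('a \<Rightarrow> 'a \<Rightarrow> bool) \<Rightarrow> 'a list \<Rightarrow> int" where
  "square_part E xs = (case xs of [i, j, k, l, u, v] \<Rightarrow>
     square_value (shape_of (E i j) (E i k) (E j k) (E i l) (E j l) (E k l))
       (E i u) (E j u) (E k u) (E l u) (E i v) (E j v) (E k v) (E l v) | _ \<Rightarrow> 0)"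

definition is_path :: "('a \<Rightarrow> 'a \<Rightarrow> bool) \<Rightarrow> 'a list \<Rightarrow> bool" where
  "is_path E xs = (case xs of [i, j, k, l] \<Rightarrow>
     shape_of (E i j) (E i k) (E j k) (E i l) (E j l) (E k l) = Path | _ \<Rightarrow> False)"

definition class_of :: "('a \<Rightarrow> 'a \<Rightarrow> bool) \<Rightarrow> 'a list \<Rightarrow> 'a \<Rightarrow> nat option" where
  "class_of E xs u = (case xs of [i, j, k, l] \<Rightarrow> path_class (E i u) (E j u) (E k u) (E l u) | _ \<Rightarrow> None)"

definition is_match :: "('a \<Rightarrow> 'a \<Rightarrow> bool) \<Rightarrow> 'a list \<Rightarrow> bool" where
  "is_match E xs = (case xs of [i, j, k, l, u, v] \<Rightarrow> is_path E [i, j, k, l] \<and>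
     class_of E [i, j, k, l] u = Some 5 \<and> class_of E [i, j, k, l] v = Some 0 \<and> E u v | _ \<Rightarrow> False)"

definition pair_defect :: "('a \<Rightarrow> 'a \<Rightarrow> bool) \<Rightarrow> 'a list \<Rightarrow> 'a \<Rightarrow> 'a \<Rightarrow> int" where
  "pair_defect E ys u v = class_defect (class_of E ys u) (class_of E ys v) (E u v)"

definition defect :: "('a \<Rightarrow> 'a \<Rightarrow> bool) \<Rightarrow> 'a list \<Rightarrow> int" where
  "defect E xs = (case xs of [i, j, k, l, u, v] \<Rightarrow>
     of_bool (is_path E [i, j, k, l]) * pair_defect E [i, j, k, l] u v | _ \<Rightarrow> 0)"

lemma loss_split: "loss E xs = 62208 * of_bool (is_match E xs) + square_part E xs + 2 * defect E xs"
  by (cases "(E, xs)" rule: loss.cases)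
    (auto simp: square_part_def is_match_def defect_def pair_defect_def is_path_def class_of_def
      pair_loss_def path_loss_def)

lemma mean_append2:
  assumes "finite V"
  shows "mean V w (Suc (Suc n)) f =
    mean V w n (\<lambda>ys. \<Sum>u\<in>V. \<Sum>v\<in>V. w u * w v * f (ys @ [u, v]))"
proof (induction n arbitrary: f)
  case 0
  show ?case by (simp add: mean_Suc[OF assms] sum_distrib_left mult.assoc)
next
  case (Suc n)
  show ?case
    by (subst mean_Suc[OF assms], subst Suc, subst mean_Suc[OF assms]) simp
qed

locale weighted_graph =
  fixes V :: "'a set" and w :: "'a \<Rightarrow> real" and E :: "'a \<Rightarrow> 'a \<Rightarrow> bool"
  assumes finite_V: "finite V"
    and w_nonneg: "x \<in> V \<Longrightarrow> 0 \<le> w x"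
    and w_sum: "(\<Sum>x\<in>V. w x) = 1"
    and sym: "E x y = E y x"
    and irrefl: "\<not> E x x"
begin

definition match_density :: real where
  "match_density = mean V w 6 (\<lambda>xs. of_bool (is_match E xs))"

definition mean_defect :: real where
  "mean_defect = mean V w 6 (\<lambda>xs. of_int (defect E xs))"

text \<open>Averaging over the 720 orderings does not change the mean, and pointwise the averaged loss is
  bounded by \<open>total_loss_le\<close>. A tuple may repeat vertices: its pattern of adjacencies is still a
  simple graph on the six positions.\<close>

lemma mean_loss_le: "mean V w 6 (\<lambda>xs. of_int (loss E xs)) \<le> 16"
proof -
  have perm: "(\<Sum>p\<in>index_perms 6. loss E (map ((!) xs) p)) \<le> 11520" for xs
  proof -
    have "(\<Sum>p\<in>index_perms 6. loss E (map ((!) xs) p)) =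
        (\<Sum>p\<in>index_perms 6. loss (\<lambda>a b. E (xs ! a) (xs ! b)) p)"
    proof (intro sum.cong refl)
      fix p assume "p \<in> index_perms 6"
      then have "length p = 6" by (rule length_index_perms)
      then obtain i j k l u v where "p = [i, j, k, l, u, v]"
        by (auto simp: numeral_eq_Suc length_Suc_conv)
      then show "loss E (map ((!) xs) p) = loss (\<lambda>a b. E (xs ! a) (xs ! b)) p" by simp
    qed
    also have "\<dots> = (\<Sum>p\<in>permutations_of_set (set [0..<6]). loss (\<lambda>a b. E (xs ! a) (xs ! b)) p)"
      by (simp add: atLeast0LessThan)
    also have "\<dots> = total_loss (\<lambda>a b. E (xs ! a) (xs ! b)) [0..<6]"
      using sym by (intro sum_loss_eq_total_loss) auto
    also have "\<dots> \<le> 11520"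
      using sym irrefl by (intro total_loss_le) auto
    finally show ?thesis .
  qed
  have "card (index_perms 6) = 720"
    by (simp add: card_permutations_of_set fact_numeral)
  moreover have "(\<Sum>p\<in>index_perms 6. mean V w 6 (\<lambda>xs. of_int (loss E (map ((!) xs) p)))) =
      (\<Sum>p\<in>index_perms 6. mean V w 6 (\<lambda>xs. of_int (loss E xs)))"
    by (intro sum.cong refl mean_permute[OF finite_V])
  ultimately have "720 * mean V w 6 (\<lambda>xs. of_int (loss E xs)) =
      (\<Sum>p\<in>index_perms 6. mean V w 6 (\<lambda>xs. of_int (loss E (map ((!) xs) p))))"
    by simp
  also have "\<dots> = mean V w 6 (\<lambda>xs. of_int (\<Sum>p\<in>index_perms 6. loss E (map ((!) xs) p)))"
    by (simp add: mean_sum)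
  also have "\<dots> \<le> mean V w 6 (\<lambda>xs. 11520)"
    using w_nonneg perm by (intro mean_mono) (auto simp flip: of_int_sum intro: of_int_le_iff[THEN iffD2, of _ 11520, simplified])
  also have "\<dots> = 11520" by (rule mean_const[OF finite_V w_sum])
  finally show ?thesis by simp
qed

lemma tuples_4_cases:
  assumes "ys \<in> tuples V 4"
  obtains i j k l where "ys = [i, j, k, l]"
  using assms by (auto simp: tuples_def numeral_eq_Suc length_Suc_conv)

lemma mean_6: "mean V w 6 f = mean V w 4 (\<lambda>ys. \<Sum>u\<in>V. \<Sum>v\<in>V. w u * w v * f (ys @ [u, v]))"
  using mean_append2[OF finite_V, of w 4 f] by (simp add: numeral_eq_Suc)

text \<open>For fixed roots \<open>i, j, k, l\<close> the mean over \<open>u\<close> and \<open>v\<close> is a quadratic form in the mean coordinate vector.\<close>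

lemma mean_square_part_nonneg: "0 \<le> mean V w 6 (\<lambda>xs. of_int (square_part E xs))"
  unfolding mean_6
proof (rule mean_nonneg)
  fix ys assume "ys \<in> tuples V 4"
  then obtain i j k l where ys: "ys = [i, j, k, l]" by (rule tuples_4_cases)
  let ?t = "shape_of (E i j) (E i k) (E j k) (E i l) (E j l) (E k l)"
  let ?c = "\<lambda>c u. c (E i u) (E j u) (E k u) (E l u)"
  have nonneg: "0 \<le> (\<Sum>u\<in>V. \<Sum>v\<in>V. w u * w v * of_int (\<Sum>(M, c)\<leftarrow>S. bil M (?c c u) (?c c v)))"
    if "set S \<subseteq> set (squares ?t)" for S
    using that
  proof (induction S)
    case (Cons Mc S)
    obtain M c where Mc: "Mc = (M, c)" by (cases Mc)
    have "0 \<le> (\<Sum>u\<in>V. \<Sum>v\<in>V. w u * w v * of_int (bil M (?c c u) (?c c v)))"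
      using Cons.prems psd_squares[of M c ?t] Mc by (intro psd_sum_nonneg[where p = 1]) auto
    then show ?case
      using Cons by (simp add: Mc distrib_left sum.distrib)
  qed simp
  show "0 \<le> (\<Sum>u\<in>V. \<Sum>v\<in>V. w u * w v * of_int (square_part E (ys @ [u, v])))"
    using nonneg[of "squares ?t"] by (simp add: ys square_part_def square_value_def)
qed (rule w_nonneg)

theorem core_inequality: "62208 * match_density + 2 * mean_defect \<le> 16"
proof -
  have "mean V w 6 (\<lambda>xs. of_int (loss E xs)) =
      62208 * match_density + mean V w 6 (\<lambda>xs. of_int (square_part E xs)) + 2 * mean_defect"
    unfolding match_density_def mean_defect_def
    by (simp add: loss_split mean_add mean_cmult)
  then show ?thesis using mean_loss_le mean_square_part_nonneg by linarith
qed

end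

section \<open>Colourings by the hexagon\<close>

definition next_class :: "nat \<Rightarrow> nat" where
  "next_class c = (if c = 5 then 0 else Suc c)"

definition class_form :: "nat option \<Rightarrow> nat option \<Rightarrow> int" where
  "class_form a b = (case (a, b) of
     (Some c, Some d) \<Rightarrow> if c = d then 2 else if hex c d then - 1 else 0 | _ \<Rightarrow> 0)"

definition bad_pair :: "('a \<Rightarrow> 'a \<Rightarrow> bool) \<Rightarrow> 'a list \<Rightarrow> 'a \<Rightarrow> 'a \<Rightarrow> bool" where
  "bad_pair E ys u v = (case (class_of E ys u, class_of E ys v) of
     (Some c, Some d) \<Rightarrow> E u v \<noteq> hex c d | _ \<Rightarrow> True)"

lemma class_defect_eq:
  "pair_defect E ys u v = of_bool (bad_pair E ys u v) + class_form (class_of E ys u) (class_of E ys v)"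
  by (auto simp: pair_defect_def class_defect_def bad_pair_def class_form_def split: option.split)

lemma path_class_less: "path_class i j k l = Some c \<Longrightarrow> c < 6"
  by (cases i; cases j; cases k; cases l; auto)

lemma class_of_less: "class_of E ys u = Some c \<Longrightarrow> c < 6"
  by (auto simp: class_of_def dest: path_class_less split: list.splits)

definition class_diff :: "nat \<Rightarrow> nat option \<Rightarrow> real" where
  "class_diff c a = of_bool (a = Some c) - of_bool (a = Some (next_class c))"

lemma less_6_cases:
  fixes c :: nat
  assumes "c < 6"
  shows "c = 0 \<or> c = 1 \<or> c = 2 \<or> c = 3 \<or> c = 4 \<or> c = 5"
  using assms by linarith

text \<open>The form \<open>class_form\<close> is the Laplacian of the hexagon, hence the sum of the squared differences of
  consecutive positions.\<close>

lemma class_form_eq: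
  assumes "\<And>c. a = Some c \<Longrightarrow> c < 6" "\<And>c. b = Some c \<Longrightarrow> c < 6"
  shows "of_int (class_form a b) = (\<Sum>c<6. class_diff c a * class_diff c b)"
proof (cases "a = None \<or> b = None")
  case True
  then show ?thesis by (auto simp: class_form_def class_diff_def split: option.split)
next
  case False
  then obtain c d where cd: "a = Some c" "b = Some d" by auto
  then have "c < 6" "d < 6" using assms by auto
  then show ?thesis
    unfolding cd
    by (elim less_6_cases[THEN disjE] disjE; simp add: class_form_def class_diff_def next_class_def hex_def
        lessThan_nat_numeral lessThan_Suc doubleton_eq_iff)
qed

lemma sum_class_form:
  fixes w :: "'a \<Rightarrow> real"
  assumes "\<And>u c. u \<in> V \<Longrightarrow> \<kappa> u = Some c \<Longrightarrow> c < 6"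
  shows "(\<Sum>u\<in>V. \<Sum>v\<in>V. w u * w v * of_int (class_form (\<kappa> u) (\<kappa> v))) =
    (\<Sum>c<6. (\<Sum>u\<in>V. w u * class_diff c (\<kappa> u))\<^sup>2)"
proof -
  have "(\<Sum>u\<in>V. \<Sum>v\<in>V. w u * w v * of_int (class_form (\<kappa> u) (\<kappa> v))) =
      (\<Sum>u\<in>V. \<Sum>v\<in>V. \<Sum>c<6. (w u * class_diff c (\<kappa> u)) * (w v * class_diff c (\<kappa> v)))"
    using assms by (intro sum.cong refl) (simp add: class_form_eq sum_distrib_left algebra_simps)
  also have "\<dots> = (\<Sum>u\<in>V. \<Sum>c<6. \<Sum>v\<in>V. (w u * class_diff c (\<kappa> u)) * (w v * class_diff c (\<kappa> v)))"
    by (intro sum.cong refl sum.swap)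
  also have "\<dots> = (\<Sum>c<6. \<Sum>u\<in>V. \<Sum>v\<in>V. (w u * class_diff c (\<kappa> u)) * (w v * class_diff c (\<kappa> v)))"
    by (rule sum.swap)
  also have "\<dots> = (\<Sum>c<6. (\<Sum>u\<in>V. w u * class_diff c (\<kappa> u))\<^sup>2)"
    by (simp only: power2_eq_square sum_product)
  finally show ?thesis .
qed

context weighted_graph
begin

definition colour_error :: "('a \<Rightarrow> nat) \<Rightarrow> real" where
  "colour_error c = (\<Sum>u\<in>V. \<Sum>v\<in>V. w u * w v * of_bool (E u v \<noteq> hex (c u) (c v)))"

definition path_defect :: "'a list \<Rightarrow> real" where
  "path_defect ys = (\<Sum>u\<in>V. \<Sum>v\<in>V. w u * w v * of_int (pair_defect E ys u v))"

definition path_colouring :: "'a list \<Rightarrow> 'a \<Rightarrow> nat" where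
  "path_colouring ys u = (case class_of E ys u of Some c \<Rightarrow> c | None \<Rightarrow> 0)"

lemma path_defect_eq:
  "path_defect ys = (\<Sum>u\<in>V. \<Sum>v\<in>V. w u * w v * of_bool (bad_pair E ys u v)) +
     (\<Sum>c<6. (\<Sum>u\<in>V. w u * class_diff c (class_of E ys u))\<^sup>2)"
proof -
  have "path_defect ys = (\<Sum>u\<in>V. \<Sum>v\<in>V. w u * w v * of_bool (bad_pair E ys u v)) +
      (\<Sum>u\<in>V. \<Sum>v\<in>V. w u * w v * of_int (class_form (class_of E ys u) (class_of E ys v)))"
    unfolding path_defect_def class_defect_eq
    by (simp add: distrib_left sum.distrib)
  also have "(\<Sum>u\<in>V. \<Sum>v\<in>V. w u * w v * of_int (class_form (class_of E ys u) (class_of E ys v))) =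
      (\<Sum>c<6. (\<Sum>u\<in>V. w u * class_diff c (class_of E ys u))\<^sup>2)"
    by (rule sum_class_form) (rule class_of_less)
  finally show ?thesis .
qed

lemma path_defect_ge_form: "(\<Sum>c<6. (\<Sum>u\<in>V. w u * class_diff c (class_of E ys u))\<^sup>2) \<le> path_defect ys"
  unfolding path_defect_eq using w_nonneg by (simp add: sum_nonneg)

lemma path_defect_nonneg: "0 \<le> path_defect ys"
  by (rule order_trans[OF _ path_defect_ge_form]) (simp add: sum_nonneg)

text \<open>A wrong pair of the colouring is a bad pair of the path; a vertex without position may be coloured
  arbitrarily because all pairs containing it count as bad already.\<close>

lemma colour_error_path_colouring: "colour_error (path_colouring ys) \<le> path_defect ys"
proof -
  have "colour_error (path_colouring ys) \<le> (\<Sum>u\<in>V. \<Sum>v\<in>V. w u * w v * of_bool (bad_pair E ys u v))"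
    unfolding colour_error_def
    using w_nonneg
    by (intro sum_mono mult_left_mono mult_nonneg_nonneg)
      (auto simp: bad_pair_def path_colouring_def split: option.splits)
  also have "\<dots> \<le> path_defect ys" unfolding path_defect_eq by (simp add: sum_nonneg)
  finally show ?thesis .
qed

lemma path_colouring_less: "path_colouring ys u < 6"
  using class_of_less by (auto simp: path_colouring_def split: option.split)

lemma mean_defect_eq: "mean_defect = mean V w 4 (\<lambda>ys. of_bool (is_path E ys) * path_defect ys)"
  unfolding mean_defect_def mean_6
proof (rule mean_cong)
  fix ys assume "ys \<in> tuples V 4"
  then obtain i j k l where "ys = [i, j, k, l]" by (rule tuples_4_cases)
  then show "(\<Sum>u\<in>V. \<Sum>v\<in>V. w u * w v * of_int (defect E (ys @ [u, v]))) =
      of_bool (is_path E ys) * path_defect ys"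
    by (simp add: defect_def path_defect_def sum_distrib_left mult_ac)
qed

lemma mean_defect_nonneg: "0 \<le> mean_defect"
  unfolding mean_defect_eq
  by (intro mean_nonneg w_nonneg mult_nonneg_nonneg path_defect_nonneg) auto

lemma match_density_nonneg: "0 \<le> match_density"
  unfolding match_density_def by (intro mean_nonneg w_nonneg) auto

lemma match_density_le: "match_density \<le> 1 / 3888"
  using core_inequality mean_defect_nonneg by simp

lemma match_density_le_path_density: "match_density \<le> mean V w 4 (\<lambda>ys. of_bool (is_path E ys))"
  unfolding match_density_def mean_6
proof (intro mean_mono w_nonneg)
  fix ys assume "ys \<in> tuples V 4"
  then obtain i j k l where ys: "ys = [i, j, k, l]" by (rule tuples_4_cases)
  have "(\<Sum>u\<in>V. \<Sum>v\<in>V. w u * w v * of_bool (is_match E (ys @ [u, v]))) \<le>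
      (\<Sum>u\<in>V. \<Sum>v\<in>V. w u * w v * of_bool (is_path E ys))"
    using w_nonneg by (intro sum_mono mult_left_mono mult_nonneg_nonneg) (auto simp: ys is_match_def)
  also have "\<dots> = of_bool (is_path E ys)"
    using w_sum by (simp flip: sum_distrib_left sum_distrib_right)
  finally show "(\<Sum>u\<in>V. \<Sum>v\<in>V. w u * w v * of_bool (is_match E (ys @ [u, v]))) \<le> of_bool (is_path E ys)" .
qed

text \<open>The first four vertices of a match form a path, and only paths contribute to the mean defect.\<close>

lemma match_density_times_le_mean_defect:
  assumes "\<And>ys. ys \<in> tuples V 4 \<Longrightarrow> is_path E ys \<Longrightarrow> \<delta> \<le> path_defect ys" "0 \<le> \<delta>"
  shows "match_density * \<delta> \<le> mean_defect"
proof -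
  have "match_density * \<delta> \<le> mean V w 4 (\<lambda>ys. of_bool (is_path E ys)) * \<delta>"
    using match_density_le_path_density assms(2) by (rule mult_right_mono)
  also have "\<dots> = mean V w 4 (\<lambda>ys. \<delta> * of_bool (is_path E ys))"
    by (simp add: mean_cmult)
  also have "\<dots> \<le> mean_defect"
    unfolding mean_defect_eq by (intro mean_mono w_nonneg) (auto simp: assms(1))
  finally show ?thesis .
qed

text \<open>Take the colouring given by a path of least defect.\<close>

theorem ex_colouring:
  obtains c where "\<And>u. c u < (6::nat)" "match_density * colour_error c \<le> mean_defect"
proof (cases "\<exists>ys\<in>tuples V 4. is_path E ys")
  case False
  then have "match_density * colour_error (\<lambda>_. 0) \<le> 0"
    using match_density_times_le_mean_defect[of 0] match_density_le_path_density match_density_nonneg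
      mean_cong[of V 4 "\<lambda>ys. of_bool (is_path E ys)" "\<lambda>_. 0" w] mean_const[OF finite_V w_sum, of 4 0]
    by auto
  then show ?thesis using mean_defect_nonneg by (intro that[of "\<lambda>_. 0"]) auto
next
  case True
  define P where "P = {ys \<in> tuples V 4. is_path E ys}"
  have fin: "finite (path_defect ` P)" "path_defect ` P \<noteq> {}"
    using True finite_tuples[OF finite_V] by (auto simp: P_def)
  then have "Min (path_defect ` P) \<in> path_defect ` P" by (rule Min_in)
  then obtain ys where ys: "ys \<in> P" "path_defect ys = Min (path_defect ` P)" by force
  then have min: "path_defect ys \<le> path_defect zs" if "zs \<in> P" for zs
    using Min_le[OF fin(1)] that by simp
  have "match_density * colour_error (path_colouring ys) \<le> match_density * path_defect ys"
    by (intro mult_left_mono colour_error_path_colouring match_density_nonneg)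
  also have "\<dots> \<le> mean_defect"
    using min by (intro match_density_times_le_mean_defect path_defect_nonneg) (auto simp: P_def)
  finally show ?thesis using path_colouring_less by (intro that) auto
qed

end

lemma hex_sym: "hex c d = hex d c"
  unfolding hex_def doubleton_eq_iff by blast

lemma hex_irrefl: "\<not> hex c c"
  by (auto simp: hex_def doubleton_eq_iff)

text \<open>In the hexagon itself, the position of a vertex relative to an induced path is its actual position up
  to a rotation or reflection, which preserves \<open>class_form\<close>.\<close>

lemma hexagon_class_form_check:
  "\<forall>i\<in>set [0..<6]. \<forall>j\<in>set [0..<6]. \<forall>k\<in>set [0..<6]. \<forall>l\<in>set [0..<6].
      if is_path hex [i, j, k, l] then \<forall>u\<in>set [0..<6]. \<forall>v\<in>set [0..<6].
        class_form (class_of hex [i, j, k, l] u) (class_of hex [i, j, k, l] v) = class_form (Some u) (Some v)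
      else True"
  by code_simp

lemma hexagon_class_form:
  assumes "ys \<in> tuples {..<6} 4" "is_path hex ys" "u < 6" "v < 6"
  shows "class_form (class_of hex ys u) (class_of hex ys v) = class_form (Some u) (Some v)"
proof -
  obtain i j k l where ys: "ys = [i, j, k, l]"
    using assms(1) by (auto simp: tuples_def numeral_eq_Suc length_Suc_conv)
  have "{i, j, k, l} \<subseteq> set [0..<6]"
    using assms(1) unfolding ys tuples_def by auto
  then have "\<forall>u\<in>set [0..<6]. \<forall>v\<in>set [0..<6].
        class_form (class_of hex [i, j, k, l] u) (class_of hex [i, j, k, l] v) = class_form (Some u) (Some v)"
    using hexagon_class_form_check assms(2) unfolding ys by (simp del: set_upt)
  moreover have "u \<in> set [0..<6]" "v \<in> set [0..<6]" using assms(3,4) by simp_all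
  ultimately show ?thesis unfolding ys by blast
qed

locale weighted_hexagon =
  fixes x :: "nat \<Rightarrow> real"
  assumes x_nonneg: "c < 6 \<Longrightarrow> 0 \<le> x c" and x_sum: "(\<Sum>c<6. x c) = 1"
begin

sublocale weighted_graph "{..<6}" x hex
proof
  show "finite {..<6::nat}" by simp
  show "0 \<le> x c" if "c \<in> {..<6}" for c using that x_nonneg by simp
  show "(\<Sum>c<6. x c) = 1" by (rule x_sum)
  show "hex c d = hex d c" for c d by (rule hex_sym)
  show "\<not> hex c c" for c by (rule hex_irrefl)
qed

definition imbalance :: real where
  "imbalance = (\<Sum>c<6. (x c - x (next_class c))\<^sup>2)"

lemma imbalance_le: "match_density * imbalance \<le> mean_defect"
proof (rule match_density_times_le_mean_defect)
  fix ys assume ys: "ys \<in> tuples {..<6::nat} 4" "is_path hex ys"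
  have diff: "(\<Sum>u<6. x u * class_diff c (Some u)) = x c - x (next_class c)" if "c < 6" for c
  proof -
    have "next_class c < 6" using that by (auto simp: next_class_def)
    moreover have "(\<Sum>u<6. x u * of_bool (u = d)) = x d" if "d < 6" for d
    proof -
      have "x u * of_bool (u = d) = (if d = u then x d else 0)" for u by simp
      then show ?thesis using that by simp
    qed
    ultimately show ?thesis using that
      by (simp add: class_diff_def right_diff_distrib sum_subtractf)
  qed
  have "imbalance = (\<Sum>c<6. (\<Sum>u<6. x u * class_diff c (Some u))\<^sup>2)"
    unfolding imbalance_def by (intro sum.cong refl) (simp add: diff)
  also have "\<dots> = (\<Sum>u<6. \<Sum>v<6. x u * x v * of_int (class_form (Some u) (Some v)))"
    by (intro sum_class_form[symmetric]) simp
  also have "\<dots> = (\<Sum>u<6. \<Sum>v<6. x u * x v * of_int (class_form (class_of hex ys u) (class_of hex ys v)))"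
    using ys by (intro sum.cong refl) (simp add: hexagon_class_form)
  also have "\<dots> = (\<Sum>c<6. (\<Sum>u<6. x u * class_diff c (class_of hex ys u))\<^sup>2)"
    by (intro sum_class_form) (use class_of_less in auto)
  also have "\<dots> \<le> path_defect ys" by (rule path_defect_ge_form)
  finally show "imbalance \<le> path_defect ys" .
qed (simp add: imbalance_def sum_nonneg)

end

section \<open>Copies of the graph and matches\<close>

abbreviation adj :: "graph \<Rightarrow> nat \<Rightarrow> nat \<Rightarrow> bool" where
  "adj G x y \<equiv> {x, y} \<in> edges G"

lemma adj_C6_pattern: "adj C6_pattern c d \<longleftrightarrow> hex c d"
  unfolding C6_pattern_def hex_def by (simp add: doubleton_eq_iff) presburger

lemma simple_graph_irrefl: "simple_graph G \<Longrightarrow> \<not> adj G x x"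
  by (auto simp: simple_graph_def)

lemma simple_graph_verts: "simple_graph G \<Longrightarrow> adj G x y \<Longrightarrow> x \<in> verts G \<and> y \<in> verts G"
  by (auto simp: simple_graph_def)

lemma simple_graph_edge:
  assumes "simple_graph G" "e \<in> edges G"
  obtains x y where "x \<noteq> y" "e = {x, y}" "x \<in> verts G" "y \<in> verts G"
  using assms by (auto simp: simple_graph_def card_2_iff)

text \<open>The vertices of \<open>F50\<close> in the order \<open>i, j, k, l, u, v\<close> of a match.\<close>

definition template :: "nat list" where
  "template = [2, 0, 5, 4, 1, 3]"

lemma adj_F50_template:
  "map (\<lambda>a. map (\<lambda>b. adj F50 (template ! a) (template ! b)) [0..<6]) [0..<6] =
    [[False, True, False, False, True, False], [True, False, True, False, False, True],
     [False, True, False, True, False, False], [False, False, True, False, False, False],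
     [True, False, False, False, False, True], [False, True, False, False, True, False]]"
  by (simp add: template_def F50_def doubleton_eq_iff upt_rec)

lemma path_class_iff:
  "path_class i j k l = Some 5 \<longleftrightarrow> i \<and> \<not> j \<and> \<not> k \<and> \<not> l"
  "path_class i j k l = Some 0 \<longleftrightarrow> \<not> i \<and> j \<and> \<not> k \<and> \<not> l"
  by (cases i; cases j; cases k; cases l; simp)+

lemma shape_of_eq_Path:
  "shape_of ij ik jk il jl kl = Path \<longleftrightarrow> ij \<and> jk \<and> \<not> ik \<and> kl \<and> \<not> il \<and> \<not> jl"
  by (auto simp: shape_of_def)

lemma is_match_iff:
  assumes "\<And>x y. E x y = E y x" "\<And>x. \<not> E x x"
  shows "is_match E [i, j, k, l, u, v] \<longleftrightarrow>
    map (\<lambda>x. map (E x) [i, j, k, l, u, v]) [i, j, k, l, u, v] =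
    [[False, True, False, False, True, False], [True, False, True, False, False, True],
     [False, True, False, True, False, False], [False, False, True, False, False, False],
     [True, False, False, False, False, True], [False, True, False, False, True, False]]"
  using assms(2) assms(1)[of j i] assms(1)[of k i] assms(1)[of k j] assms(1)[of l i] assms(1)[of l j]
    assms(1)[of l k] assms(1)[of u i] assms(1)[of u j] assms(1)[of u k] assms(1)[of u l]
    assms(1)[of v i] assms(1)[of v j] assms(1)[of v k] assms(1)[of v l] assms(1)[of v u]
  by (simp add: is_match_def is_path_def class_of_def shape_of_eq_Path path_class_iff) argo

lemma is_match_iff_template:
  assumes "\<And>x y. E x y = E y x" "\<And>x. \<not> E x x" "length p = 6"
  shows "is_match E p \<longleftrightarrow> (\<forall>a<6. \<forall>b<6. E (p ! a) (p ! b) = adj F50 (template ! a) (template ! b))"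
proof -
  obtain i j k l u v where p: "p = [i, j, k, l, u, v]"
    using assms(3) by (auto simp: numeral_eq_Suc length_Suc_conv)
  have "(\<forall>a<6. \<forall>b<6. E (p ! a) (p ! b) = adj F50 (template ! a) (template ! b)) \<longleftrightarrow>
      map (\<lambda>a. map (\<lambda>b. E (p ! a) (p ! b)) [0..<6]) [0..<6] =
      map (\<lambda>a. map (\<lambda>b. adj F50 (template ! a) (template ! b)) [0..<6]) [0..<6]"
    by (simp only: map_eq_conv set_upt atLeastLessThan_iff le0 simp_thms Ball_def)
  also have "map (\<lambda>a. map (\<lambda>b. E (p ! a) (p ! b)) [0..<6]) [0..<6] = map (\<lambda>x. map (E x) p) p"
    by (simp add: p upt_rec)
  finally show ?thesis
    unfolding adj_F50_template by (simp only: p is_match_iff[OF assms(1,2)])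
qed

definition F50_rows :: "bool list list" where
  "F50_rows = [[False, False, True, True, False, True], [False, False, True, True, False, False],
    [True, True, False, False, False, False], [True, True, False, False, False, False],
    [False, False, False, False, False, True], [True, False, False, False, True, False]]"

text \<open>A table for evaluation.\<close>

definition F50_adj :: "nat \<Rightarrow> nat \<Rightarrow> bool" where
  "F50_adj a b = F50_rows ! a ! b"

lemma adj_F50_rows:
  assumes "a < 6" "b < 6"
  shows "adj F50 a b = F50_adj a b"
proof -
  have "map (\<lambda>a. map (adj F50 a) [0..<6]) [0..<6] = F50_rows"
    by (simp add: F50_rows_def F50_def doubleton_eq_iff upt_rec)
  then have "F50_rows ! a ! b = map (\<lambda>a. map (adj F50 a) [0..<6]) [0..<6] ! a ! b" by (simp only:)
  then show ?thesis using assms by (simp add: F50_adj_def)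
qed

lemma F50_matches_check:
  "\<forall>i\<in>set [0..<6]. \<forall>j\<in>set [0..<6]. \<forall>k\<in>set [0..<6]. \<forall>l\<in>set [0..<6].
     if is_path F50_adj [i, j, k, l] then \<forall>u\<in>set [0..<6]. \<forall>v\<in>set [0..<6].
       (if is_match F50_adj [i, j, k, l, u, v] \<and> v \<noteq> i
        then [i, j, k, l, u, v] = [2, 0, 5, 4, 1, 3] \<or> [i, j, k, l, u, v] = [3, 0, 5, 4, 1, 2] else True)
     else True"
  by code_simp

lemma F50_matches_cong:
  assumes "p \<in> index_perms 6"
  shows "is_match (adj F50) p = is_match F50_adj p"
proof -
  have "length p = 6" using assms by (rule length_index_perms)
  then obtain i j k l u v where p: "p = [i, j, k, l, u, v]"
    by (auto simp: numeral_eq_Suc length_Suc_conv)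
  have "x < 6" if "x \<in> set p" for x using that permutations_of_setD(1)[OF assms] by auto
  then show ?thesis
    by (simp add: p is_match_def is_path_def class_of_def adj_F50_rows)
qed

text \<open>The two matches differ by the automorphism of \<open>F50\<close> that exchanges 2 and 3. The tuple \<open>[2, 0, 5, 4, 1, 2]\<close>,
  in which \<open>v\<close> and \<open>i\<close> coincide, would satisfy the conditions of a match as well.\<close>

lemma F50_matches:
  "{p \<in> index_perms 6. is_match (adj F50) p} = {[2, 0, 5, 4, 1, 3], [3, 0, 5, 4, 1, 2]}"
proof (intro equalityI subsetI)
  fix p assume "p \<in> {p \<in> index_perms 6. is_match (adj F50) p}"
  then have p: "p \<in> index_perms 6" and match: "is_match F50_adj p" using F50_matches_cong by auto
  have "length p = 6" using p by (rule length_index_perms)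
  then obtain i j k l u v where p': "p = [i, j, k, l, u, v]"
    by (auto simp: numeral_eq_Suc length_Suc_conv)
  have "set p \<subseteq> set [0..<6]"
    using permutations_of_setD(1)[OF p] by (simp add: lessThan_atLeast0)
  then have mem: "{i, j, k, l, u, v} \<subseteq> set [0..<6]" by (simp only: p' list.set)
  have ne: "v \<noteq> i" using permutations_of_setD(2)[OF p] unfolding p' by auto
  have path: "is_path F50_adj [i, j, k, l]" using match by (simp add: p' is_match_def)
  have "if is_path F50_adj [i, j, k, l] then \<forall>u\<in>set [0..<6]. \<forall>v\<in>set [0..<6].
       (if is_match F50_adj [i, j, k, l, u, v] \<and> v \<noteq> i
        then [i, j, k, l, u, v] = [2, 0, 5, 4, 1, 3] \<or> [i, j, k, l, u, v] = [3, 0, 5, 4, 1, 2] else True)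
     else True"
    using F50_matches_check mem by blast
  then have "if is_match F50_adj [i, j, k, l, u, v] \<and> v \<noteq> i
      then [i, j, k, l, u, v] = [2, 0, 5, 4, 1, 3] \<or> [i, j, k, l, u, v] = [3, 0, 5, 4, 1, 2] else True"
    using mem unfolding if_P[OF path] by blast
  then have "[i, j, k, l, u, v] = [2, 0, 5, 4, 1, 3] \<or> [i, j, k, l, u, v] = [3, 0, 5, 4, 1, 2]"
    using ne match by (simp only: p' simp_thms if_True)
  then show "p \<in> {[2, 0, 5, 4, 1, 3], [3, 0, 5, 4, 1, 2]}" by (simp add: p')
next
  fix p :: "nat list" assume *: "p \<in> {[2, 0, 5, 4, 1, 3], [3, 0, 5, 4, 1, 2]}"
  then have p: "p \<in> index_perms 6" by (auto simp: permutations_of_set_def)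
  have "is_match F50_adj [2, 0, 5, 4, 1, 3]" "is_match F50_adj [3, 0, 5, 4, 1, 2]" by code_simp+
  then show "p \<in> {p \<in> index_perms 6. is_match (adj F50) p}"
    using * p F50_matches_cong[OF p] by auto
qed

lemma adj_induced_subgraph:
  "x \<in> S \<Longrightarrow> y \<in> S \<Longrightarrow> adj (induced_subgraph G S) x y = adj G x y"
  by (simp add: induced_subgraph_def)

lemma verts_induced_subgraph [simp]: "verts (induced_subgraph G S) = S"
  by (simp add: induced_subgraph_def)

lemma verts_F50 [simp]: "verts F50 = {..<6}"
  by (simp add: F50_def)

lemma adj_sym: "adj G x y = adj G y x"
  by (simp add: insert_commute)

text \<open>An isomorphism transports the matches of \<open>F50\<close>.\<close>

lemma card_matches_if_isomorphic:
  assumes G: "simple_graph G" and iso: "isomorphic (induced_subgraph G S) F50"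
  shows "card {p \<in> permutations_of_set S. is_match (adj G) p} = 2"
proof -
  obtain f where f: "bij_betw f S {..<6}"
    and adj: "\<And>x y. x \<in> S \<Longrightarrow> y \<in> S \<Longrightarrow> adj G x y = adj F50 (f x) (f y)"
    using iso adj_induced_subgraph unfolding isomorphic_def graph_iso_def by (auto 4 3)
  define g where "g = inv_into S f"
  have g: "bij_betw g {..<6} S" unfolding g_def by (rule bij_betw_inv_into[OF f])
  have fg: "f (g a) = a" if "a < 6" for a
    using bij_betw_inv_into_right[OF f] that by (simp add: g_def)
  have gf: "g (f x) = x" if "x \<in> S" for x
    using bij_betw_inv_into_left[OF f that] by (simp add: g_def)
  have gS: "g a \<in> S" if "a < 6" for a using bij_betwE[OF g] that by simp
  have match: "is_match (adj G) (map g q) = is_match (adj F50) q" if q: "q \<in> index_perms 6" for q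
  proof -
    have "q ! a < 6" if "a < 6" for a
      using permutations_of_setD(1)[OF q] length_index_perms[OF q] that nth_mem[of a q] by auto
    then have "adj G (map g q ! a) (map g q ! b) = adj F50 (q ! a) (q ! b)" if "a < 6" "b < 6" for a b
      using that length_index_perms[OF q] by (simp add: adj gS fg)
    then show ?thesis
      using length_index_perms[OF q] simple_graph_irrefl[OF G] simple_graph_irrefl[OF simple_graph_F50]
      by (simp add: is_match_iff_template adj_sym)
  qed
  have "{p \<in> permutations_of_set S. is_match (adj G) p} =
      map g ` {q \<in> index_perms 6. is_match (adj F50) q}"
  proof (intro equalityI subsetI)
    fix p assume "p \<in> {p \<in> permutations_of_set S. is_match (adj G) p}"
    then have p: "set p = S" "distinct p" and "is_match (adj G) p"
      by (auto simp: permutations_of_set_def)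
    moreover have q: "map f p \<in> index_perms 6"
      using p f by (auto simp: permutations_of_set_def distinct_map bij_betw_def)
    moreover have "map g (map f p) = p" using p gf by (auto intro!: map_idI)
    ultimately show "p \<in> map g ` {q \<in> index_perms 6. is_match (adj F50) q}"
      using match[OF q] by (intro image_eqI[of _ _ "map f p"]) auto
  next
    fix p assume "p \<in> map g ` {q \<in> index_perms 6. is_match (adj F50) q}"
    then obtain q where q: "q \<in> index_perms 6" "is_match (adj F50) q" "p = map g q" by auto
    then show "p \<in> {p \<in> permutations_of_set S. is_match (adj G) p}"
      using match g by (auto simp: permutations_of_set_def distinct_map bij_betw_def)
  qed
  moreover have "inj_on (map g) {q \<in> index_perms 6. is_match (adj F50) q}"
  proof (rule inj_onI)
    fix p q assume pq: "p \<in> {q \<in> index_perms 6. is_match (adj F50) q}"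
      "q \<in> {q \<in> index_perms 6. is_match (adj F50) q}" "map g p = map g q"
    have "map f (map g q) = q" if "q \<in> index_perms 6" for q
      using that fg by (auto simp: permutations_of_set_def intro!: map_idI)
    then have "map f (map g p) = p" "map f (map g q) = q" using pq(1,2) by blast+
    then show "p = q" using pq(3) by metis
  qed
  ultimately have "card {p \<in> permutations_of_set S. is_match (adj G) p} =
      card {q \<in> index_perms 6. is_match (adj F50) q}"
    by (simp only: card_image)
  also have "\<dots> = 2" unfolding F50_matches by simp
  finally show ?thesis .
qed

lemma isomorphic_if_match:
  assumes G: "simple_graph G" and p: "p \<in> permutations_of_set S" "card S = 6" and m: "is_match (adj G) p"
  shows "isomorphic (induced_subgraph G S) F50"
proof -
  have sp: "set p = S" "distinct p" using p by (auto simp: permutations_of_set_def)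
  have len: "length p = 6" using distinct_card[OF sp(2)] p(2) sp(1) by simp
  have nth: "bij_betw ((!) p) {..<6} S" using bij_betw_nth[OF sp(2)] len sp(1) by simp
  have "bij_betw ((!) template) {..<6} (set template)"
    by (rule bij_betw_nth) (simp_all add: template_def)
  moreover have "set template = {..<6}" by (auto simp: template_def)
  ultimately have tem: "bij_betw ((!) template) {..<6} {..<6}" by simp
  define f where "f = (!) template \<circ> inv_into {..<6} ((!) p)"
  have "bij_betw f S {..<6}"
    unfolding f_def by (rule bij_betw_trans[OF bij_betw_inv_into[OF nth] tem])
  moreover have "adj (induced_subgraph G S) x y = adj F50 (f x) (f y)" if "x \<in> S" "y \<in> S" for x y
  proof -
    define a where "a = inv_into {..<6} ((!) p) x"
    define b where "b = inv_into {..<6} ((!) p) y"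
    have "p ! a = x" "p ! b = y"
      using that bij_betw_inv_into_right[OF nth] by (simp_all add: a_def b_def)
    moreover have "a < 6" "b < 6"
      using that bij_betwE[OF bij_betw_inv_into[OF nth]] by (auto simp: a_def b_def)
    ultimately have "adj G x y = adj F50 (template ! a) (template ! b)"
      using m is_match_iff_template[of "adj G" p] len simple_graph_irrefl[OF G] adj_sym by metis
    then show ?thesis using that by (simp add: adj_induced_subgraph f_def a_def b_def)
  qed
  ultimately show ?thesis unfolding isomorphic_def graph_iso_def by auto
qed

definition copies :: "graph \<Rightarrow> nat" where
  "copies G = card {S. S \<subseteq> verts G \<and> card S = 6 \<and> isomorphic (induced_subgraph G S) F50}"

lemma induced_density_F50: "induced_density F50 G = real (copies G) / real (card (verts G) choose 6)"
  by (simp add: induced_density_def copies_def)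

text \<open>Group the matches by their vertex sets.\<close>

lemma card_distinct_matches:
  assumes G: "simple_graph G"
  shows "card {xs \<in> tuples (verts G) 6. distinct xs \<and> is_match (adj G) xs} = 2 * copies G"
proof -
  let ?C = "{S. S \<subseteq> verts G \<and> card S = 6}"
  let ?M = "\<lambda>S. {p \<in> permutations_of_set S. is_match (adj G) p}"
  have fin: "finite (verts G)" using G by (simp add: simple_graph_def)
  have finC: "finite ?C" using fin by simp
  have "{xs \<in> tuples (verts G) 6. distinct xs \<and> is_match (adj G) xs} = (\<Union>S\<in>?C. ?M S)"
    by (auto simp: tuples_def permutations_of_set_def distinct_card)
  moreover have "card (\<Union>S\<in>?C. ?M S) = (\<Sum>S\<in>?C. card (?M S))"
  proof (rule card_UN_disjoint[OF finC])
    show "\<forall>S\<in>?C. finite (?M S)" by simp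
    show "\<forall>S\<in>?C. \<forall>T\<in>?C. S \<noteq> T \<longrightarrow> ?M S \<inter> ?M T = {}"
      by (auto simp: permutations_of_set_def)
  qed
  moreover have "card (?M S) = (if isomorphic (induced_subgraph G S) F50 then 2 else 0)" if "S \<in> ?C" for S
    using card_matches_if_isomorphic[OF G, of S] isomorphic_if_match[OF G, of _ S] that by auto
  ultimately have "card {xs \<in> tuples (verts G) 6. distinct xs \<and> is_match (adj G) xs} =
      (\<Sum>S\<in>?C. if isomorphic (induced_subgraph G S) F50 then 2 else 0)"
    by simp
  also have "\<dots> = (\<Sum>S\<in>{S \<in> ?C. isomorphic (induced_subgraph G S) F50}. 2)"
    using finC by (subst sum.inter_filter) simp_all
  also have "\<dots> = 2 * copies G" by (simp add: copies_def conj_assoc)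
  finally show ?thesis .
qed

section \<open>Blowups and edit distance\<close>

text \<open>Blowups of the hexagon on a given vertex set correspond to colourings by \<open>{..<6}\<close>, which avoids
  families of parts and isomorphisms.\<close>

definition colour_graph :: "nat set \<Rightarrow> (nat \<Rightarrow> nat) \<Rightarrow> graph" where
  "colour_graph V c = (V, {{x, y} | x y. x \<in> V \<and> y \<in> V \<and> hex (c x) (c y)})"

lemma verts_colour_graph [simp]: "verts (colour_graph V c) = V"
  by (simp add: colour_graph_def)

lemma adj_colour_graph:
  "adj (colour_graph V c) x y \<longleftrightarrow> x \<in> V \<and> y \<in> V \<and> hex (c x) (c y)"
  unfolding colour_graph_def using hex_sym by (auto simp: doubleton_eq_iff)

lemma simple_graph_colour_graph: "finite V \<Longrightarrow> simple_graph (colour_graph V c)"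
  using hex_irrefl by (fastforce simp: simple_graph_def colour_graph_def card_2_iff)

lemma simple_graph_eqI:
  assumes "simple_graph G" "simple_graph H" "verts G = verts H"
    and "\<And>x y. x \<in> verts G \<Longrightarrow> y \<in> verts G \<Longrightarrow> adj G x y = adj H x y"
  shows "G = H"
proof -
  have "edges G = edges H"
  proof (intro equalityI subsetI)
    fix e assume "e \<in> edges G"
    with assms(1) obtain x y where "e = {x, y}" "x \<in> verts G" "y \<in> verts G"
      by (rule simple_graph_edge)
    then show "e \<in> edges H" using assms(4)[of x y] \<open>e \<in> edges G\<close> by simp
  next
    fix e assume "e \<in> edges H"
    with assms(2) obtain x y where "e = {x, y}" "x \<in> verts H" "y \<in> verts H"
      by (rule simple_graph_edge)
    then show "e \<in> edges G" using assms(3) assms(4)[of x y] \<open>e \<in> edges H\<close> by simp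
  qed
  then show ?thesis using assms(3) by (simp add: prod_eq_iff)
qed

lemma verts_C6_pattern [simp]: "verts C6_pattern = {..<6}"
  by (simp add: C6_pattern_def)

lemma blowup_eq_colour_graph:
  assumes parts: "blowup_parts C6_pattern U" and c: "\<And>i x. i < 6 \<Longrightarrow> x \<in> U i \<Longrightarrow> c x = i"
  shows "blowup C6_pattern U = colour_graph (\<Union>i<6. U i) c"
proof -
  have "(x \<noteq> y \<and> (\<exists>i\<in>{..<6}. \<exists>j\<in>{..<6}. x \<in> U i \<and> y \<in> U j \<and> adj C6_pattern i j)) \<longleftrightarrow>
      (x \<in> (\<Union>i<6. U i) \<and> y \<in> (\<Union>i<6. U i) \<and> hex (c x) (c y))" for x y
  proof
    assume "x \<noteq> y \<and> (\<exists>i\<in>{..<6}. \<exists>j\<in>{..<6}. x \<in> U i \<and> y \<in> U j \<and> adj C6_pattern i j)"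
    then obtain i j where "i < 6" "j < 6" "x \<in> U i" "y \<in> U j" "hex i j"
      unfolding adj_C6_pattern by auto
    then show "x \<in> (\<Union>i<6. U i) \<and> y \<in> (\<Union>i<6. U i) \<and> hex (c x) (c y)" using c by auto
  next
    assume "x \<in> (\<Union>i<6. U i) \<and> y \<in> (\<Union>i<6. U i) \<and> hex (c x) (c y)"
    then obtain i j where ij: "i < 6" "j < 6" "x \<in> U i" "y \<in> U j" "hex i j" using c by auto
    have "c x = i" "c y = j" using ij c by blast+
    then have "x \<noteq> y" using ij(5) hex_irrefl by metis
    with ij show "x \<noteq> y \<and> (\<exists>i\<in>{..<6}. \<exists>j\<in>{..<6}. x \<in> U i \<and> y \<in> U j \<and> adj C6_pattern i j)"
      unfolding adj_C6_pattern by auto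
  qed
  then show ?thesis by (simp only: blowup_def colour_graph_def verts_C6_pattern)
qed

lemma blowup_colouring:
  assumes "blowup_parts C6_pattern U"
  obtains c where "\<And>x. c x < (6::nat)" "\<And>i x. i < 6 \<Longrightarrow> x \<in> U i \<Longrightarrow> c x = i"
proof
  define c where "c x = (if \<exists>i<6. x \<in> U i then SOME i. i < 6 \<and> x \<in> U i else 0)" for x
  have c: "c x < 6 \<and> x \<in> U (c x)" if "\<exists>i<6. x \<in> U i" for x
    using someI_ex[OF that] that by (simp add: c_def)
  show "c x < 6" for x
  proof (cases "\<exists>i<6. x \<in> U i")
    case False
    then have "c x = 0" unfolding c_def by (rule if_not_P)
    then show ?thesis by simp
  qed (use c in blast)
  show "c x = i" if "i < 6" "x \<in> U i" for i x
    using c[of x] that assms by (auto simp: blowup_parts_def disjoint_family_on_def)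
qed

lemma colour_graph_in_blowups:
  assumes "finite V" "\<And>x. c x < 6"
  shows "colour_graph V c \<in> blowups C6_pattern"
proof -
  have parts: "blowup_parts C6_pattern (\<lambda>i. {x \<in> V. c x = i})"
    using assms(1) by (auto simp: blowup_parts_def disjoint_family_on_def)
  have "(\<Union>i<6. {x \<in> V. c x = i}) = V" using assms(2) by auto
  then have "blowup C6_pattern (\<lambda>i. {x \<in> V. c x = i}) = colour_graph V c"
    using blowup_eq_colour_graph[OF parts, of c] by simp
  then have "colour_graph V c = blowup C6_pattern (\<lambda>i. {x \<in> V. c x = i})" ..
  then show ?thesis using parts unfolding blowups_def by blast
qed

lemma isomorphic_refl: "isomorphic G G"
  unfolding isomorphic_def graph_iso_def by (rule exI[of _ id]) simp

lemma blowup_copies_eq_colour_graphs: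
  assumes "finite V"
  shows "{H. simple_graph H \<and> verts H = V \<and> (\<exists>K\<in>blowups C6_pattern. isomorphic H K)} =
    {colour_graph V c | c. \<forall>x. c x < 6}"
proof (intro equalityI subsetI)
  fix H assume "H \<in> {H. simple_graph H \<and> verts H = V \<and> (\<exists>K\<in>blowups C6_pattern. isomorphic H K)}"
  then obtain U f where H: "simple_graph H" "verts H = V" and U: "blowup_parts C6_pattern U"
    and f: "graph_iso f H (blowup C6_pattern U)"
    by (auto simp: blowups_def isomorphic_def)
  obtain c where c: "\<And>x. c x < 6" "\<And>i x. i < 6 \<Longrightarrow> x \<in> U i \<Longrightarrow> c x = i"
    using blowup_colouring[OF U] by blast
  have eq: "blowup C6_pattern U = colour_graph (\<Union>i<6. U i) c"
    by (rule blowup_eq_colour_graph[OF U]) (rule c(2))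
  have "adj H x y = adj (colour_graph V (c \<circ> f)) x y" if "x \<in> V" "y \<in> V" for x y
  proof -
    have "f x \<in> (\<Union>i<6. U i)" "f y \<in> (\<Union>i<6. U i)"
      using f that H(2) bij_betwE unfolding graph_iso_def eq by fastforce+
    moreover have "adj H x y = adj (colour_graph (\<Union>i<6. U i) c) (f x) (f y)"
      using f that H(2) unfolding graph_iso_def eq by blast
    ultimately show ?thesis using that by (simp add: adj_colour_graph)
  qed
  then have "H = colour_graph V (c \<circ> f)"
    using H assms by (intro simple_graph_eqI simple_graph_colour_graph) auto
  then show "H \<in> {colour_graph V c | c. \<forall>x. c x < 6}" using c(1) by auto
next
  fix H assume "H \<in> {colour_graph V c | c. \<forall>x. c x < 6}"
  then obtain c where H: "H = colour_graph V c" and c: "\<forall>x. c x < 6" by blast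
  have "H \<in> blowups C6_pattern" unfolding H using assms c by (intro colour_graph_in_blowups) auto
  then show "H \<in> {H. simple_graph H \<and> verts H = V \<and> (\<exists>K\<in>blowups C6_pattern. isomorphic H K)}"
    using simple_graph_colour_graph[OF assms] isomorphic_refl[of H] H by auto
qed

definition wrong_pairs :: "graph \<Rightarrow> (nat \<Rightarrow> nat) \<Rightarrow> (nat \<times> nat) set" where
  "wrong_pairs G c = {(x, y) \<in> verts G \<times> verts G. adj G x y \<noteq> hex (c x) (c y)}"

text \<open>Each edited edge accounts for two ordered pairs.\<close>

lemma card_wrong_pairs:
  fixes c :: "nat \<Rightarrow> nat"
  assumes G: "simple_graph G"
  defines "H \<equiv> colour_graph (verts G) c"
  shows "card (wrong_pairs G c) = 2 * card ((edges G - edges H) \<union> (edges H - edges G))"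
proof -
  let ?D = "(edges G - edges H) \<union> (edges H - edges G)"
  have fin: "finite (verts G)" using G by (simp add: simple_graph_def)
  have H: "simple_graph H" "verts H = verts G"
    using simple_graph_colour_graph[OF fin] by (simp_all add: H_def)
  have adjH: "adj H x y = hex (c x) (c y)" if "x \<in> verts G" "y \<in> verts G" for x y
    using that by (simp add: H_def adj_colour_graph)
  have finD: "finite ?D"
    using G H fin by (intro finite_subset[of ?D "Pow (verts G)"]) (auto simp: simple_graph_def)
  have "wrong_pairs G c = (\<Union>e\<in>?D. {(x, y). {x, y} = e})"
  proof (intro equalityI subsetI)
    fix z assume "z \<in> wrong_pairs G c"
    then obtain x y where "z = (x, y)" "x \<in> verts G" "y \<in> verts G" "adj G x y \<noteq> adj H x y"
      using adjH by (auto simp: wrong_pairs_def)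
    then show "z \<in> (\<Union>e\<in>?D. {(x, y). {x, y} = e})" by auto
  next
    fix z assume "z \<in> (\<Union>e\<in>?D. {(x, y). {x, y} = e})"
    then obtain x y where z: "z = (x, y)" "adj G x y \<noteq> adj H x y" by auto
    then have "x \<in> verts G \<and> y \<in> verts G"
      using simple_graph_verts[OF G, of x y] simple_graph_verts[OF H(1), of x y] H(2) by auto
    then show "z \<in> wrong_pairs G c" using z adjH by (auto simp: wrong_pairs_def)
  qed
  moreover have "card (\<Union>e\<in>?D. {(x, y). {x, y} = e}) = (\<Sum>e\<in>?D. card {(x, y). {x, y} = e})"
  proof (rule card_UN_disjoint[OF finD])
    show "\<forall>e\<in>?D. finite {(x, y). {x, y} = e}"
    proof
      fix e assume "e \<in> ?D"
      then have "e \<subseteq> verts G" using G H by (auto simp: simple_graph_def)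
      then have "{(x, y). {x, y} = e} \<subseteq> verts G \<times> verts G" by auto
      then show "finite {(x, y). {x, y} = e}" using fin by (meson finite_SigmaI finite_subset)
    qed
  qed auto
  moreover have "card {(x, y). {x, y} = e} = 2" if "e \<in> ?D" for e
  proof -
    have "card e = 2" using that G H by (auto simp: simple_graph_def)
    then obtain a b where ab: "e = {a, b}" "a \<noteq> b" by (auto simp: card_2_iff)
    then have "{(x, y). {x, y} = e} = {(a, b), (b, a)}" by (auto simp: doubleton_eq_iff)
    then show ?thesis using ab by simp
  qed
  ultimately show ?thesis by simp
qed

lemma edit_distance_colourings:
  assumes G: "simple_graph G"
  shows "\<And>c. (\<And>x. c x < 6) \<Longrightarrow> 2 * edit_distance G C6_pattern \<le> card (wrong_pairs G c)"
    and "\<exists>c. (\<forall>x. c x < 6) \<and> 2 * edit_distance G C6_pattern = card (wrong_pairs G c)"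
proof -
  let ?d = "\<lambda>H. card ((edges G - edges H) \<union> (edges H - edges G))"
  let ?S = "{?d H | H. simple_graph H \<and> verts H = verts G \<and> (\<exists>K\<in>blowups C6_pattern. isomorphic H K)}"
  have fin: "finite (verts G)" using G by (simp add: simple_graph_def)
  have "?S = ?d ` {H. simple_graph H \<and> verts H = verts G \<and> (\<exists>K\<in>blowups C6_pattern. isomorphic H K)}"
    by (rule setcompr_eq_image)
  also have "\<dots> = ?d ` {colour_graph (verts G) c | c. \<forall>x. c x < 6}"
    unfolding blowup_copies_eq_colour_graphs[OF fin] ..
  finally have S: "?S = {?d (colour_graph (verts G) c) | c. \<forall>x. c x < 6}" by auto
  have "?d H \<le> card (Pow (verts G))" if "simple_graph H" "verts H = verts G" for H
    using that G fin by (intro card_mono) (auto simp: simple_graph_def)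
  then have finS: "finite ?S" by (intro finite_subset[of ?S "{..card (Pow (verts G))}"]) auto
  have ne: "?S \<noteq> {}" unfolding S by (auto intro: exI[of _ "\<lambda>_. 0"])
  show "2 * edit_distance G C6_pattern \<le> card (wrong_pairs G c)" if "\<And>x. c x < 6" for c
  proof -
    have "?d (colour_graph (verts G) c) \<in> ?S" unfolding S using that by auto
    then have "edit_distance G C6_pattern \<le> ?d (colour_graph (verts G) c)"
      unfolding edit_distance_def using finS by (rule Min_le[rotated])
    then show ?thesis by (simp add: card_wrong_pairs[OF G])
  qed
  have "edit_distance G C6_pattern \<in> ?S"
    unfolding edit_distance_def using finS ne by (rule Min_in)
  then obtain c where "\<forall>x. c x < 6" "edit_distance G C6_pattern = ?d (colour_graph (verts G) c)"
    unfolding S by auto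
  then show "\<exists>c. (\<forall>x. c x < 6) \<and> 2 * edit_distance G C6_pattern = card (wrong_pairs G c)"
    using card_wrong_pairs[OF G] by auto
qed

section \<open>Perturbing the weights and the graph\<close>

lemma mean_append1:
  assumes "finite V"
  shows "mean V w (Suc n) f = mean V w n (\<lambda>ys. \<Sum>v\<in>V. w v * f (ys @ [v]))"
proof (induction n arbitrary: f)
  case 0
  show ?case by (simp add: mean_Suc[OF assms])
next
  case (Suc n)
  show ?case
    by (subst mean_Suc[OF assms], subst Suc, subst mean_Suc[OF assms]) simp
qed

text \<open>Two different entries of a random tuple are independent; by exchangeability they may be taken to be
  the first two.\<close>

lemma mean_marginal:
  assumes V: "finite V" "(\<Sum>x\<in>V. w x) = 1" and ab: "a < n" "b < n" "a \<noteq> b"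
  shows "mean V w n (\<lambda>xs. g (xs ! a) (xs ! b)) = (\<Sum>u\<in>V. \<Sum>v\<in>V. w u * w v * g u v)"
proof -
  define p where "p = a # b # filter (\<lambda>i. i \<noteq> a \<and> i \<noteq> b) [0..<n]"
  have p: "p \<in> index_perms n" using ab by (auto simp: p_def permutations_of_set_def)
  obtain m where n: "n = Suc (Suc m)" using ab by (metis less_antisym not0_implies_Suc not_less0 less_Suc0)
  have "mean V w n (\<lambda>xs. g (xs ! a) (xs ! b)) =
      mean V w n (\<lambda>xs. (\<lambda>ys. g (ys ! 0) (ys ! 1)) (map ((!) xs) p))"
    by (simp add: p_def)
  also have "\<dots> = mean V w n (\<lambda>ys. g (ys ! 0) (ys ! 1))"
    by (rule mean_permute[OF V(1) p])
  also have "\<dots> = (\<Sum>u\<in>V. w u * (\<Sum>v\<in>V. w v * g u v))"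
    by (simp add: n mean_Suc[OF V(1)] mean_const[OF V])
  finally show ?thesis by (simp add: sum_distrib_left mult.assoc)
qed

lemma abs_prod_list_diff_le:
  fixes w1 w2 :: "'a \<Rightarrow> real"
  assumes "0 \<le> \<rho>" "\<And>x. x \<in> set xs \<Longrightarrow> 0 \<le> w2 x" "\<And>x. x \<in> set xs \<Longrightarrow> \<bar>w1 x - w2 x\<bar> \<le> \<rho> * w2 x"
  shows "\<bar>prod_list (map w1 xs) - prod_list (map w2 xs)\<bar> \<le>
    ((1 + \<rho>) ^ length xs - 1) * prod_list (map w2 xs)"
  using assms(2,3)
proof (induction xs)
  case (Cons x xs)
  define P where "P = prod_list (map w1 xs)"
  define Q where "Q = prod_list (map w2 xs)"
  define k where "k = (1 + \<rho>) ^ length xs - 1"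
  have Q: "0 \<le> Q" unfolding Q_def using Cons.prems by (intro prod_list_nonneg) auto
  have IH: "\<bar>P - Q\<bar> \<le> k * Q" using Cons by (simp add: P_def Q_def k_def)
  have x: "\<bar>w1 x - w2 x\<bar> \<le> \<rho> * w2 x" "0 \<le> w2 x" using Cons.prems by auto
  then have w1: "\<bar>w1 x\<bar> \<le> (1 + \<rho>) * w2 x" by (simp add: algebra_simps)
  have "\<bar>w1 x * P - w2 x * Q\<bar> = \<bar>w1 x * (P - Q) + (w1 x - w2 x) * Q\<bar>"
    by (simp add: algebra_simps)
  also have "\<dots> \<le> \<bar>w1 x\<bar> * \<bar>P - Q\<bar> + \<bar>w1 x - w2 x\<bar> * Q"
    using abs_triangle_ineq[of "w1 x * (P - Q)" "(w1 x - w2 x) * Q"] Q by (simp add: abs_mult)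
  also have "\<dots> \<le> ((1 + \<rho>) * w2 x) * (k * Q) + (\<rho> * w2 x) * Q"
    using IH x w1 Q assms(1) by (intro add_mono mult_mono) auto
  also have "\<dots> = ((1 + \<rho>) ^ length (x # xs) - 1) * (w2 x * Q)"
    by (simp add: k_def algebra_simps)
  finally show ?case by (simp add: P_def Q_def)
qed simp

text \<open>If the weights agree up to a factor between \<open>1 - \<rho>\<close> and \<open>1 + \<rho>\<close>, then so do their products over
  \<open>n\<close>-tuples up to \<open>(1 + \<rho>) ^ n\<close>.\<close>

lemma abs_mean_diff_le:
  assumes "0 \<le> \<rho>" "\<And>x. x \<in> V \<Longrightarrow> 0 \<le> w2 x" "\<And>x. x \<in> V \<Longrightarrow> \<bar>w1 x - w2 x\<bar> \<le> \<rho> * w2 x"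
  shows "\<bar>mean V w1 n f - mean V w2 n f\<bar> \<le> ((1 + \<rho>) ^ n - 1) * mean V w2 n (\<lambda>xs. \<bar>f xs\<bar>)"
proof -
  have "\<bar>mean V w1 n f - mean V w2 n f\<bar> \<le>
      (\<Sum>xs\<in>tuples V n. \<bar>prod_list (map w1 xs) - prod_list (map w2 xs)\<bar> * \<bar>f xs\<bar>)"
    unfolding mean_def sum_subtractf[symmetric] left_diff_distrib[symmetric] abs_mult[symmetric]
    by (rule sum_abs)
  also have "\<dots> \<le> (\<Sum>xs\<in>tuples V n. (((1 + \<rho>) ^ n - 1) * prod_list (map w2 xs)) * \<bar>f xs\<bar>)"
  proof (intro sum_mono mult_right_mono abs_ge_zero)
    fix xs assume "xs \<in> tuples V n"
    then have "set xs \<subseteq> V" "length xs = n" by (auto simp: tuples_def)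
    then show "\<bar>prod_list (map w1 xs) - prod_list (map w2 xs)\<bar> \<le> ((1 + \<rho>) ^ n - 1) * prod_list (map w2 xs)"
      using abs_prod_list_diff_le[of \<rho> xs w2 w1] assms by (auto simp: subset_iff)
  qed
  also have "\<dots> = ((1 + \<rho>) ^ n - 1) * mean V w2 n (\<lambda>xs. \<bar>f xs\<bar>)"
    by (simp add: mean_def sum_distrib_left mult.assoc)
  finally show ?thesis .
qed

lemma mean_uniform:
  "mean V (\<lambda>_. 1 / m) n (\<lambda>xs. of_bool (P xs)) = real (card {xs \<in> tuples V n. P xs}) / m ^ n"
  if "finite V"
proof -
  have "mean V (\<lambda>_. 1 / m) n (\<lambda>xs. of_bool (P xs)) = (\<Sum>xs\<in>tuples V n. (1 / m) ^ n * of_bool (P xs))"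
    unfolding mean_def
    by (intro sum.cong refl) (auto simp: tuples_def map_replicate_const prod_list_replicate simp del: map_replicate)
  also have "\<dots> = (1 / m) ^ n * real (card {xs \<in> tuples V n. P xs})"
    using finite_tuples[OF that] by (simp add: sum_distrib_left[symmetric] Int_def conj_commute)
  finally show ?thesis by (simp add: power_one_over divide_simps)
qed

lemma match_differs:
  assumes "\<And>x y. E x y = E y x" "\<And>x. \<not> E x x" "\<And>x y. E' x y = E' y x" "\<And>x. \<not> E' x x"
    and "length xs = 6" "is_match E xs \<noteq> is_match E' xs"
  obtains a b where "a < 6" "b < 6" "a \<noteq> b" "E (xs ! a) (xs ! b) \<noteq> E' (xs ! a) (xs ! b)"
proof -
  obtain a b where "a < 6" "b < 6" "E (xs ! a) (xs ! b) \<noteq> E' (xs ! a) (xs ! b)"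
    using assms(6) is_match_iff_template[of E xs, OF assms(1,2,5)]
      is_match_iff_template[of E' xs, OF assms(3,4,5)] by metis
  moreover from this have "a \<noteq> b" using assms(2,4) by auto
  ultimately show thesis using that by blast
qed

text \<open>Any other two entries of a match are distinguished by their adjacency to some entry.\<close>

lemma match_not_distinct:
  assumes "\<And>x y. E x y = E y x" "\<And>x. \<not> E x x" "length xs = 6" "is_match E xs" "\<not> distinct xs"
  shows "xs ! 5 = xs ! 0"
proof -
  obtain i j k l u v where xs: "xs = [i, j, k, l, u, v]"
    using assms(3) by (auto simp: numeral_eq_Suc length_Suc_conv)
  have "is_match E [i, j, k, l, u, v]" using assms(4) xs by simp
  then have rows: "map (E i) [j, u] = [True, True]" "map (E j) [i, j, k, v, u] = [True, False, True, True, False]"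
      "map (E k) [j, k, l, u, v] = [True, False, True, False, False]" "map (E l) [k, l, u, v] = [True, False, False, False]"
      "map (E u) [i, j, k, l, u, v] = [True, False, False, False, False, True]"
      "map (E v) [j, k, l, v] = [True, False, False, False]"
    unfolding is_match_iff[of E, OF assms(1,2)] by simp_all
  have ne: "x \<noteq> y" if "E x z" "\<not> E y z" for x y z using that by blast
  have "i \<noteq> j" by (rule ne[where z = j]) (use rows in simp_all)
  moreover have "i \<noteq> k" by (rule ne[where z = u]) (use rows in simp_all)
  moreover have "i \<noteq> l" by (rule ne[where z = u]) (use rows in simp_all)
  moreover have "i \<noteq> u" by (rule ne[where z = j]) (use rows in simp_all)
  moreover have "j \<noteq> k" by (rule ne[where z = v]) (use rows in simp_all)
  moreover have "j \<noteq> l" by (rule ne[where z = v]) (use rows in simp_all)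
  moreover have "j \<noteq> u" by (rule ne[where z = k]) (use rows in simp_all)
  moreover have "j \<noteq> v" by (rule ne[where z = v]) (use rows in simp_all)
  moreover have "k \<noteq> l" by (rule ne[where z = l]) (use rows in simp_all)
  moreover have "k \<noteq> u" by (rule ne[where z = l]) (use rows in simp_all)
  moreover have "k \<noteq> v" by (rule ne[where z = l]) (use rows in simp_all)
  moreover have "l \<noteq> u" by (rule ne[where z = k]) (use rows in simp_all)
  moreover have "l \<noteq> v" by (rule ne[where z = k]) (use rows in simp_all)
  moreover have "u \<noteq> v" by (rule ne[where z = v]) (use rows in simp_all)
  ultimately show ?thesis using assms(5) by (simp add: xs)
qed

text \<open>If a tuple is a match in only one of two graphs, then these differ in some pair of its entries.\<close>

lemma mean_match_diff_le:
  fixes w :: "'a \<Rightarrow> real"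
  assumes V: "finite V" "\<And>x. x \<in> V \<Longrightarrow> 0 \<le> w x" "(\<Sum>x\<in>V. w x) = 1"
    and E: "\<And>x y. E x y = E y x" "\<And>x. \<not> E x x" "\<And>x y. E' x y = E' y x" "\<And>x. \<not> E' x x"
  shows "mean V w 6 (\<lambda>xs. of_bool (is_match E xs \<noteq> is_match E' xs)) \<le>
    36 * (\<Sum>u\<in>V. \<Sum>v\<in>V. w u * w v * of_bool (E u v \<noteq> E' u v))"
proof -
  let ?\<beta> = "\<Sum>u\<in>V. \<Sum>v\<in>V. w u * w v * of_bool (E u v \<noteq> E' u v)"
  let ?d = "\<lambda>a b xs. of_bool (a \<noteq> b) * of_bool (E (xs ! a) (xs ! b) \<noteq> E' (xs ! a) (xs ! b))"
  have \<beta>: "0 \<le> ?\<beta>" using V(2) by (intro sum_nonneg) auto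
  have "mean V w 6 (\<lambda>xs. of_bool (is_match E xs \<noteq> is_match E' xs)) \<le>
      mean V w 6 (\<lambda>xs. \<Sum>z\<in>{..<6::nat} \<times> {..<6::nat}. ?d (fst z) (snd z) xs)"
  proof (intro mean_mono V(2))
    fix xs assume "xs \<in> tuples V 6"
    then have len: "length xs = 6" by (simp add: tuples_def)
    show "of_bool (is_match E xs \<noteq> is_match E' xs) \<le>
        (\<Sum>z\<in>{..<6::nat} \<times> {..<6::nat}. ?d (fst z) (snd z) xs :: real)"
    proof (cases "is_match E xs = is_match E' xs")
      case False
      obtain a b where "a < 6" "b < 6" "a \<noteq> b" "E (xs ! a) (xs ! b) \<noteq> E' (xs ! a) (xs ! b)"
        using match_differs[of E E' xs, OF E len False] by blast
      then have "1 = (?d (fst (a, b)) (snd (a, b)) xs :: real)" "(a, b) \<in> {..<6} \<times> {..<6}" by auto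
      then show ?thesis
        using member_le_sum[of "(a, b)" "{..<6} \<times> {..<6}" "\<lambda>z. ?d (fst z) (snd z) xs :: real"] False by simp
    qed (simp add: sum_nonneg)
  qed
  also have "\<dots> = (\<Sum>z\<in>{..<6::nat} \<times> {..<6::nat}. mean V w 6 (?d (fst z) (snd z)))"
    by (rule mean_sum)
  also have "\<dots> \<le> (\<Sum>z\<in>{..<6::nat} \<times> {..<6::nat}. ?\<beta>)"
  proof (intro sum_mono)
    fix z assume "z \<in> {..<6::nat} \<times> {..<6::nat}"
    then show "mean V w 6 (?d (fst z) (snd z)) \<le> ?\<beta>"
      using \<beta> mean_marginal[OF V(1,3), of "fst z" 6 "snd z" "\<lambda>u v. of_bool (E u v \<noteq> E' u v)"]
        mean_const[OF V(1,3), of 6 0]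
      by (cases "fst z = snd z") auto
  qed
  finally show ?thesis by simp
qed

lemma mean_match_not_distinct_le:
  assumes V: "finite V" "V \<noteq> {}" and E: "\<And>x y. E x y = E y x" "\<And>x. \<not> E x x"
  shows "mean V (\<lambda>_. 1 / card V) 6 (\<lambda>xs. of_bool (is_match E xs \<and> \<not> distinct xs)) \<le> 1 / card V"
proof -
  let ?w = "\<lambda>_. 1 / real (card V)"
  have sum: "(\<Sum>x\<in>V. ?w x) = 1" using V by simp
  have "mean V ?w 6 (\<lambda>xs. of_bool (is_match E xs \<and> \<not> distinct xs)) \<le> mean V ?w 6 (\<lambda>xs. of_bool (xs ! 5 = xs ! 0))"
    using match_not_distinct[of E, OF E] by (intro mean_mono) (auto simp: tuples_def)
  also have "\<dots> = (\<Sum>u\<in>V. \<Sum>v\<in>V. ?w u * ?w v * of_bool (u = v))"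
    using mean_marginal[OF V(1) sum, of 5 6 0 "\<lambda>u v. of_bool (u = v)"] by simp
  also have "\<dots> = 1 / card V" using V by (simp add: of_bool_def if_distrib cong: if_cong)
  finally show ?thesis .
qed

text \<open>A match with a repetition is determined by its first five entries, which gains a factor
  \<open>1 / card V\<close> on top of the proportion of differing pairs.\<close>

lemma mean_match_diff_not_distinct_le:
  assumes V: "finite V" "V \<noteq> {}"
    and E: "\<And>x y. E x y = E y x" "\<And>x. \<not> E x x" "\<And>x y. E' x y = E' y x" "\<And>x. \<not> E' x x"
  defines "w \<equiv> \<lambda>_. 1 / real (card V)"
  shows "mean V w 6 (\<lambda>xs. of_bool ((is_match E xs \<noteq> is_match E' xs) \<and> \<not> distinct xs)) \<le>
    25 / card V * (\<Sum>u\<in>V. \<Sum>v\<in>V. w u * w v * of_bool (E u v \<noteq> E' u v))"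
proof -
  let ?\<beta> = "\<Sum>u\<in>V. \<Sum>v\<in>V. w u * w v * of_bool (E u v \<noteq> E' u v)"
  let ?d = "\<lambda>a b ys. of_bool (a \<noteq> b) * of_bool (E (ys ! a) (ys ! b) \<noteq> E' (ys ! a) (ys ! b))"
  let ?S = "\<lambda>ys. \<Sum>z\<in>{..<5::nat} \<times> {..<5::nat}. ?d (fst z) (snd z) ys"
  have w: "0 \<le> w x" for x by (simp add: w_def)
  have sum: "(\<Sum>x\<in>V. w x) = 1" using V by (simp add: w_def)
  have \<beta>: "0 \<le> ?\<beta>" using w by (intro sum_nonneg) auto
  have S0: "0 \<le> (?S ys :: real)" for ys by (intro sum_nonneg) auto
  have point: "of_bool ((is_match E xs \<noteq> is_match E' xs) \<and> \<not> distinct xs) \<le> of_bool (v = ys ! 0) * (?S ys :: real)"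
    if xs: "xs = ys @ [v]" and len: "length ys = 5" for xs ys v
  proof (cases "(is_match E xs \<noteq> is_match E' xs) \<and> \<not> distinct xs")
    case True
    have len6: "length xs = 6" using xs len by simp
    have "xs ! 5 = xs ! 0"
      using True match_not_distinct[of E, OF E(1,2) len6] match_not_distinct[of E', OF E(3,4) len6] by blast
    then have v: "v = ys ! 0" using xs len by (simp add: nth_append)
    obtain a b where ab: "a < 6" "b < 6" "a \<noteq> b" "E (xs ! a) (xs ! b) \<noteq> E' (xs ! a) (xs ! b)"
      using match_differs[of E E' xs, OF E len6] True by blast
    \<comment> \<open>Since the last entry repeats the first, the differing pair can be sought among the first five.\<close>
    define r where "r i = (if i = 5 then 0 else i)" for i :: nat
    have r: "r i < 5" "xs ! i = ys ! r i" if "i < 6" for i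
      using that xs len v by (auto simp: r_def nth_append less_Suc_eq numeral_eq_Suc)
    have diff: "E (ys ! r a) (ys ! r b) \<noteq> E' (ys ! r a) (ys ! r b)" using ab r by simp
    then have "r a \<noteq> r b" using E(2,4) by auto
    then have "1 = (?d (fst (r a, r b)) (snd (r a, r b)) ys :: real)" "(r a, r b) \<in> {..<5} \<times> {..<5}"
      using diff r ab by auto
    then have "1 \<le> (?S ys :: real)"
      using member_le_sum[of "(r a, r b)" "{..<5} \<times> {..<5}" "\<lambda>z. ?d (fst z) (snd z) ys :: real"] by simp
    then show ?thesis using v by simp
  next
    case False
    then have "of_bool ((is_match E xs \<noteq> is_match E' xs) \<and> \<not> distinct xs) = (0 :: real)" by simp
    then show ?thesis using mult_nonneg_nonneg[OF _ S0, of "of_bool (v = ys ! 0)" ys] by (simp only: zero_less_eq_of_bool)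
  qed
  have six: "Suc 5 = (6 :: nat)" by simp
  have "mean V w 6 (\<lambda>xs. of_bool ((is_match E xs \<noteq> is_match E' xs) \<and> \<not> distinct xs)) =
      mean V w 5 (\<lambda>ys. \<Sum>v\<in>V. w v * of_bool ((is_match E (ys @ [v]) \<noteq> is_match E' (ys @ [v])) \<and> \<not> distinct (ys @ [v])))"
    using mean_append1[OF V(1), of w 5 "\<lambda>xs. of_bool ((is_match E xs \<noteq> is_match E' xs) \<and> \<not> distinct xs)"]
    unfolding six .
  also have "\<dots> \<le> mean V w 5 (\<lambda>ys. 1 / card V * ?S ys)"
  proof (intro mean_mono w)
    fix ys assume ys: "ys \<in> tuples V 5"
    then have len: "length ys = 5" and mem: "ys ! 0 \<in> V" by (auto simp: tuples_def subset_iff)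
    have "(\<Sum>v\<in>V. w v * of_bool ((is_match E (ys @ [v]) \<noteq> is_match E' (ys @ [v])) \<and> \<not> distinct (ys @ [v]))) \<le>
        (\<Sum>v\<in>V. w v * (of_bool (v = ys ! 0) * ?S ys))"
      using point[OF refl len] by (intro sum_mono mult_left_mono w)
    also have "\<dots> = (\<Sum>v\<in>V. if v = ys ! 0 then 1 / card V * ?S ys else 0)"
      by (intro sum.cong refl) (simp add: w_def)
    also have "\<dots> = 1 / card V * ?S ys" using V(1) mem by simp
    finally show "(\<Sum>v\<in>V. w v * of_bool ((is_match E (ys @ [v]) \<noteq> is_match E' (ys @ [v])) \<and> \<not> distinct (ys @ [v]))) \<le>
        1 / card V * ?S ys" .
  qed
  also have "\<dots> = 1 / card V * (\<Sum>z\<in>{..<5::nat} \<times> {..<5::nat}. mean V w 5 (?d (fst z) (snd z)))"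
    by (simp only: mean_cmult mean_sum)
  also have "\<dots> \<le> 1 / card V * (\<Sum>z\<in>{..<5::nat} \<times> {..<5::nat}. ?\<beta>)"
  proof (intro mult_left_mono sum_mono)
    fix z assume "z \<in> {..<5::nat} \<times> {..<5::nat}"
    then show "mean V w 5 (?d (fst z) (snd z)) \<le> ?\<beta>"
      using \<beta> mean_marginal[OF V(1) sum, of "fst z" 5 "snd z" "\<lambda>u v. of_bool (E u v \<noteq> E' u v)"]
        mean_const[OF V(1) sum, of 5 0]
      by (cases "fst z = snd z") auto
  qed simp
  also have "\<dots> = 25 / card V * ?\<beta>" by simp
  finally show ?thesis .
qed

section \<open>The inducibility and its maximiser\<close>

text \<open>The number of 6-tuples over that of ordered 6-subsets.\<close>

definition tuple_ratio :: "nat \<Rightarrow> real" where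
  "tuple_ratio n = real n ^ 6 / (720 * real (n choose 6))"

lemma tuple_ratio_tendsto: "tuple_ratio \<longlonglongrightarrow> 1"
proof -
  have "(\<lambda>n. 1 / (\<Prod>i<6::nat. 1 - real i / real n)) \<longlonglongrightarrow> 1 / (\<Prod>i<6::nat. 1 - 0)"
    by (intro tendsto_intros lim_const_over_n) simp
  then have lim: "(\<lambda>n. 1 / (\<Prod>i<6::nat. 1 - real i / real n)) \<longlonglongrightarrow> 1" by simp
  have eq: "1 / (\<Prod>i<6::nat. 1 - real i / real n) = tuple_ratio n" if "n > 0" for n
  proof -
    have "1 - real i / real n = (real n - real i) / real n" for i
      using that by (simp add: diff_divide_distrib)
    then have "(\<Prod>i<6::nat. 1 - real i / real n) = (\<Prod>i<6::nat. real n - real i) / real n ^ 6"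
      by (simp add: prod_dividef)
    also have "(\<Prod>i<6::nat. real n - real i) = 720 * real (n choose 6)"
      using gbinomial_prod_rev[of "real n" 6]
      by (simp add: binomial_gbinomial atLeast0LessThan fact_numeral)
    finally show ?thesis by (simp add: tuple_ratio_def)
  qed
  show ?thesis
    by (rule Lim_transform_eventually[OF lim]) (auto intro!: eventually_sequentiallyI[of 1] eq)
qed

lemma weighted_graph_uniform:
  assumes "simple_graph G" "verts G \<noteq> {}"
  shows "weighted_graph (verts G) (\<lambda>_. 1 / real (card (verts G))) (adj G)"
proof
  show "finite (verts G)" using assms(1) by (simp add: simple_graph_def)
  then show "(\<Sum>x\<in>verts G. 1 / real (card (verts G))) = 1" using assms(2) by simp
qed (use assms(1) simple_graph_irrefl in \<open>auto simp: adj_sym\<close>)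

lemma copies_eq_mean:
  assumes "simple_graph G"
  shows "2 * real (copies G) / real (card (verts G)) ^ 6 =
    mean (verts G) (\<lambda>_. 1 / real (card (verts G))) 6 (\<lambda>xs. of_bool (distinct xs \<and> is_match (adj G) xs))"
proof -
  have "finite (verts G)" using assms by (simp add: simple_graph_def)
  then show ?thesis
    using mean_uniform[of "verts G" "real (card (verts G))" 6 "\<lambda>xs. distinct xs \<and> is_match (adj G) xs"]
      card_distinct_matches[OF assms] by simp
qed

text \<open>Matches with a repeated vertex have probability at most \<open>1 / n\<close>.\<close>

lemma copies_bounds:
  fixes G :: graph
  defines "n \<equiv> real (card (verts G))"
  defines "M \<equiv> mean (verts G) (\<lambda>_. 1 / n) 6 (\<lambda>xs. of_bool (is_match (adj G) xs))"
  assumes G: "simple_graph G" and ne: "verts G \<noteq> {}"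
  shows "2 * real (copies G) / n ^ 6 \<le> M" "M - 1 / n \<le> 2 * real (copies G) / n ^ 6"
proof -
  let ?m = "\<lambda>P. mean (verts G) (\<lambda>_. 1 / n) 6 (\<lambda>xs. of_bool (P xs))"
  have fin: "finite (verts G)" using G by (simp add: simple_graph_def)
  have "M = mean (verts G) (\<lambda>_. 1 / n) 6
      (\<lambda>xs. of_bool (distinct xs \<and> is_match (adj G) xs) + of_bool (is_match (adj G) xs \<and> \<not> distinct xs))"
    unfolding M_def by (intro mean_cong) auto
  also have "\<dots> = ?m (\<lambda>xs. distinct xs \<and> is_match (adj G) xs) + ?m (\<lambda>xs. is_match (adj G) xs \<and> \<not> distinct xs)"
    by (rule mean_add)
  also have "?m (\<lambda>xs. distinct xs \<and> is_match (adj G) xs) = 2 * real (copies G) / n ^ 6"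
    unfolding n_def by (rule copies_eq_mean[OF G, symmetric])
  finally have M: "M = 2 * real (copies G) / n ^ 6 + ?m (\<lambda>xs. is_match (adj G) xs \<and> \<not> distinct xs)" .
  have "?m (\<lambda>xs. is_match (adj G) xs \<and> \<not> distinct xs) \<le> 1 / n"
    unfolding n_def
    by (rule mean_match_not_distinct_le[of "verts G" "adj G", OF fin ne adj_sym simple_graph_irrefl[OF G]])
  moreover have "0 \<le> ?m (\<lambda>xs. is_match (adj G) xs \<and> \<not> distinct xs)"
    by (intro mean_nonneg) (auto simp: n_def)
  ultimately show "2 * real (copies G) / n ^ 6 \<le> M" "M - 1 / n \<le> 2 * real (copies G) / n ^ 6"
    using M by linarith+
qed

lemma induced_density_eq_ratio:
  assumes "verts G \<noteq> {}" "finite (verts G)"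
  shows "induced_density F50 G =
    360 * tuple_ratio (card (verts G)) * (2 * real (copies G) / real (card (verts G)) ^ 6)"
  using assms by (simp add: induced_density_F50 tuple_ratio_def)

definition hexagon_density :: "(nat \<Rightarrow> real) \<Rightarrow> real" where
  "hexagon_density x = mean {..<6} x 6 (\<lambda>xs. of_bool (is_match hex xs))"

lemma mean_match_colouring:
  assumes "finite V" "\<And>y. y \<in> V \<Longrightarrow> c y < 6"
    and "\<And>x y. x \<in> V \<Longrightarrow> y \<in> V \<Longrightarrow> E x y = hex (c x) (c y)"
  shows "mean V w 6 (\<lambda>xs. of_bool (is_match E xs)) = hexagon_density (\<lambda>d. \<Sum>y\<in>{y \<in> V. c y = d}. w y)"
proof -
  have "mean V w 6 (\<lambda>xs. of_bool (is_match E xs)) = mean V w 6 (\<lambda>xs. of_bool (is_match hex (map c xs)))"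
  proof (rule mean_cong)
    fix xs assume xs: "xs \<in> tuples V 6"
    then obtain i j k l u v where "xs = [i, j, k, l, u, v]"
      by (auto simp: tuples_def numeral_eq_Suc length_Suc_conv)
    then show "of_bool (is_match E xs) = (of_bool (is_match hex (map c xs)) :: real)"
      using xs by (simp add: tuples_def is_match_def is_path_def class_of_def assms(3))
  qed
  also have "\<dots> = hexagon_density (\<lambda>d. \<Sum>y\<in>{y \<in> V. c y = d}. w y)"
    unfolding hexagon_density_def using assms(1,2) by (intro mean_push) auto
  finally show ?thesis .
qed

text \<open>The rotations and reflections of one match.\<close>

definition hexagon_matches :: "nat list list" where
  "hexagon_matches = map (\<lambda>r. map (\<lambda>a. (a + r) mod 6) [0, 1, 2, 3, 5, 0]) [0..<6] @
     map (\<lambda>r. map (\<lambda>a. (r + 6 - a) mod 6) [0, 1, 2, 3, 5, 0]) [0..<6]"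

lemma hexagon_density_uniform_ge: "1 / 3888 \<le> hexagon_density (\<lambda>_. 1 / 6)"
proof -
  let ?M = "{xs \<in> tuples {..<6} 6. is_match hex xs}"
  have "\<forall>xs\<in>set hexagon_matches. is_match hex xs \<and> length xs = 6 \<and> (\<forall>a\<in>set xs. a < 6)"
    by code_simp
  then have "set hexagon_matches \<subseteq> ?M" unfolding tuples_def lessThan_def by blast
  then have "card (set hexagon_matches) \<le> card ?M"
    by (intro card_mono) (simp add: finite_tuples)
  moreover have "distinct hexagon_matches" "length hexagon_matches = 12" by code_simp+
  ultimately have "12 \<le> real (card ?M)" using distinct_card[of hexagon_matches] by simp
  then show ?thesis
    using mean_uniform[of "{..<6::nat}" 6 6 "is_match hex"] by (simp add: hexagon_density_def)
qed

text \<open>The second inequality combines \<open>imbalance_le\<close> with \<open>2 * mean_defect \<le> 16 - 62208 * match_density\<close>.\<close>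

lemma hexagon_imbalance:
  assumes "weighted_hexagon x"
  shows "hexagon_density x \<le> 1 / 3888"
    and "hexagon_density x * weighted_hexagon.imbalance x \<le> 31104 * (1 / 3888 - hexagon_density x)"
proof -
  interpret weighted_hexagon x by fact
  have eq: "match_density = hexagon_density x" by (simp add: match_density_def hexagon_density_def)
  show "hexagon_density x \<le> 1 / 3888" using match_density_le eq by simp
  show "hexagon_density x * imbalance \<le> 31104 * (1 / 3888 - hexagon_density x)"
    using imbalance_le core_inequality eq by simp
qed

lemma weighted_hexagon_iff: "weighted_hexagon x \<longleftrightarrow> x \<in> prob_simplex {..<6}"
  by (auto simp: weighted_hexagon_def prob_simplex_def)

lemma weighted_hexagon_uniform: "weighted_hexagon (\<lambda>_. 1 / 6)"
  by unfold_locales simp_all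

lemma hexagon_density_uniform: "hexagon_density (\<lambda>_. 1 / 6) = 1 / 3888"
  using hexagon_density_uniform_ge hexagon_imbalance(1)[OF weighted_hexagon_uniform] by simp

text \<open>Walk around the hexagon from \<open>c\<close> to every other vertex, and use that the weights average to \<open>1 / 6\<close>.\<close>

lemma weight_diff_le:
  assumes "weighted_hexagon x" "c < 6" "weighted_hexagon.imbalance x \<le> s\<^sup>2" "0 \<le> s"
  shows "\<bar>x c - 1 / 6\<bar> \<le> 5 * s"
proof -
  interpret weighted_hexagon x by fact
  have step: "\<bar>x d - x (next_class d)\<bar> \<le> s" if "d < 6" for d
  proof -
    have "(x d - x (next_class d))\<^sup>2 \<le> imbalance"
      unfolding imbalance_def using that by (intro member_le_sum) auto
    then have "(x d - x (next_class d))\<^sup>2 \<le> s\<^sup>2" using assms(3) by simp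
    then show ?thesis using assms(4) by (metis abs_le_square_iff abs_of_nonneg)
  qed
  have s: "\<bar>x 0 - x 1\<bar> \<le> s" "\<bar>x 1 - x 2\<bar> \<le> s" "\<bar>x 2 - x 3\<bar> \<le> s" "\<bar>x 3 - x 4\<bar> \<le> s" "\<bar>x 4 - x 5\<bar> \<le> s"
    using step[of 0] step[of 1] step[of 2] step[of 3] step[of 4]
    by (simp_all add: next_class_def numeral_eq_Suc)
  have "x 0 + x 1 + x 2 + x 3 + x 4 + x 5 = 1"
    using x_sum by (simp add: lessThan_nat_numeral lessThan_Suc add_ac)
  then show ?thesis
    using s assms(4) less_6_cases[OF assms(2)] by (elim disjE) (simp_all add: abs_le_iff)
qed

lemma hexagon_density_uniqueness:
  assumes "weighted_hexagon x" "hexagon_density x = 1 / 3888" "c < 6"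
  shows "x c = 1 / 6"
  using weight_diff_le[OF assms(1,3), of 0] hexagon_imbalance(2)[OF assms(1)] assms(2) by simp

lemma tendsto_mean:
  assumes "finite V" "\<And>v. v \<in> V \<Longrightarrow> (\<lambda>n. w n v) \<longlonglongrightarrow> w' v"
  shows "(\<lambda>n. mean V (w n) k f) \<longlonglongrightarrow> mean V w' k f"
proof (induction k arbitrary: f)
  case (Suc k)
  show ?case unfolding mean_Suc[OF assms(1)] by (intro tendsto_intros assms(2) Suc)
qed simp

lemma finite_blowup: "blowup_parts C6_pattern U \<Longrightarrow> finite (verts (blowup C6_pattern U))"
  by (simp add: blowup_def blowup_parts_def)

lemma card_verts_blowup:
  assumes "blowup_parts C6_pattern U"
  shows "card (verts (blowup C6_pattern U)) = (\<Sum>i<6. card (U i))"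
  using assms unfolding blowup_def blowup_parts_def disjoint_family_on_def
  by (simp add: card_UN_disjoint)

lemma blowup_match_density:
  assumes "blowup_parts C6_pattern U"
  shows "simple_graph (blowup C6_pattern U)"
    and "mean (verts (blowup C6_pattern U)) (\<lambda>_. 1 / m) 6 (\<lambda>xs. of_bool (is_match (adj (blowup C6_pattern U)) xs)) =
      hexagon_density (\<lambda>d. real (card (U d)) / m)"
proof -
  obtain c where c: "\<And>x. c x < 6" "\<And>i x. i < 6 \<Longrightarrow> x \<in> U i \<Longrightarrow> c x = i"
    using blowup_colouring[OF assms] by blast
  let ?V = "\<Union>i<6. U i"
  have eq: "blowup C6_pattern U = colour_graph ?V c"
    by (rule blowup_eq_colour_graph[OF assms]) (rule c(2))
  have fin: "finite ?V" using assms by (auto simp: blowup_parts_def)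
  show "simple_graph (blowup C6_pattern U)"
    unfolding eq by (rule simple_graph_colour_graph[OF fin])
  have cls: "{y \<in> ?V. c y = d} = U d" if "d < 6" for d using c that by auto
  have "mean ?V (\<lambda>_. 1 / m) 6 (\<lambda>xs. of_bool (is_match (adj (colour_graph ?V c)) xs)) =
      hexagon_density (\<lambda>d. \<Sum>y\<in>{y \<in> ?V. c y = d}. 1 / m)"
    using c(1) by (intro mean_match_colouring[OF fin]) (simp_all add: adj_colour_graph)
  also have "\<dots> = hexagon_density (\<lambda>d. real (card (U d)) / m)"
    unfolding hexagon_density_def mean_def
  proof (intro sum.cong refl arg_cong2[of _ _ _ _ "(*)"] arg_cong[of _ _ prod_list] map_cong)
    fix xs d assume "xs \<in> tuples {..<6::nat} 6" "d \<in> set xs"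
    then have "d < 6" by (auto simp: tuples_def)
    then show "(\<Sum>y\<in>{y \<in> ?V. c y = d}. 1 / m) = real (card (U d)) / m"
      unfolding cls[OF \<open>d < 6\<close>] by simp
  qed
  finally show "mean (verts (blowup C6_pattern U)) (\<lambda>_. 1 / m) 6 (\<lambda>xs. of_bool (is_match (adj (blowup C6_pattern U)) xs)) =
      hexagon_density (\<lambda>d. real (card (U d)) / m)"
    unfolding eq by simp
qed

text \<open>Matches in a blowup are counted by colours, so their probability depends only on the proportions of
  the parts, and continuously so. The order of the blowup differs from \<open>n\<close> by a factor tending to 1.\<close>

lemma induced_density_blowup_tendsto:
  assumes x: "x \<in> prob_simplex {..<6}" and parts: "\<And>n. blowup_parts C6_pattern (U n)"
    and lim: "\<And>i. i < 6 \<Longrightarrow> (\<lambda>n. real (card (U n i)) / real n) \<longlonglongrightarrow> x i"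
  shows "(\<lambda>n. induced_density F50 (blowup C6_pattern (U n))) \<longlonglongrightarrow> 360 * hexagon_density x"
proof -
  let ?G = "\<lambda>n. blowup C6_pattern (U n)"
  define N where "N n = card (verts (?G n))" for n
  let ?h = "\<lambda>n. hexagon_density (\<lambda>d. real (card (U n d)) / real (N n))"
  let ?c = "\<lambda>n. 2 * real (copies (?G n)) / real (N n) ^ 6"
  have "(\<lambda>n. \<Sum>i<6. real (card (U n i)) / real n) \<longlonglongrightarrow> (\<Sum>i<6. x i)"
    using lim by (intro tendsto_sum) simp
  also have "(\<Sum>i<6. x i) = 1" using x by (simp add: prob_simplex_def)
  finally have N1: "(\<lambda>n. real (N n) / real n) \<longlonglongrightarrow> 1"
    using card_verts_blowup[OF parts] by (simp add: N_def sum_divide_distrib)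
  have Nreal: "filterlim (\<lambda>n. real (N n)) at_top sequentially"
  proof -
    have "filterlim (\<lambda>n. real (N n) / real n * real n) at_top sequentially"
      by (rule filterlim_tendsto_pos_mult_at_top[OF N1 _ filterlim_real_sequentially]) simp
    moreover have "eventually (\<lambda>n. real (N n) / real n * real n = real (N n)) sequentially"
      by (intro eventually_sequentiallyI[of 1]) simp
    ultimately show ?thesis by (simp add: filterlim_cong)
  qed
  then have N: "filterlim N at_top sequentially"
    using filterlim_sequentially_iff_filterlim_real by blast
  have pos: "eventually (\<lambda>n. verts (?G n) \<noteq> {}) sequentially"
  proof -
    have "eventually (\<lambda>n. N n \<ge> 1) sequentially" using N by (auto simp: filterlim_at_top)
    then show ?thesis by eventually_elim (auto simp: N_def)
  qed
  have frac: "(\<lambda>n. real (card (U n d)) / real (N n)) \<longlonglongrightarrow> x d" if "d < 6" for d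
  proof -
    have "(\<lambda>n. (real (card (U n d)) / real n) / (real (N n) / real n)) \<longlonglongrightarrow> x d / 1"
      by (intro tendsto_divide lim that N1) simp
    moreover have "eventually (\<lambda>n. (real (card (U n d)) / real n) / (real (N n) / real n) =
        real (card (U n d)) / real (N n)) sequentially"
      by (intro eventually_sequentiallyI[of 1]) simp
    ultimately have "(\<lambda>n. real (card (U n d)) / real (N n)) \<longlonglongrightarrow> x d / 1"
      by (rule Lim_transform_eventually)
    then show ?thesis by simp
  qed
  have h: "?h \<longlonglongrightarrow> hexagon_density x"
    unfolding hexagon_density_def using frac by (intro tendsto_mean) auto
  have "(\<lambda>n. 1 / real (N n)) \<longlonglongrightarrow> 0"
    by (rule filterlim_compose[OF lim_1_over_n N])
  then have lower: "(\<lambda>n. ?h n - 1 / real (N n)) \<longlonglongrightarrow> hexagon_density x"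
    using tendsto_diff[OF h] by fastforce
  have bounds: "?c n \<le> ?h n \<and> ?h n - 1 / real (N n) \<le> ?c n" if "verts (?G n) \<noteq> {}" for n
    using copies_bounds[OF blowup_match_density(1)[OF parts] that]
    unfolding blowup_match_density(2)[OF parts] N_def by blast
  have c: "?c \<longlonglongrightarrow> hexagon_density x"
    using pos by (intro tendsto_sandwich[OF _ _ lower h]) (auto elim!: eventually_mono dest!: bounds)
  have "(\<lambda>n. 360 * tuple_ratio (N n) * ?c n) \<longlonglongrightarrow> 360 * 1 * hexagon_density x"
    by (intro tendsto_intros c filterlim_compose[OF tuple_ratio_tendsto N])
  moreover have "eventually (\<lambda>n. 360 * tuple_ratio (N n) * ?c n = induced_density F50 (?G n)) sequentially"
    using pos by eventually_elim (simp add: N_def induced_density_eq_ratio[OF _ finite_blowup[OF parts]])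
  ultimately have "(\<lambda>n. induced_density F50 (?G n)) \<longlonglongrightarrow> 360 * 1 * hexagon_density x"
    by (rule Lim_transform_eventually)
  then show ?thesis by simp
qed

text \<open>Needed for the uniqueness of the limit in the definition of \<open>blowup_density\<close>.\<close>

lemma ex_blowup_sequence:
  assumes "\<And>i. i < 6 \<Longrightarrow> 0 \<le> x i"
  obtains U where "\<And>n. blowup_parts C6_pattern (U n)"
    "\<And>i. i < 6 \<Longrightarrow> (\<lambda>n. real (card (U n i)) / real n) \<longlonglongrightarrow> x i"
proof
  define U where "U n i = (\<lambda>k. 6 * k + i) ` {..<nat \<lfloor>x i * real n\<rfloor>}" for n i :: nat
  have "U n i \<inter> U n j = {}" if "i < 6" "j < 6" "i \<noteq> j" for n i j
  proof -
    have "k mod 6 = i" if "k \<in> U n i" "i < 6" for k i using that by (auto simp: U_def)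
    then show ?thesis using that by blast
  qed
  then show "blowup_parts C6_pattern (U n)" for n
    by (auto simp: blowup_parts_def disjoint_family_on_def U_def)
  show "(\<lambda>n. real (card (U n i)) / real n) \<longlonglongrightarrow> x i" if "i < 6" for i
  proof (rule tendsto_sandwich)
    have card: "real (card (U n i)) = of_int \<lfloor>x i * real n\<rfloor>" for n
      using assms[OF that] by (simp add: U_def card_image inj_on_def)
    show "eventually (\<lambda>n. real (card (U n i)) / real n \<le> x i) sequentially"
      unfolding card by (intro eventually_sequentiallyI[of 1]) (simp add: field_simps)
    show "eventually (\<lambda>n. x i - 1 / real n \<le> real (card (U n i)) / real n) sequentially"
    proof (intro eventually_sequentiallyI[of 1])
      fix n :: nat assume "1 \<le> n"
      then have "x i - 1 / real n = (x i * real n - 1) / real n" by (simp add: field_simps)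
      also have "\<dots> \<le> of_int \<lfloor>x i * real n\<rfloor> / real n" by (intro divide_right_mono) linarith+
      finally show "x i - 1 / real n \<le> real (card (U n i)) / real n" unfolding card .
    qed
    show "(\<lambda>n. x i - 1 / real n) \<longlonglongrightarrow> x i"
      using tendsto_diff[OF tendsto_const lim_1_over_n, of "x i"] by simp
  qed simp
qed

lemma blowup_density_C6:
  assumes x: "x \<in> prob_simplex {..<6}"
  shows "blowup_density F50 C6_pattern x = 360 * hexagon_density x"
  unfolding blowup_density_def verts_C6_pattern
proof (rule the_equality)
  show "\<forall>V. (\<forall>n. blowup_parts C6_pattern (V n)) \<and>
      (\<forall>i\<in>{..<6}. (\<lambda>n. real (card (V n i)) / real n) \<longlonglongrightarrow> x i) \<longrightarrow>
      (\<lambda>n. induced_density F50 (blowup C6_pattern (V n))) \<longlonglongrightarrow> 360 * hexagon_density x"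
    using induced_density_blowup_tendsto[OF x] by blast
  fix l
  assume l: "\<forall>V. (\<forall>n. blowup_parts C6_pattern (V n)) \<and>
      (\<forall>i\<in>{..<6}. (\<lambda>n. real (card (V n i)) / real n) \<longlonglongrightarrow> x i) \<longrightarrow>
      (\<lambda>n. induced_density F50 (blowup C6_pattern (V n))) \<longlonglongrightarrow> l"
  obtain U where U: "\<And>n. blowup_parts C6_pattern (U n)"
    "\<And>i. i < 6 \<Longrightarrow> (\<lambda>n. real (card (U n i)) / real n) \<longlonglongrightarrow> x i"
    using ex_blowup_sequence[of x] x by (auto simp: prob_simplex_def)
  have "(\<lambda>n. induced_density F50 (blowup C6_pattern (U n))) \<longlonglongrightarrow> l" using l U by auto
  then show "l = 360 * hexagon_density x"
    using induced_density_blowup_tendsto[OF x U] LIMSEQ_unique by blast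
qed

theorem unique_maximiser: "unique_maximiser_up_to_aut F50 C6_pattern (\<lambda>i. 1 / 6)"
proof -
  have unif: "(\<lambda>_. 1 / 6) \<in> prob_simplex {..<6}"
    using weighted_hexagon_uniform weighted_hexagon_iff by blast
  have "maximiser F50 C6_pattern (\<lambda>_. 1 / 6)"
    using unif hexagon_imbalance(1)[unfolded weighted_hexagon_iff]
    by (simp add: maximiser_def blowup_density_C6 hexagon_density_uniform mult.commute)
  moreover have "y i = 1 / 6" if "maximiser F50 C6_pattern y" "i < 6" for y i
  proof -
    have y: "y \<in> prob_simplex {..<6}"
      and "hexagon_density (\<lambda>_. 1 / 6) \<le> hexagon_density y"
      using that(1) unif by (auto simp: maximiser_def blowup_density_C6)
    then have "hexagon_density y = 1 / 3888"
      using hexagon_imbalance(1)[of y] weighted_hexagon_iff hexagon_density_uniform by force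
    then show ?thesis using y weighted_hexagon_iff hexagon_density_uniqueness that(2) by blast
  qed
  moreover have "automorphism C6_pattern id" by (simp add: automorphism_def graph_iso_def)
  ultimately show ?thesis unfolding unique_maximiser_up_to_aut_def by auto
qed

lemma copies_le: "finite (verts G) \<Longrightarrow> copies G \<le> card (verts G) choose 6"
  unfolding copies_def by (subst n_subsets[symmetric]) (auto intro!: card_mono)

text \<open>Only finitely many values occur, so the maximum defining \<open>max_density\<close> is attained.\<close>

lemma max_density_attained:
  shows "\<exists>G. simple_graph G \<and> card (verts G) = n \<and> max_density F50 n = induced_density F50 G"
    and "\<And>G. simple_graph G \<Longrightarrow> card (verts G) = n \<Longrightarrow> induced_density F50 G \<le> max_density F50 n"
proof -
  let ?S = "{induced_density F50 G | G. simple_graph G \<and> card (verts G) = n}"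
  have "?S \<subseteq> (\<lambda>k. real k / real (n choose 6)) ` {..n choose 6}"
    using copies_le by (force simp: induced_density_F50 simple_graph_def)
  then have fin: "finite ?S" by (rule finite_subset) simp
  have "simple_graph ({..<n}, {})" by (simp add: simple_graph_def)
  then have ne: "?S \<noteq> {}" by fastforce
  show "\<exists>G. simple_graph G \<and> card (verts G) = n \<and> max_density F50 n = induced_density F50 G"
    using Max_in[OF fin ne] unfolding max_density_def by blast
  show "induced_density F50 G \<le> max_density F50 n" if "simple_graph G" "card (verts G) = n" for G
    unfolding max_density_def using that by (intro Max_ge[OF fin]) blast
qed

lemma match_density_uniform_le:
  assumes "simple_graph G" "verts G \<noteq> {}"
  shows "mean (verts G) (\<lambda>_. 1 / real (card (verts G))) 6 (\<lambda>xs. of_bool (is_match (adj G) xs)) \<le> 1 / 3888"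
proof -
  interpret weighted_graph "verts G" "\<lambda>_. 1 / real (card (verts G))" "adj G"
    by (rule weighted_graph_uniform[OF assms])
  show ?thesis using match_density_le by (simp only: match_density_def)
qed

lemma max_density_le:
  assumes "n > 0"
  shows "max_density F50 n \<le> 5 / 54 * tuple_ratio n"
proof -
  obtain G where G: "simple_graph G" "card (verts G) = n" "max_density F50 n = induced_density F50 G"
    using max_density_attained(1) by blast
  have ne: "verts G \<noteq> {}" "finite (verts G)" using G assms by (auto simp: simple_graph_def)
  have "2 * real (copies G) / real n ^ 6 \<le> 1 / 3888"
    using copies_bounds(1)[OF G(1) ne(1)] match_density_uniform_le[OF G(1) ne(1)] G(2) by simp
  then have "360 * tuple_ratio n * (2 * real (copies G) / real n ^ 6) \<le> 360 * tuple_ratio n * (1 / 3888)"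
    by (intro mult_left_mono) (simp_all add: tuple_ratio_def)
  then show ?thesis unfolding G(3) induced_density_eq_ratio[OF ne] G(2) by simp
qed

text \<open>The lower bound comes from the blowups on \<open>n\<close> vertices with parts of almost equal size.\<close>

theorem max_density_tendsto: "max_density F50 \<longlonglongrightarrow> 5 / 54"
proof -
  define U where "U n i = (\<lambda>k. 6 * k + i) ` {..<(n + 5 - i) div 6}" for n i :: nat
  have card: "card (U n i) = (n + 5 - i) div 6" for n i
    by (simp add: U_def card_image inj_on_def)
  have "U n i \<inter> U n j = {}" if "i < 6" "j < 6" "i \<noteq> j" for n i j
  proof -
    have "k mod 6 = i" if "k \<in> U n i" "i < 6" for k i using that by (auto simp: U_def)
    then show ?thesis using that by blast
  qed
  then have parts: "blowup_parts C6_pattern (U n)" for n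
    by (auto simp: blowup_parts_def disjoint_family_on_def U_def)
  have lim: "(\<lambda>n. real (card (U n i)) / real n) \<longlonglongrightarrow> 1 / 6" if "i < 6" for i
  proof (rule tendsto_sandwich)
    have *: "real n \<le> 6 * real (card (U n i)) + 5" "6 * real (card (U n i)) \<le> real n + 5" for n
    proof -
      have "n \<le> 6 * card (U n i) + 5" "6 * card (U n i) \<le> n + 5" unfolding card using that by linarith+
      then show "real n \<le> 6 * real (card (U n i)) + 5" "6 * real (card (U n i)) \<le> real n + 5" by linarith+
    qed
    show "eventually (\<lambda>n. 1 / 6 - (5 / 6) / real n \<le> real (card (U n i)) / real n) sequentially"
    proof (intro eventually_sequentiallyI[of 1])
      fix n :: nat assume "1 \<le> n"
      then have "1 / 6 - (5 / 6) / real n = (real n - 5) / 6 / real n" by (simp add: field_simps)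
      also have "\<dots> \<le> real (card (U n i)) / real n" using *(1)[of n] by (intro divide_right_mono) auto
      finally show "1 / 6 - (5 / 6) / real n \<le> real (card (U n i)) / real n" .
    qed
    show "eventually (\<lambda>n. real (card (U n i)) / real n \<le> 1 / 6 + (5 / 6) / real n) sequentially"
    proof (intro eventually_sequentiallyI[of 1])
      fix n :: nat assume n: "1 \<le> n"
      have "real (card (U n i)) / real n \<le> (real n + 5) / 6 / real n"
        using *(2)[of n] by (intro divide_right_mono) auto
      also have "\<dots> = 1 / 6 + (5 / 6) / real n" using n by (simp add: field_simps)
      finally show "real (card (U n i)) / real n \<le> 1 / 6 + (5 / 6) / real n" .
    qed
    show "(\<lambda>n. 1 / 6 - (5 / 6) / real n) \<longlonglongrightarrow> 1 / 6"
      using tendsto_diff[OF tendsto_const lim_const_over_n, of "1 / 6" "5 / 6"] by simp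
    show "(\<lambda>n. 1 / 6 + (5 / 6) / real n) \<longlonglongrightarrow> 1 / 6"
      using tendsto_add[OF tendsto_const lim_const_over_n, of "1 / 6" "5 / 6"] by simp
  qed
  have "(\<lambda>n. induced_density F50 (blowup C6_pattern (U n))) \<longlonglongrightarrow> 360 * hexagon_density (\<lambda>_. 1 / 6)"
    using weighted_hexagon_uniform weighted_hexagon_iff
    by (intro induced_density_blowup_tendsto parts lim) auto
  then have lower: "(\<lambda>n. induced_density F50 (blowup C6_pattern (U n))) \<longlonglongrightarrow> 5 / 54"
    by (simp add: hexagon_density_uniform)
  have upper: "(\<lambda>n. 5 / 54 * tuple_ratio n) \<longlonglongrightarrow> 5 / 54"
    using tendsto_mult[OF tendsto_const tuple_ratio_tendsto, of "5 / 54"] by simp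
  show ?thesis
  proof (rule tendsto_sandwich[OF _ _ lower upper])
    have "card (verts (blowup C6_pattern (U n))) = n" for n
    proof -
      have n: "n = 6 * (n div 6) + n mod 6" "n mod 6 < 6" by simp_all
      have "(\<Sum>i<6. (6 * q + r + 5 - i) div 6) = 6 * q + r" if "r < 6" for q r :: nat
      proof -
        have "Suc (6 * q) div 6 = q" "Suc (Suc (6 * q)) div 6 = q" by presburger+
        then show ?thesis
          using less_6_cases[OF that] by (elim disjE) (simp_all add: lessThan_nat_numeral lessThan_Suc)
      qed
      from this[OF n(2), of "n div 6"] show ?thesis
        unfolding card_verts_blowup[OF parts] card n(1)[symmetric] .
    qed
    then show "eventually (\<lambda>n. induced_density F50 (blowup C6_pattern (U n)) \<le> max_density F50 n) sequentially"
      using max_density_attained(2) blowup_match_density(1)[OF parts] by simp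
    show "eventually (\<lambda>n. max_density F50 n \<le> 5 / 54 * tuple_ratio n) sequentially"
      using max_density_le by (intro eventually_sequentiallyI[of 1]) simp
  qed
qed

section \<open>Perfect stability\<close>

lemma weighted_graph_uniform_colour_error:
  assumes G: "simple_graph G" "verts G \<noteq> {}"
  shows "weighted_graph.colour_error (verts G) (\<lambda>_. 1 / real (card (verts G))) (adj G) c =
    real (card (wrong_pairs G c)) / (real (card (verts G)))\<^sup>2"
proof -
  interpret weighted_graph "verts G" "\<lambda>_. 1 / real (card (verts G))" "adj G"
    by (rule weighted_graph_uniform[OF G])
  have "card (wrong_pairs G c) = card (SIGMA u:verts G. {v \<in> verts G. adj G u v \<noteq> hex (c u) (c v)})"
    by (rule arg_cong[of _ _ card]) (auto simp: wrong_pairs_def)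
  also have "\<dots> = (\<Sum>u\<in>verts G. card {v \<in> verts G. adj G u v \<noteq> hex (c u) (c v)})"
    using finite_V by (intro card_SigmaI) auto
  finally show ?thesis
    using finite_V
    by (simp add: colour_error_def sum_divide_distrib sum_distrib_left[symmetric] power2_eq_square Int_def
        flip: sum_divide_distrib)
qed

lemma core_inequality_colouring:
  assumes "weighted_graph V w E"
  obtains c where "\<And>u. c u < (6::nat)"
    "mean V w 6 (\<lambda>xs. of_bool (is_match E xs)) * weighted_graph.colour_error V w E c \<le>
     31104 * (1 / 3888 - mean V w 6 (\<lambda>xs. of_bool (is_match E xs)))"
proof -
  interpret weighted_graph V w E by fact
  obtain c where c: "\<And>u. c u < (6::nat)" "match_density * colour_error c \<le> mean_defect"
    using ex_colouring by blast
  moreover have "mean_defect \<le> 31104 * (1 / 3888 - match_density)" using core_inequality by simp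
  ultimately show ?thesis using that[of c] by (auto simp: match_density_def)
qed

lemma colour_error_mono:
  assumes w: "weighted_graph V w E" and w': "weighted_graph V w' E"
    and le: "\<And>y. y \<in> V \<Longrightarrow> w y \<le> k * w' y" and k: "0 \<le> k"
  shows "weighted_graph.colour_error V w E c \<le> k\<^sup>2 * weighted_graph.colour_error V w' E c"
proof -
  have nonneg: "0 \<le> w y" "0 \<le> w' y" if "y \<in> V" for y
    using that weighted_graph.w_nonneg[OF w] weighted_graph.w_nonneg[OF w'] by auto
  have "weighted_graph.colour_error V w E c \<le>
      (\<Sum>u\<in>V. \<Sum>v\<in>V. (k * w' u) * (k * w' v) * of_bool (E u v \<noteq> hex (c u) (c v)))"
    unfolding weighted_graph.colour_error_def[OF w]
    using le nonneg k by (intro sum_mono mult_right_mono mult_mono) auto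
  also have "\<dots> = k\<^sup>2 * weighted_graph.colour_error V w' E c"
    unfolding weighted_graph.colour_error_def[OF w'] by (simp add: sum_distrib_left power2_eq_square mult_ac)
  finally show ?thesis .
qed



text \<open>The weights that make all six colour classes have total weight \<open>1 / 6\<close>.\<close>

definition balancing_weight :: "'a set \<Rightarrow> ('a \<Rightarrow> nat) \<Rightarrow> 'a \<Rightarrow> real" where
  "balancing_weight V c y = 1 / (6 * real (card {z \<in> V. c z = c y}))"

lemma sum_balancing_weight:
  assumes "finite V" "{y \<in> V. c y = d} \<noteq> {}"
  shows "(\<Sum>y\<in>{y \<in> V. c y = d}. balancing_weight V c y) = 1 / 6"
proof -
  have "(\<Sum>y\<in>{y \<in> V. c y = d}. balancing_weight V c y) =
      (\<Sum>y\<in>{y \<in> V. c y = d}. 1 / (6 * real (card {y \<in> V. c y = d})))"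
    by (intro sum.cong refl) (simp add: balancing_weight_def)
  then show ?thesis using assms by simp
qed

lemma weighted_graph_balancing:
  assumes V: "finite V" "\<And>y. y \<in> V \<Longrightarrow> c y < 6" "\<And>d. d < 6 \<Longrightarrow> {y \<in> V. c y = d} \<noteq> {}"
    and E: "\<And>x y. E x y = E y x" "\<And>x. \<not> E x x"
  shows "weighted_graph V (balancing_weight V c) E"
proof
  have "(\<Sum>y\<in>V. balancing_weight V c y) = (\<Sum>d<6. \<Sum>y\<in>{y \<in> V. c y = d}. balancing_weight V c y)"
    using V by (intro sum.group[symmetric]) auto
  also have "\<dots> = (\<Sum>d<6::nat. 1 / 6)"
    using V(3) by (intro sum.cong refl sum_balancing_weight[OF V(1)]) simp
  also have "\<dots> = 1" by simp
  finally show "(\<Sum>y\<in>V. balancing_weight V c y) = 1" .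
qed (use V(1) E in \<open>auto simp: balancing_weight_def\<close>)

text \<open>Under the balancing weights a blowup is exactly extremal, without error term.\<close>

lemma match_density_balancing:
  assumes V: "finite V" "\<And>y. y \<in> V \<Longrightarrow> c y < 6" "\<And>d. d < 6 \<Longrightarrow> {y \<in> V. c y = d} \<noteq> {}"
    and E: "\<And>x y. x \<in> V \<Longrightarrow> y \<in> V \<Longrightarrow> E x y = hex (c x) (c y)"
  shows "mean V (balancing_weight V c) 6 (\<lambda>xs. of_bool (is_match E xs)) = 1 / 3888"
proof -
  have "mean V (balancing_weight V c) 6 (\<lambda>xs. of_bool (is_match E xs)) =
      hexagon_density (\<lambda>d. \<Sum>y\<in>{y \<in> V. c y = d}. balancing_weight V c y)"
    by (rule mean_match_colouring[OF V(1,2) E])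
  also have "\<dots> = hexagon_density (\<lambda>_. 1 / 6)"
    unfolding hexagon_density_def mean_def
  proof (intro sum.cong refl arg_cong2[of _ _ _ _ "(*)"] arg_cong[of _ _ prod_list] map_cong)
    fix xs d assume "xs \<in> tuples {..<6::nat} 6" "d \<in> set xs"
    then have "d < 6" by (auto simp: tuples_def)
    then show "(\<Sum>y\<in>{y \<in> V. c y = d}. balancing_weight V c y) = 1 / 6"
      by (intro sum_balancing_weight V)
  qed
  finally show ?thesis by (simp add: hexagon_density_uniform)
qed

lemma nearly_balanced_weight:
  fixes c :: "'a \<Rightarrow> nat"
  assumes V: "finite V" "V \<noteq> {}"
    and x: "\<bar>real (card {z \<in> V. c z = c y}) / real (card V) - 1 / 6\<bar> \<le> \<rho> / 12" and \<rho>: "0 \<le> \<rho>" "\<rho> \<le> 1 / 2"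
  shows "\<bar>balancing_weight V c y - 1 / real (card V)\<bar> \<le> \<rho> * (1 / real (card V))"
proof -
  define x where "x = 6 * (real (card {z \<in> V. c z = c y}) / real (card V))"
  have "\<bar>x - 1\<bar> \<le> \<rho> / 2" using assms(3) unfolding x_def by linarith
  then have half: "1 / 2 \<le> x" using \<rho> by linarith
  then have "\<rho> * (1 / 2) \<le> \<rho> * x" using \<rho>(1) by (rule mult_left_mono)
  then have "\<bar>1 - x\<bar> \<le> \<rho> * x" using \<open>\<bar>x - 1\<bar> \<le> \<rho> / 2\<close> by linarith
  moreover have "1 / x - 1 = (1 - x) / x" using half by (simp add: field_simps)
  ultimately have "\<bar>1 / x - 1\<bar> \<le> \<rho>" using half by (simp add: abs_divide pos_divide_le_eq)
  moreover have n: "0 < real (card V)" using V by (simp add: card_gt_0_iff)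
  then have "balancing_weight V c y = 1 / x * (1 / real (card V))"
    by (simp add: balancing_weight_def x_def)
  then have "balancing_weight V c y - 1 / real (card V) = (1 / x - 1) * (1 / real (card V))"
    by (simp only: left_diff_distrib mult_1)
  ultimately show ?thesis using n by (simp add: abs_mult divide_simps)
qed

lemma power_6_le: "(1 + \<rho>) ^ 6 - 1 \<le> 63 * \<rho>" if "0 \<le> \<rho>" "\<rho> \<le> (1 :: real)"
proof -
  have p: "\<rho> ^ k \<le> \<rho>" if "k > 0" for k
    using power_decreasing[of 1 k \<rho>] that \<open>0 \<le> \<rho>\<close> \<open>\<rho> \<le> 1\<close> by simp
  have "(1 + \<rho>) ^ 6 - 1 = 6 * \<rho> + 15 * \<rho> ^ 2 + 20 * \<rho> ^ 3 + 15 * \<rho> ^ 4 + 6 * \<rho> ^ 5 + \<rho> ^ 6"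
    by (simp add: power_numeral_even power_numeral_odd algebra_simps)
  then show ?thesis using p[of 2] p[of 3] p[of 4] p[of 5] p[of 6] by simp
qed

text \<open>The key step for perfect stability: if the blowup closest to \<open>G\<close> is nearly balanced, then it has
  more copies than \<open>G\<close>, by an amount proportional to the proportion \<open>\<beta>\<close> of wrong pairs.\<close>

lemma copies_gain:
  fixes G :: graph and c :: "nat \<Rightarrow> nat"
  defines "V \<equiv> verts G" and "n \<equiv> real (card (verts G))"
  defines "\<beta> \<equiv> real (card (wrong_pairs G c)) / n\<^sup>2"
  assumes G: "simple_graph G" and ne: "verts G \<noteq> {}"
    and c: "\<And>x. c x < 6"
    and opt: "\<And>c'. (\<And>x. c' x < (6 :: nat)) \<Longrightarrow> card (wrong_pairs G c) \<le> card (wrong_pairs G c')"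
    and \<rho>: "0 \<le> \<rho>" "\<rho> \<le> 1 / 2"
    and x: "\<And>d. d < 6 \<Longrightarrow> \<bar>real (card {z \<in> V. c z = d}) / n - 1 / 6\<bar> \<le> \<rho> / 12"
  shows "(1 / (8 * 3888 * 31104) - 2268 * \<rho> - 25 / n) * \<beta> \<le>
    2 * (real (copies (colour_graph V c)) - real (copies G)) / n ^ 6"
proof -
  let ?E = "adj G"
  let ?E' = "adj (colour_graph V c)"
  let ?u = "\<lambda>_ :: nat. 1 / n"
  let ?w = "balancing_weight V c"
  let ?f = "\<lambda>xs. of_bool (is_match ?E' xs) - of_bool (is_match ?E xs) :: real"
  have fin: "finite V" using G by (simp add: simple_graph_def V_def)
  have n: "0 < n" using ne fin by (simp add: n_def V_def card_gt_0_iff)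
  have cV: "V \<noteq> {}" "n = real (card V)" using ne by (simp_all add: V_def n_def)
  have G': "simple_graph (colour_graph V c)" by (rule simple_graph_colour_graph[OF fin])
  have E': "?E' u v = hex (c u) (c v)" if "u \<in> V" "v \<in> V" for u v
    using that by (simp add: adj_colour_graph)
  have sym: "?E u v = ?E v u" "\<not> ?E u u" "?E' u v = ?E' v u" "\<not> ?E' u u" for u v
    using simple_graph_irrefl[OF G] simple_graph_irrefl[OF G'] adj_sym by blast+
  have parts: "{y \<in> V. c y = d} \<noteq> {}" if "d < 6" for d
  proof
    assume "{y \<in> V. c y = d} = {}"
    then have "\<bar>real (card {z \<in> V. c z = d}) / n - 1 / 6\<bar> = 1 / 6" by (simp only:) simp
    then show False using x[OF that] \<rho> by linarith
  qed
  interpret u: weighted_graph V ?u ?E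
    unfolding V_def n_def by (rule weighted_graph_uniform[OF G ne])
  interpret w: weighted_graph V ?w ?E
    using sym(1,2) by (intro weighted_graph_balancing[OF fin c parts])
  have err: "u.colour_error c' = real (card (wrong_pairs G c')) / n\<^sup>2" for c'
    using weighted_graph_uniform_colour_error[OF G ne] by (simp add: V_def n_def)
  have \<beta>_eq: "(\<Sum>u\<in>V. \<Sum>v\<in>V. 1 / n * (1 / n) * of_bool (?E u v \<noteq> ?E' u v)) = \<beta>"
    using err[of c] E' by (simp add: u.colour_error_def \<beta>_def cong: sum.cong)
  have "wrong_pairs G c \<subseteq> V \<times> V" by (auto simp: wrong_pairs_def V_def)
  then have "card (wrong_pairs G c) \<le> card V * card V"
    using fin card_mono[of "V \<times> V"] by (simp add: card_cartesian_product)
  then have "real (card (wrong_pairs G c)) \<le> n\<^sup>2"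
    unfolding cV(2) power2_eq_square of_nat_mult[symmetric] of_nat_le_iff .
  then have \<beta>: "0 \<le> \<beta>" "\<beta> \<le> 1" using n by (auto simp: \<beta>_def)
  have near: "\<bar>?w y - 1 / n\<bar> \<le> \<rho> * (1 / n)" for y
    using nearly_balanced_weight[OF fin cV(1) _ \<rho>, of c y] x[OF c, of y] cV(2) by simp
  have half: "1 / n \<le> 2 * ?w y" for y
    using near[of y] \<rho> n mult_right_mono[of \<rho> "1 / 2" "1 / n"] by (simp add: abs_le_iff)
  \<comment> \<open>With balancing weights the blowup is exactly extremal. By contrast, \<open>G\<close> falls short of the maximum
      in proportion to \<open>\<beta>\<close>: as \<open>c\<close> is optimal, no colouring of \<open>G\<close> has fewer wrong pairs, and the
      balancing weights are at least half of the equal ones.\<close>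
  define a where "a = mean V ?w 6 (\<lambda>xs. of_bool (is_match ?E xs))"
  have a: "0 \<le> a" "a \<le> 1 / 3888"
    using w.match_density_nonneg w.match_density_le by (simp_all add: a_def w.match_density_def)
  obtain c' where c': "\<And>y. c' y < 6" "a * w.colour_error c' \<le> 31104 * (1 / 3888 - a)"
    using core_inequality_colouring[OF w.weighted_graph_axioms] unfolding a_def by blast
  have "\<beta> \<le> u.colour_error c'"
    using opt[OF c'(1)] n unfolding err \<beta>_def by (intro divide_right_mono) auto
  also have "\<dots> \<le> 2\<^sup>2 * w.colour_error c'"
    using half by (intro colour_error_mono u.weighted_graph_axioms w.weighted_graph_axioms) auto
  finally have \<beta>w: "\<beta> / 4 \<le> w.colour_error c'" by simp
  have loss: "1 / (8 * 3888 * 31104) * \<beta> \<le> 1 / 3888 - a"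
  proof (cases "1 / 7776 \<le> a")
    case True
    then have "1 / 7776 * (\<beta> / 4) \<le> a * w.colour_error c'"
      using \<beta>w \<beta> a by (intro mult_mono) auto
    then show ?thesis using c'(2) by simp
  next
    case False
    then show ?thesis using \<beta> by simp
  qed
  have gain: "mean V ?w 6 ?f = 1 / 3888 - a"
    using match_density_balancing[OF fin c parts E'] by (simp add: mean_diff a_def)
  \<comment> \<open>Back to equal weights; only tuples on which the two graphs disagree contribute.\<close>
  have absf: "\<bar>?f xs\<bar> = of_bool (is_match ?E xs \<noteq> is_match ?E' xs)" for xs by auto
  have "\<bar>mean V ?w 6 ?f - mean V ?u 6 ?f\<bar> \<le> ((1 + \<rho>) ^ 6 - 1) * mean V ?u 6 (\<lambda>xs. \<bar>?f xs\<bar>)"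
    using near n by (intro abs_mean_diff_le \<rho>) auto
  also have "\<dots> \<le> 63 * \<rho> * (36 * \<beta>)"
    unfolding absf
  proof (rule mult_mono)
    show "(1 + \<rho>) ^ 6 - 1 \<le> 63 * \<rho>" using \<rho> by (intro power_6_le) auto
    show "mean V ?u 6 (\<lambda>xs. of_bool (is_match ?E xs \<noteq> is_match ?E' xs)) \<le> 36 * \<beta>"
      using n mean_match_diff_le[of V ?u ?E ?E', OF fin _ u.w_sum sym(1,2,3,4)] unfolding \<beta>_eq by simp
    show "0 \<le> mean V ?u 6 (\<lambda>xs. of_bool (is_match ?E xs \<noteq> is_match ?E' xs))"
      by (intro mean_nonneg u.w_nonneg) auto
  qed (use \<rho> in simp)
  finally have transfer: "1 / 3888 - a - 2268 * \<rho> * \<beta> \<le> mean V ?u 6 ?f"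
    unfolding gain by (simp add: abs_le_iff)
  \<comment> \<open>Back to distinct vertices.\<close>
  have "mean V ?u 6 ?f \<le> mean V ?u 6 (\<lambda>xs. (of_bool (distinct xs \<and> is_match ?E' xs) - of_bool (distinct xs \<and> is_match ?E xs)) +
      of_bool ((is_match ?E xs \<noteq> is_match ?E' xs) \<and> \<not> distinct xs))"
    by (intro mean_mono u.w_nonneg) auto
  also have "\<dots> = 2 * (real (copies (colour_graph V c)) - real (copies G)) / n ^ 6 +
      mean V ?u 6 (\<lambda>xs. of_bool ((is_match ?E xs \<noteq> is_match ?E' xs) \<and> \<not> distinct xs))"
    using copies_eq_mean[OF G] copies_eq_mean[OF G']
    by (simp add: mean_add mean_diff V_def n_def diff_divide_distrib right_diff_distrib)
  also have "mean V ?u 6 (\<lambda>xs. of_bool ((is_match ?E xs \<noteq> is_match ?E' xs) \<and> \<not> distinct xs)) \<le> 25 / n * \<beta>"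
    using mean_match_diff_not_distinct_le[of V ?E ?E', OF fin cV(1) sym(1,2,3,4)] unfolding cV(2)[symmetric] \<beta>_eq .
  finally show ?thesis using transfer loss unfolding left_diff_distrib by linarith
qed

lemma edit_distance_le_square:
  assumes "simple_graph G"
  shows "real (edit_distance G C6_pattern) \<le> (real (card (verts G)))\<^sup>2"
proof -
  have "finite (verts G)" using assms by (simp add: simple_graph_def)
  then have "card (wrong_pairs G (\<lambda>_. 0)) \<le> card (verts G \<times> verts G)"
    by (intro card_mono) (auto simp: wrong_pairs_def)
  moreover have "2 * edit_distance G C6_pattern \<le> card (wrong_pairs G (\<lambda>_. 0))"
    by (rule edit_distance_colourings(1)[OF assms]) simp
  ultimately have "edit_distance G C6_pattern \<le> (card (verts G))\<^sup>2"
    by (simp add: card_cartesian_product power2_eq_square)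
  then show ?thesis by (metis of_nat_le_iff of_nat_power)
qed

lemma nearly_extremal_weights:
  assumes x: "weighted_hexagon x" and h: "1 / 3888 - \<epsilon> \<le> hexagon_density x" and \<epsilon>: "0 \<le> \<epsilon>" "\<epsilon> \<le> 1 / 7776"
    and c: "c < 6"
  shows "\<bar>x c - 1 / 6\<bar> \<le> 5 * sqrt (31104 * 7776 * \<epsilon>)"
proof (rule weight_diff_le[OF x c])
  interpret weighted_hexagon x by fact
  have imb: "0 \<le> imbalance" unfolding imbalance_def by (intro sum_nonneg) simp
  have "1 / 7776 * imbalance \<le> hexagon_density x * imbalance"
    using h \<epsilon>(2) imb by (intro mult_right_mono) auto
  also have "\<dots> \<le> 31104 * \<epsilon>"
    using hexagon_imbalance(2)[OF x] h by simp
  finally show "imbalance \<le> (sqrt (31104 * 7776 * \<epsilon>))\<^sup>2" using \<epsilon>(1) by simp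
qed (use \<epsilon> in simp)

text \<open>If \<open>G\<close> is nearly extremal then so is the closest blowup, as it differs from \<open>G\<close> in few pairs. Its
  parts are therefore nearly balanced.\<close>

lemma nearly_extremal_graph:
  fixes G :: graph
  defines "n \<equiv> real (card (verts G))"
  assumes G: "simple_graph G" and ne: "verts G \<noteq> {}"
    and md: "1 / 3888 - \<epsilon> \<le> mean (verts G) (\<lambda>_. 1 / n) 6 (\<lambda>xs. of_bool (is_match (adj G) xs))"
    and \<epsilon>: "0 \<le> \<epsilon>" "(1 + 36 * 31104 * 7776) * \<epsilon> \<le> 1 / 7776"
    and c: "\<And>x. c x < (6 :: nat)"
    and opt: "\<And>c'. (\<And>x. c' x < (6 :: nat)) \<Longrightarrow> card (wrong_pairs G c) \<le> card (wrong_pairs G c')"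
    and d: "d < 6"
  shows "\<bar>real (card {z \<in> verts G. c z = d}) / n - 1 / 6\<bar> \<le>
    5 * sqrt (31104 * 7776 * ((1 + 36 * 31104 * 7776) * \<epsilon>))"
proof -
  let ?V = "verts G"
  let ?E = "adj G"
  let ?E' = "adj (colour_graph ?V c)"
  let ?u = "\<lambda>_ :: nat. 1 / n"
  define m where "m = mean ?V ?u 6 (\<lambda>xs. of_bool (is_match ?E xs))"
  define \<beta> where "\<beta> = real (card (wrong_pairs G c)) / n\<^sup>2"
  have fin: "finite ?V" using G by (simp add: simple_graph_def)
  have n: "0 < n" using ne fin by (simp add: n_def card_gt_0_iff)
  have G': "simple_graph (colour_graph ?V c)" by (rule simple_graph_colour_graph[OF fin])
  have E': "?E' u v = hex (c u) (c v)" if "u \<in> ?V" "v \<in> ?V" for u v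
    using that by (simp add: adj_colour_graph)
  have sym: "?E u v = ?E v u" "\<not> ?E u u" "?E' u v = ?E' v u" "\<not> ?E' u u" for u v
    using simple_graph_irrefl[OF G] simple_graph_irrefl[OF G'] adj_sym by blast+
  have wg: "weighted_graph ?V ?u ?E" unfolding n_def by (rule weighted_graph_uniform[OF G ne])
  then interpret u: weighted_graph ?V ?u ?E .
  have err: "u.colour_error c' = real (card (wrong_pairs G c')) / n\<^sup>2" for c'
    using weighted_graph_uniform_colour_error[OF G ne] by (simp add: n_def)
  have \<beta>_eq: "(\<Sum>u\<in>?V. \<Sum>v\<in>?V. 1 / n * (1 / n) * of_bool (?E u v \<noteq> ?E' u v)) = \<beta>"
    using err[of c] E' by (simp add: u.colour_error_def \<beta>_def cong: sum.cong)
  obtain c' where c': "\<And>y. c' y < 6" "m * u.colour_error c' \<le> 31104 * (1 / 3888 - m)"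
    using core_inequality_colouring[OF wg] unfolding m_def by blast
  have "\<beta> \<le> u.colour_error c'"
    using opt[OF c'(1)] n unfolding err \<beta>_def by (intro divide_right_mono) auto
  moreover have "0 \<le> \<beta>" by (simp add: \<beta>_def)
  ultimately have "1 / 7776 * \<beta> \<le> m * u.colour_error c'"
    using md \<epsilon> by (intro mult_mono) (auto simp: m_def)
  also have "\<dots> \<le> 31104 * \<epsilon>" using c'(2) md by (simp add: m_def)
  finally have \<beta>: "\<beta> \<le> 31104 * 7776 * \<epsilon>" by simp
  let ?x = "\<lambda>d. \<Sum>y\<in>{y \<in> ?V. c y = d}. 1 / n"
  have "m - hexagon_density ?x = mean ?V ?u 6 (\<lambda>xs. of_bool (is_match ?E xs) - of_bool (is_match ?E' xs))"
    unfolding m_def mean_diff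
    using mean_match_colouring[of ?V c ?E', OF fin c E'] by simp
  also have "\<dots> \<le> mean ?V ?u 6 (\<lambda>xs. of_bool (is_match ?E xs \<noteq> is_match ?E' xs))"
    using n by (intro mean_mono) auto
  also have "\<dots> \<le> 36 * \<beta>"
    using n mean_match_diff_le[of ?V ?u ?E ?E', OF fin _ u.w_sum sym(1,2,3,4)] unfolding \<beta>_eq by simp
  finally have h: "1 / 3888 - (1 + 36 * 31104 * 7776) * \<epsilon> \<le> hexagon_density ?x"
    using md \<beta> unfolding m_def by (simp add: algebra_simps)
  have hexagon: "weighted_hexagon ?x"
  proof
    have "(\<Sum>d<6. ?x d) = (\<Sum>y\<in>?V. 1 / n)"
      using c by (intro sum.group fin) auto
    then show "(\<Sum>d<6. ?x d) = 1" using u.w_sum by simp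
  qed (use n in \<open>simp add: sum_nonneg\<close>)
  have "?x d = real (card {z \<in> ?V. c z = d}) / n" by simp
  then show ?thesis
    using nearly_extremal_weights[OF hexagon h _ \<epsilon>(2) d] \<epsilon>(1) by simp
qed

text \<open>Since \<open>max_density\<close> converges to \<open>5 / 54\<close>, a graph with density close to the maximum for its order
  also has match probability close to \<open>1 / 3888\<close>.\<close>

lemma eventually_nearly_extremal:
  fixes \<epsilon> :: real
  assumes "\<epsilon> > 0"
  shows "eventually (\<lambda>n. \<forall>G. simple_graph G \<and> card (verts G) = n \<and> max_density F50 n - induced_density F50 G \<le> 90 * \<epsilon> \<longrightarrow>
    1 / 3888 - \<epsilon> \<le> mean (verts G) (\<lambda>_. 1 / real n) 6 (\<lambda>xs. of_bool (is_match (adj G) xs))) sequentially"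
proof -
  have "(\<lambda>n. max_density F50 n / (360 * tuple_ratio n)) \<longlonglongrightarrow> (5 / 54) / (360 * 1)"
    by (intro tendsto_intros max_density_tendsto tuple_ratio_tendsto) simp
  then have "eventually (\<lambda>n. 1 / 3888 - \<epsilon> / 2 < max_density F50 n / (360 * tuple_ratio n)) sequentially"
    by (rule order_tendstoD) (use assms in simp)
  moreover have "eventually (\<lambda>n. 1 / 2 < tuple_ratio n) sequentially"
    using tuple_ratio_tendsto by (rule order_tendstoD) simp
  ultimately show ?thesis
    using eventually_gt_at_top[of 0]
  proof eventually_elim
    case (elim n)
    show ?case
    proof (intro allI impI, elim conjE)
      fix G assume G: "simple_graph G" "card (verts G) = n" "max_density F50 n - induced_density F50 G \<le> 90 * \<epsilon>"
      let ?c = "2 * real (copies G) / real n ^ 6"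
      have ne: "verts G \<noteq> {}" "finite (verts G)" using G elim(3) by (auto simp: simple_graph_def)
      have r: "0 < tuple_ratio n" using elim(2) by simp
      have "max_density F50 n / (360 * tuple_ratio n) \<le> (360 * tuple_ratio n * ?c + 90 * \<epsilon>) / (360 * tuple_ratio n)"
        using G(3) r induced_density_eq_ratio[OF ne] unfolding G(2) by (intro divide_right_mono) auto
      also have "\<dots> = ?c + \<epsilon> / (4 * tuple_ratio n)" using r by (simp add: add_divide_distrib)
      also have "\<epsilon> / (4 * tuple_ratio n) \<le> \<epsilon> / 2"
        using elim(2) assms by (intro divide_left_mono) auto
      finally have "1 / 3888 - \<epsilon> \<le> ?c" using elim(1) by simp
      then show "1 / 3888 - \<epsilon> \<le> mean (verts G) (\<lambda>_. 1 / real n) 6 (\<lambda>xs. of_bool (is_match (adj G) xs))"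
        using copies_bounds(1)[OF G(1) ne(1)] unfolding G(2) by (rule order_trans)
    qed
  qed
qed

text \<open>If the deficit \<open>\<delta>\<close> of \<open>G\<close> is bounded below, the claim is trivial for large \<open>C\<close> because at most \<open>n\<^sup>2\<close>
  edits are needed. Otherwise the closest blowup is nearly balanced, and \<open>copies_gain\<close> applies with
  an error term of at most half of the gain.\<close>

theorem perfect_stability: "perfectly_stable F50 C6_pattern"
proof -
  \<comment> \<open>The gain \<open>\<kappa>\<close> of \<open>copies_gain\<close> must exceed its two error terms. With the choice of \<open>\<rho>\<close> the first
      is \<open>\<kappa> / 4\<close>, and for large \<open>n\<close> so is the second at most. The parts deviate little enough for this
      \<open>\<rho>\<close> if the match probability of \<open>G\<close> is within \<open>\<epsilon>\<close> of \<open>1 / 3888\<close>; \<open>K\<close> is the factor by which this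
      distance grows in the passage from \<open>G\<close> to the closest blowup.\<close>
  define \<kappa> :: real where "\<kappa> = 1 / (8 * 3888 * 31104)"
  define \<rho> where "\<rho> = \<kappa> / (4 * 2268)"
  define s where "s = \<rho> / 60"
  define K :: real where "K = 1 + 36 * 31104 * 7776"
  define \<epsilon> where "\<epsilon> = s\<^sup>2 / (31104 * 7776 * K)"
  have pos: "0 < \<kappa>" "0 < \<rho>" "\<rho> \<le> 1 / 2" "0 < s" "s \<le> 1" "0 < K" "0 < \<epsilon>"
    by (simp_all add: \<kappa>_def \<rho>_def s_def K_def \<epsilon>_def)
  have \<epsilon>s: "sqrt (31104 * 7776 * (K * \<epsilon>)) = s" using pos by (simp add: \<epsilon>_def)
  have "K * \<epsilon> = s\<^sup>2 / (31104 * 7776)" using pos by (simp add: \<epsilon>_def)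
  also have "\<dots> \<le> 1 / (31104 * 7776)" using pos by (intro divide_right_mono) (auto intro: power_le_one)
  finally have K\<epsilon>: "K * \<epsilon> \<le> 1 / 7776" by simp
  have ratio: "eventually (\<lambda>n. 1 / 2 < tuple_ratio n) sequentially"
    using tuple_ratio_tendsto by (rule order_tendstoD) simp
  have "eventually (\<lambda>n. 1 / 2 < tuple_ratio n \<and> (\<forall>G. simple_graph G \<and> card (verts G) = n \<and>
      max_density F50 n - induced_density F50 G \<le> 90 * \<epsilon> \<longrightarrow>
      1 / 3888 - \<epsilon> \<le> mean (verts G) (\<lambda>_. 1 / real n) 6 (\<lambda>xs. of_bool (is_match (adj G) xs)))) sequentially"
    by (intro eventually_conj ratio eventually_nearly_extremal pos)
  then obtain N where N: "\<And>n. N \<le> n \<Longrightarrow> 1 / 2 < tuple_ratio n"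
    "\<And>G. simple_graph G \<Longrightarrow> N \<le> card (verts G) \<Longrightarrow>
      max_density F50 (card (verts G)) - induced_density F50 G \<le> 90 * \<epsilon> \<Longrightarrow>
      1 / 3888 - \<epsilon> \<le> mean (verts G) (\<lambda>_. 1 / real (card (verts G))) 6 (\<lambda>xs. of_bool (is_match (adj G) xs))"
    unfolding eventually_sequentially by blast
  define C where "C = 1 + real N + 100 / \<kappa> + 1 / (90 * \<epsilon>) + 1 / (180 * \<kappa>)"
  have C: "1 \<le> C" "real N \<le> C" "100 / \<kappa> \<le> C" "1 / (90 * \<epsilon>) \<le> C" "1 / (180 * \<kappa>) \<le> C"
  proof -
    have "0 \<le> 100 / \<kappa>" "0 \<le> 1 / (90 * \<epsilon>)" "0 \<le> 1 / (180 * \<kappa>)" using pos by simp_all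
    then show "1 \<le> C" "real N \<le> C" "100 / \<kappa> \<le> C" "1 / (90 * \<epsilon>) \<le> C" "1 / (180 * \<kappa>) \<le> C"
      unfolding C_def by linarith+
  qed
  have main: "real (edit_distance G C6_pattern) \<le>
      C * (max_density F50 (card (verts G)) - induced_density F50 G) * (real (card (verts G)))\<^sup>2"
    if G: "simple_graph G" and large: "C \<le> real (card (verts G))" for G
  proof -
    define n where "n = real (card (verts G))"
    define \<delta> where "\<delta> = max_density F50 (card (verts G)) - induced_density F50 G"
    have n: "1 \<le> n" "N \<le> card (verts G)" "100 / \<kappa> \<le> n"
      using large C unfolding n_def by linarith+
    have ne: "verts G \<noteq> {}" "finite (verts G)" using n(1) by (auto simp: n_def intro: card_ge_0_finite)
    have "real (edit_distance G C6_pattern) \<le> C * \<delta> * n\<^sup>2"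
    proof (cases "\<delta> \<le> 90 * \<epsilon>")
      case False
      then have "1 \<le> 1 / (90 * \<epsilon>) * \<delta>" using pos by (simp add: field_simps)
      also have "\<dots> \<le> C * \<delta>" using C False pos by (intro mult_right_mono) auto
      finally have "1 * n\<^sup>2 \<le> C * \<delta> * n\<^sup>2" by (intro mult_right_mono) auto
      then show ?thesis using edit_distance_le_square[OF G] unfolding n_def by linarith
    next
      case True
      obtain c where c: "\<And>x. c x < 6" "2 * edit_distance G C6_pattern = card (wrong_pairs G c)"
        using edit_distance_colourings(2)[OF G] by blast
      have opt: "card (wrong_pairs G c) \<le> card (wrong_pairs G c')" if "\<And>x. c' x < 6" for c'
        using edit_distance_colourings(1)[OF G, of c'] that c(2) by simp
      define \<beta> where "\<beta> = real (card (wrong_pairs G c)) / n\<^sup>2"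
      define G' where "G' = colour_graph (verts G) c"
      have G': "simple_graph G'" "verts G' = verts G"
        using simple_graph_colour_graph[OF ne(2)] by (simp_all add: G'_def)
      have "\<bar>real (card {z \<in> verts G. c z = d}) / n - 1 / 6\<bar> \<le> \<rho> / 12" if "d < 6" for d
        using nearly_extremal_graph[OF G ne(1) N(2)[OF G n(2) True[unfolded \<delta>_def]] _ _ c(1) opt that] pos
          K\<epsilon> \<epsilon>s by (simp add: n_def K_def s_def)
      then have gain: "(\<kappa> - 2268 * \<rho> - 25 / n) * \<beta> \<le> 2 * (real (copies G') - real (copies G)) / n ^ 6"
        using copies_gain[OF G ne(1) c(1) opt, of \<rho>] pos by (simp add: n_def \<beta>_def G'_def \<kappa>_def)
      have "25 / n \<le> \<kappa> / 4" using n pos by (simp add: field_simps)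
      then have "\<kappa> / 2 \<le> \<kappa> - 2268 * \<rho> - 25 / n" by (simp add: \<rho>_def)
      moreover have "0 \<le> \<beta>" by (simp add: \<beta>_def)
      ultimately have "\<kappa> / 2 * \<beta> \<le> (\<kappa> - 2268 * \<rho> - 25 / n) * \<beta>" by (rule mult_right_mono)
      then have gain': "\<kappa> / 2 * \<beta> \<le> 2 * (real (copies G') - real (copies G)) / n ^ 6"
        using gain by (rule order_trans)
      have "180 * (\<kappa> / 2 * \<beta>) \<le> 360 * tuple_ratio (card (verts G)) * (\<kappa> / 2 * \<beta>)"
        using N(1)[OF n(2)] pos \<open>0 \<le> \<beta>\<close> by (intro mult_right_mono) auto
      also have "\<dots> \<le> 360 * tuple_ratio (card (verts G)) * (2 * (real (copies G') - real (copies G)) / n ^ 6)"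
        using N(1)[OF n(2)] gain' by (intro mult_left_mono) auto
      also have "\<dots> = induced_density F50 G' - induced_density F50 G"
        using induced_density_eq_ratio[of G] induced_density_eq_ratio[of G'] ne
        by (simp add: G'(2) n_def right_diff_distrib diff_divide_distrib)
      also have "\<dots> \<le> \<delta>"
        using max_density_attained(2)[OF G'(1)] by (simp add: G'(2) \<delta>_def)
      finally have \<delta>: "90 * \<kappa> * \<beta> \<le> \<delta>" by (simp add: mult.commute)
      have "real (edit_distance G C6_pattern) = \<beta> / 2 * n\<^sup>2"
        using c(2) n(1) by (simp add: \<beta>_def flip: of_nat_mult) 
      also have "\<beta> / 2 = 1 / (180 * \<kappa>) * (90 * \<kappa> * \<beta>)" using pos by simp
      also have "\<dots> \<le> C * \<delta>"
        using C \<delta> pos \<open>0 \<le> \<beta>\<close> by (intro mult_mono) auto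
      finally show ?thesis by (simp add: mult_right_mono)
    qed
    then show ?thesis by (simp add: n_def \<delta>_def)
  qed
  show ?thesis
    unfolding perfectly_stable_def using C(1) main by (intro exI[of _ C]) auto
qed

theorem theorem3p20:
  shows "max_density F50 \<longlonglongrightarrow> inducibility F50 \<and> inducibility F50 = 5 / 54
    \<and> perfectly_stable F50 C6_pattern
    \<and> unique_maximiser_up_to_aut F50 C6_pattern (\<lambda>i. 1 / 6)"
proof -
  have eq: "inducibility F50 = 5 / 54"
    unfolding inducibility_def by (rule limI[OF max_density_tendsto])
  show ?thesis
    unfolding eq using max_density_tendsto perfect_stability unique_maximiser by blast
qed

end
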